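(* Let $n\ge1$, $0<q<1$, let $\lambda$ be a nonnegative integer, $t=q^\lambda$, let $x,y>0$ be real and let $\eta\in\mathbb{Z}_{\ge0}^n$ be a composition. Then $$\prod_{i=1}^n\int_0^1 d_qs_i\,s_i^{x-1}\frac{(qs_i;q)_\infty}{(q^{y}s_i;q)_\infty}\;E_\eta(s;q,t)\prod_{1\le i<j\le n}s_i^{2\lambda}\left(q^{1-\lambda}\tfrac{s_j}{s_i};q\right)_{2\lambda}$$ $$=q^{\lambda x\binom n2+2\lambda^2\binom n3}\,E_\eta(t^{\underline\delta};q,t)\prod_{i=1}^n\frac{\Gamma_q[\lambda i+1]\,\Gamma_q[x+\lambda(n-i)+\eta_i^+]\,\Gamma_q[y+\lambda(n-i)]}{\Gamma_q[\lambda+1]\,\Gamma_q[x+y+\lambda(2n-i-1)+\eta_i^+]},$$ where the left-hand side is the $n$-fold $q$-integral over $s=(s_1,\ldots,s_n)$ of the whole integrand.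
   Context: Non-symmetric Macdonald polynomials in variables $x_1,\ldots,x_n$ (here evaluated at $s$). The operator $\mathsf{s}_i$ interchanges $x_i$ and $x_{i+1}$ ($1\le i\le n-1$); $(\tau_i f)(x_1,\ldots,x_n)=f(x_1,\ldots,qx_i,\ldots,x_n)$; $T_i=t+\frac{tx_i-x_{i+1}}{x_i-x_{i+1}}(\mathsf{s}_i-1)$; $\omega=\mathsf{s}_{n-1}\cdots \mathsf{s}_1\tau_1$; $Y_i=t^{-n+i}T_i\cdots T_{n-1}\,\omega\,T_1^{-1}\cdots T_{i-1}^{-1}$ for $1\le i\le n$. For $\eta\in\mathbb{Z}_{\ge0}^n$ let $x^\eta=x_1^{\eta_1}\cdots x_n^{\eta_n}$, $|\eta|=\sum_i\eta_i$, $\eta^+$ the partition obtained by permuting the parts of $\eta$, and $l'_\eta(i)=\#\{k<i:\eta_k\ge\eta_i\}+\#\{k>i:\eta_k>\eta_i\}$. Dominance order on $n$-tuples: $\nu<\eta$ iff $\nu\ne\eta$ and $\sum_{i=1}^p(\eta_i-\nu_i)\ge0$ for all $1\le p\le n$. For $|\nu|=|\eta|$: $\nu\prec\eta$ iff $\nu^+<\eta^+$, or $\nu^+=\eta^+$ and $\nu<\eta$. $E_\eta(x;q,t)$ is the unique polynomial of the form $x^\eta+\sum_{\nu\prec\eta}b_{\eta\nu}x^\nu$ with $Y_iE_\eta=q^{\eta_i}t^{-l'_\eta(i)}E_\eta$ for all $1\le i\le n$ (for $\lambda=0$ it is understood as the limit $t\to1$). Further notation. $(z;q)_\infty=\prod_{i\ge0}(1-zq^i)$,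 $(z;q)_m=\prod_{i=0}^{m-1}(1-zq^i)$. $q$-gamma function: $\Gamma_q[u]=\frac{(q;q)_\infty}{(q^u;q)_\infty}(1-q)^{1-u}$. $q$-integral: $\int_0^1f(s)\,d_qs=(1-q)\sum_{j=0}^\infty f(q^j)q^j$, and iterated in each variable. $t^{\underline\delta}=(1,t,\ldots,t^{n-1})$. *)

theory Defs
  imports "HOL-Analysis.Analysis" "HOL-Library.Poly_Mapping"
begin

text \<open>
  A polynomial is a finitely supported map from exponent vectors to real coefficients. The
  variables are indexed by all natural numbers; only \<open>x\<^sub>1, \<dots>, x\<^sub>n\<close> occur below. A composition
  \<open>\<eta>\<close> with \<open>n\<close> parts is an exponent vector supported in \<open>{1..n}\<close>.
\<close>

type_synonym expvec = "nat \<Rightarrow>\<^sub>0 nat"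
type_synonym mpoly = "expvec \<Rightarrow>\<^sub>0 real"

definition Const :: "real \<Rightarrow> mpoly" where
  "Const c = Poly_Mapping.single 0 c"

definition monomial :: "expvec \<Rightarrow> mpoly" where
  "monomial \<nu> = Poly_Mapping.single \<nu> 1"

definition Var :: "nat \<Rightarrow> mpoly" where
  "Var i = monomial (Poly_Mapping.single i 1)"

text \<open>Coefficients are mapped by \<open>h\<close> and the variable \<open>x\<^sub>i\<close> is replaced by \<open>\<sigma> i\<close>.\<close>

definition insertion :: "(real \<Rightarrow> 'r) \<Rightarrow> (nat \<Rightarrow> 'r) \<Rightarrow> mpoly \<Rightarrow> 'r::comm_semiring_1" where
  "insertion h \<sigma> p =
     (\<Sum>m\<in>Poly_Mapping.keys p. h (Poly_Mapping.lookup p m) *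
        (\<Prod>i\<in>Poly_Mapping.keys m. \<sigma> i ^ Poly_Mapping.lookup m i))"

definition peval :: "mpoly \<Rightarrow> (nat \<Rightarrow> real) \<Rightarrow> real" where
  "peval p s = insertion id s p"

definition psubst :: "(nat \<Rightarrow> mpoly) \<Rightarrow> mpoly \<Rightarrow> mpoly" where
  "psubst \<sigma> p = insertion Const \<sigma> p"

definition swap_op :: "nat \<Rightarrow> mpoly \<Rightarrow> mpoly" where
  "swap_op i = psubst (Var(i := Var (Suc i), Suc i := Var i))"

definition shift_op :: "real \<Rightarrow> nat \<Rightarrow> mpoly \<Rightarrow> mpoly" where
  "shift_op q i = psubst (Var(i := Const q * Var i))"

text \<open>
  The quotient \<open>(s\<^sub>i f - f) / (x\<^sub>i - x\<^sub>i\<^sub>+\<^sub>1)\<close>: the division is exact, and the quotient is unique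
  because polynomials form an integral domain.
\<close>

definition div_diff :: "nat \<Rightarrow> mpoly \<Rightarrow> mpoly" where
  "div_diff i f = (THE g. (Var i - Var (Suc i)) * g = swap_op i f - f)"

definition T_op :: "real \<Rightarrow> nat \<Rightarrow> mpoly \<Rightarrow> mpoly" where
  "T_op t i f = Const t * f + (Const t * Var i - Var (Suc i)) * div_diff i f"

text \<open>\<open>\<omega> = s\<^sub>n\<^sub>-\<^sub>1 \<cdots> s\<^sub>1 \<tau>\<^sub>1\<close>; the operator \<open>\<tau>\<^sub>1\<close> is applied first and \<open>s\<^sub>n\<^sub>-\<^sub>1\<close> last.\<close>

definition omega_op :: "nat \<Rightarrow> real \<Rightarrow> mpoly \<Rightarrow> mpoly" where
  "omega_op n q f = fold swap_op [1..<n] (shift_op q 1 f)"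

text \<open>
  \<open>Y\<^sub>i = t\<^sup>-\<^sup>n\<^sup>+\<^sup>i T\<^sub>i \<cdots> T\<^sub>n\<^sub>-\<^sub>1 \<omega> T\<^sub>1\<^sup>-\<^sup>1 \<cdots> T\<^sub>i\<^sub>-\<^sub>1\<^sup>-\<^sup>1\<close>. For \<open>t \<noteq> 0\<close> the operator \<open>T\<^sub>j\<close> is a bijection on
  polynomials, since \<open>(T\<^sub>j - t) (T\<^sub>j + 1) = 0\<close>, so that \<open>inv\<close> is its two-sided inverse.
\<close>

definition Y_op :: "nat \<Rightarrow> real \<Rightarrow> real \<Rightarrow> nat \<Rightarrow> mpoly \<Rightarrow> mpoly" where
  "Y_op n q t i f =
     Const (t powi (int i - int n)) *
       foldr (T_op t) [i..<n] (omega_op n q (foldr (\<lambda>j. inv (T_op t j)) [1..<i] f))"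

definition partition_of :: "nat \<Rightarrow> (nat \<Rightarrow> nat) \<Rightarrow> nat \<Rightarrow> nat" where
  "partition_of n \<eta> i = rev (sort (map \<eta> [1..<Suc n])) ! (i - 1)"

definition dominance_less :: "nat \<Rightarrow> (nat \<Rightarrow> nat) \<Rightarrow> (nat \<Rightarrow> nat) \<Rightarrow> bool" where
  "dominance_less n \<nu> \<eta> \<longleftrightarrow>
     (\<exists>i\<in>{1..n}. \<nu> i \<noteq> \<eta> i) \<and>
     (\<forall>p\<in>{1..n}. (\<Sum>i=1..p. int (\<eta> i) - int (\<nu> i)) \<ge> 0)"

definition comp_less :: "nat \<Rightarrow> (nat \<Rightarrow> nat) \<Rightarrow> (nat \<Rightarrow> nat) \<Rightarrow> bool" where
  "comp_less n \<nu> \<eta> \<longleftrightarrow>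
     (\<Sum>i=1..n. \<nu> i) = (\<Sum>i=1..n. \<eta> i) \<and>
     (dominance_less n (partition_of n \<nu>) (partition_of n \<eta>) \<or>
      (\<forall>i\<in>{1..n}. partition_of n \<nu> i = partition_of n \<eta> i) \<and> dominance_less n \<nu> \<eta>)"

definition leg' :: "nat \<Rightarrow> (nat \<Rightarrow> nat) \<Rightarrow> nat \<Rightarrow> nat" where
  "leg' n \<eta> i =
     card {k \<in> {1..n}. k < i \<and> \<eta> k \<ge> \<eta> i} + card {k \<in> {1..n}. k > i \<and> \<eta> k > \<eta> i}"

definition lower_comps :: "nat \<Rightarrow> expvec \<Rightarrow> expvec set" where
  "lower_comps n \<eta> = {\<nu>. Poly_Mapping.keys \<nu> \<subseteq> {1..n} \<and>
     comp_less n (Poly_Mapping.lookup \<nu>) (Poly_Mapping.lookup \<eta>)}"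

lemma finite_lower_comps: "finite (lower_comps n \<eta>)"
proof -
  define N where "N = (\<Sum>i=1..n. Poly_Mapping.lookup \<eta> i)"
  have "Poly_Mapping.lookup ` lower_comps n \<eta>
          \<subseteq> {f. \<forall>i. (i \<in> {1..n} \<longrightarrow> f i \<in> {..N}) \<and> (i \<notin> {1..n} \<longrightarrow> f i = 0)}"
  proof (intro image_subsetI CollectI allI conjI impI)
    fix \<nu> i assume \<nu>: "\<nu> \<in> lower_comps n \<eta>"
    show "Poly_Mapping.lookup \<nu> i \<in> {..N}" if "i \<in> {1..n}"
    proof -
      have "Poly_Mapping.lookup \<nu> i \<le> (\<Sum>i=1..n. Poly_Mapping.lookup \<nu> i)"
        using that by (intro member_le_sum) auto
      also have "\<dots> = N" using \<nu> by (simp add: lower_comps_def comp_less_def N_def)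
      finally show ?thesis by simp
    qed
    show "Poly_Mapping.lookup \<nu> i = 0" if "i \<notin> {1..n}"
      using \<nu> that by (auto simp: lower_comps_def subset_iff in_keys_iff)
  qed
  moreover have "finite {f. \<forall>i. (i \<in> {1..n} \<longrightarrow> f i \<in> {..N}) \<and> (i \<notin> {1..n} \<longrightarrow> f i = (0::nat))}"
    by (intro finite_set_of_finite_funs) auto
  ultimately have "finite (Poly_Mapping.lookup ` lower_comps n \<eta>)"
    by (rule finite_subset)
  then show ?thesis
    by (rule finite_imageD) (simp add: inj_on_def)
qed

definition is_nonsym_macdonald :: "nat \<Rightarrow> real \<Rightarrow> real \<Rightarrow> expvec \<Rightarrow> mpoly \<Rightarrow> bool" where
  "is_nonsym_macdonald n q t \<eta> E \<longleftrightarrow>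
     (\<exists>b :: expvec \<Rightarrow> real.
        E = monomial \<eta> + (\<Sum>\<nu>\<in>lower_comps n \<eta>. Const (b \<nu>) * monomial \<nu>)) \<and>
     (\<forall>i\<in>{1..n}. Y_op n q t i E =
        Const (q ^ Poly_Mapping.lookup \<eta> i * t powi (- int (leg' n (Poly_Mapping.lookup \<eta>) i))) * E)"

definition nonsym_macdonald :: "nat \<Rightarrow> real \<Rightarrow> real \<Rightarrow> expvec \<Rightarrow> mpoly" where
  "nonsym_macdonald n q t \<eta> = (THE E. is_nonsym_macdonald n q t \<eta> E)"

text \<open>The value \<open>E\<^sub>\<eta>(s; q, t)\<close>; at \<open>t = 1\<close> it is understood as the limit \<open>t \<rightarrow> 1\<close>.\<close>

definition macdonald_E :: "nat \<Rightarrow> expvec \<Rightarrow> (nat \<Rightarrow> real) \<Rightarrow> real \<Rightarrow> real \<Rightarrow> real" where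
  "macdonald_E n \<eta> s q t =
     (if t = 1 then Lim (at 1) (\<lambda>u. peval (nonsym_macdonald n q u \<eta>) s)
      else peval (nonsym_macdonald n q t \<eta>) s)"

definition qpoch_inf :: "real \<Rightarrow> real \<Rightarrow> real" where
  "qpoch_inf z q = prodinf (\<lambda>i. 1 - z * q ^ i)"

definition qpoch :: "real \<Rightarrow> real \<Rightarrow> nat \<Rightarrow> real" where
  "qpoch z q m = (\<Prod>i<m. 1 - z * q ^ i)"

definition qGamma :: "real \<Rightarrow> real \<Rightarrow> real" where
  "qGamma q u = qpoch_inf q q / qpoch_inf (q powr u) q * (1 - q) powr (1 - u)"

definition qintegral :: "real \<Rightarrow> (real \<Rightarrow> real) \<Rightarrow> real" where
  "qintegral q f = (1 - q) * suminf (\<lambda>j. f (q ^ j) * q ^ j)"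

text \<open>
  The iterated integral in the listed variables, the first one outermost; \<open>s\<close> provides the
  values of the remaining variables.
\<close>

fun qintegral_iter :: "real \<Rightarrow> nat list \<Rightarrow> ((nat \<Rightarrow> real) \<Rightarrow> real) \<Rightarrow> (nat \<Rightarrow> real) \<Rightarrow> real" where
  "qintegral_iter q [] F s = F s"
| "qintegral_iter q (i # is) F s = qintegral q (\<lambda>u. qintegral_iter q is F (s(i := u)))"

definition multi_qintegral :: "nat \<Rightarrow> real \<Rightarrow> ((nat \<Rightarrow> real) \<Rightarrow> real) \<Rightarrow> real" where
  "multi_qintegral n q F = qintegral_iter q [1..<Suc n] F (\<lambda>_. 0)"

end

theory Submission
  imports Defs
begin

text \<open>
  Let \<open>L\<close> be the \<open>q\<close>-integral of a polynomial against the weight of the theorem, as a function of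
  \<open>X = q\<^sup>x\<close>. Exchanging \<open>s\<^sub>i\<close> and \<open>s\<^sub>i\<^sub>+\<^sub>1\<close> shows \<open>L (T\<^sub>i f) = t L f\<close>, and the substitution
  \<open>(s\<^sub>1, \<dots>, s\<^sub>n) \<mapsto> (q s\<^sub>n, s\<^sub>1, \<dots>, s\<^sub>n\<^sub>-\<^sub>1)\<close> gives
  \<open>L ((1 - x\<^sub>1) f) = X t\<^sup>n\<^sup>-\<^sup>1 L ((1 - q\<^sup>y x\<^sub>n) \<omega> f)\<close>. If \<open>Y\<^sub>1 f = z f\<close>, these two facts express
  \<open>L (x\<^sub>n \<omega> f)\<close> through \<open>L f\<close>. Applying this along \<open>E, x\<^sub>n \<omega> E, \<dots>, (x\<^sub>n \<omega>)\<^sup>n E = q\<^bsup>|\<eta>|\<^esup> x\<^sub>1 \<cdots> x\<^sub>n E\<close>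
  relates \<open>L E\<close> at \<open>q X\<close> to \<open>L E\<close> at \<open>X\<close>. As \<open>X \<rightarrow> 0\<close>, the integral is dominated by the single
  point \<open>s = (1, t, \<dots>, t\<^sup>n\<^sup>-\<^sup>1)\<close>, which produces the factor \<open>E (1, t, \<dots>, t\<^sup>n\<^sup>-\<^sup>1)\<close>.

  The polynomials \<open>E\<close> themselves are built from \<open>1\<close> with the operator \<open>x\<^sub>n \<omega>\<close> and the intertwiners
  \<open>T\<^sub>i + c\<close>. Their leading terms are followed in an order finer than the one that defines \<open>E\<close>,
  because the dominance order on compositions is not preserved by exchanging two parts.
\<close>

section \<open>Polynomials and substitutions\<close>

text \<open>The Hecke part works for arbitrary nonzero q and t, because at \<lambda> = 0 the
  polynomial is a limit t -> 1. Every eigenvector comes from one recipe, rational in t, whose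
  denominators are powers of t and differences of two neighbouring eigenvalues at an ascent. These
  differences are nonzero at \<open>t = q ^ lam\<close> and for t near 1, so the recipe taken at t =
  1 yields both an eigenvector and the limit. Uniqueness needs no matrix entries of Y: the
  eigenvectors already built show that Y preserves the spans in question, and their spectra differ.

  On the integral side X stays variable, since the product of all variables turns X into q X. The
  recursion fixes the integral up to its behaviour as X -> 0. Coordinates \<open>q ^ a\<close> and
  \<open>q ^ b\<close> with indices i < j make the weight vanish unless
  \<open>a + lam \<le> b\<close> or \<open>b + lam < a\<close>. This makes
  \<open>lam * (n choose 2)\<close> the least total exponent on the support, attained only at the
  point named above, and it is the power of X to divide by before the limit.\<close>

abbreviation lookup where "lookup \<equiv> Poly_Mapping.lookup"
abbreviation adj :: "nat \<Rightarrow> nat \<Rightarrow> nat" where "adj i \<equiv> Transposition.transpose i (Suc i)"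
abbreviation keys where "keys \<equiv> Poly_Mapping.keys"

lemma poly_mapping_sum_single: "(\<Sum>m\<in>keys p. Poly_Mapping.single m (lookup p m)) = p"
  by (rule poly_mapping_eqI)
     (auto simp: lookup_sum lookup_single when_def in_keys_iff sum.delta)

lemma Const_add: "Const (a + b) = Const a + Const b"
  and Const_mult: "Const (a * b) = Const a * Const b"
  and Const_diff: "Const (a - b) = Const a - Const b"
  and Const_uminus: "Const (- a) = - Const a"
  and Const_0 [simp]: "Const 0 = 0"
  and Const_1 [simp]: "Const 1 = 1"
  and Const_eq_0_iff [simp]: "Const a = 0 \<longleftrightarrow> a = 0"
proof -
  show "Const a = 0 \<longleftrightarrow> a = 0"
    unfolding Const_def by (metis lookup_single_eq lookup_zero single_zero)
qed (simp_all add: Const_def single_add mult_single single_diff single_uminus)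

lemma Const_power: "Const (a ^ k) = Const a ^ k"
  by (induction k) (simp_all add: Const_mult)

lemma Const_mult_inverse: "a \<noteq> 0 \<Longrightarrow> Const a * Const (inverse a) = 1"
  by (simp flip: Const_mult)

lemma lookup_Const_mult [simp]: "lookup (Const c * p) m = c * lookup p m"
proof -
  have "Const c * p = Poly_Mapping.map ((*) c) p"
    by (simp add: Const_def mult_map_scale_conv_mult)
  then show ?thesis by (simp add: Poly_Mapping.map.rep_eq when_def)
qed

lemma keys_Const_mult: "keys (Const c * p) \<subseteq> keys p"
  by (auto simp: in_keys_iff)

lemma lookup_monomial: "lookup (monomial m) k = (if k = m then 1 else 0)"
  by (simp add: monomial_def lookup_single when_def)

lemma keys_monomial [simp]: "keys (monomial m) = {m}"
  by (auto simp: in_keys_iff lookup_monomial split: if_splits)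

lemma monomial_0 [simp]: "monomial 0 = 1"
  by (simp add: monomial_def)

lemma monomial_add: "monomial (a + b) = monomial a * monomial b"
  by (simp add: monomial_def mult_single)

lemma monomial_sum: "monomial (\<Sum>i\<in>A. f i) = (\<Prod>i\<in>A. monomial (f i))"
  by (induction A rule: infinite_finite_induct) (simp_all add: monomial_add)

lemma monomial_single: "monomial (Poly_Mapping.single i k) = Var i ^ k"
proof (induction k)
  case (Suc k)
  have "Poly_Mapping.single i (Suc k) = Poly_Mapping.single i 1 + Poly_Mapping.single i k"
    by (simp flip: single_add)
  then show ?case by (simp add: monomial_add Suc Var_def)
qed simp

lemma monomial_eq_prod_Var: "monomial m = (\<Prod>i\<in>keys m. Var i ^ lookup m i)"
  by (subst poly_mapping_sum_single[of m, symmetric]) (simp only: monomial_sum monomial_single)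

lemma mpoly_eq_sum_monomials: "(\<Sum>m\<in>keys p. Const (lookup p m) * monomial m) = p"
  using poly_mapping_sum_single[of p] by (simp add: Const_def monomial_def mult_single)

lemma mpoly_eq_sum_monomials':
  assumes "finite S" "keys p \<subseteq> S"
  shows "p = (\<Sum>m\<in>S. Const (lookup p m) * monomial m)"
proof -
  have "(\<Sum>m\<in>S. Const (lookup p m) * monomial m) = (\<Sum>m\<in>keys p. Const (lookup p m) * monomial m)"
    using assms by (intro sum.mono_neutral_right) (auto simp: in_keys_iff)
  then show ?thesis by (simp add: mpoly_eq_sum_monomials)
qed

text \<open>Constants and variables generate the polynomial ring. With this induction, identities
  between substitutions need only be checked on variables.\<close>

lemma mpoly_induct [case_names Const Var add mult]:
  assumes C: "\<And>c. P (Const c)" and V: "\<And>i. P (Var i)"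
    and A: "\<And>p q. P p \<Longrightarrow> P q \<Longrightarrow> P (p + q)" and M: "\<And>p q. P p \<Longrightarrow> P q \<Longrightarrow> P (p * q)"
  shows "P p"
proof -
  have 1: "P 1" using C[of 1] by simp
  have pw: "P (q ^ k)" if "P q" for q k
    using that by (induction k) (auto intro: 1 M)
  have "P (\<Prod>i\<in>A. Var i ^ f i)" for A and f :: "nat \<Rightarrow> nat"
    by (induction A rule: infinite_finite_induct) (auto intro: 1 M pw V)
  then have mono: "P (monomial m)" for m
    by (simp add: monomial_eq_prod_Var)
  have "P (\<Sum>m\<in>A. Const (f m) * monomial m)" for A f
  proof (induction A rule: infinite_finite_induct)
    case (insert x F)
    then show ?case by (auto intro!: A M mono C)
  qed (use C[of 0] in auto)
  then show ?thesis using mpoly_eq_sum_monomials[of p] by metis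
qed

section \<open>Evaluation and substitution homomorphisms\<close>

lemma prod_keys_eq_superset:
  assumes "finite S" "keys m \<subseteq> S"
  shows "(\<Prod>i\<in>keys m. (\<sigma> i :: 'r::comm_semiring_1) ^ lookup m i) = (\<Prod>i\<in>S. \<sigma> i ^ lookup m i)"
  using assms by (intro prod.mono_neutral_left) (auto simp: in_keys_iff)

lemma prod_keys_add:
  "(\<Prod>i\<in>keys (a + b). (\<sigma> i :: 'r::comm_semiring_1) ^ lookup (a + b) i) =
     (\<Prod>i\<in>keys a. \<sigma> i ^ lookup a i) * (\<Prod>i\<in>keys b. \<sigma> i ^ lookup b i)"
proof -
  let ?S = "keys a \<union> keys b"
  have "keys (a + b) \<subseteq> ?S" by (rule Poly_Mapping.keys_add)
  then show ?thesis
    by (subst (1 2 3) prod_keys_eq_superset[of ?S])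
       (auto simp: lookup_add power_add prod.distrib)
qed

text \<open>Treats the two uses of \<open>insertion\<close> at once: evaluation at a real point,
  with \<open>h = id\<close>, and substitution of polynomials for variables, with
  \<open>h = Const\<close>.\<close>

locale coeff_hom =
  fixes h :: "real \<Rightarrow> 'r::comm_ring_1"
  assumes h_0: "h 0 = 0" and h_1: "h 1 = 1"
    and h_add: "h (a + b) = h a + h b" and h_mult: "h (a * b) = h a * h b"
begin

lemma insertion_superset:
  assumes "finite S" "keys p \<subseteq> S"
  shows "insertion h \<sigma> p = (\<Sum>m\<in>S. h (lookup p m) * (\<Prod>i\<in>keys m. \<sigma> i ^ lookup m i))"
  unfolding insertion_def
  using assms by (intro sum.mono_neutral_left) (auto simp: in_keys_iff h_0)

lemma insertion_add: "insertion h \<sigma> (p + q) = insertion h \<sigma> p + insertion h \<sigma> q"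
proof -
  let ?S = "keys p \<union> keys q"
  have "keys (p + q) \<subseteq> ?S" by (rule Poly_Mapping.keys_add)
  then show ?thesis
    by (simp add: insertion_superset[of ?S] lookup_add h_add distrib_right sum.distrib)
qed

lemma insertion_sum: "insertion h \<sigma> (\<Sum>a\<in>A. f a) = (\<Sum>a\<in>A. insertion h \<sigma> (f a))"
proof -
  have "insertion h \<sigma> 0 = 0" by (simp add: insertion_def)
  then show ?thesis
    by (induction A rule: infinite_finite_induct) (simp_all add: insertion_add)
qed

lemma insertion_single:
  "insertion h \<sigma> (Poly_Mapping.single m c) = h c * (\<Prod>i\<in>keys m. \<sigma> i ^ lookup m i)"
  by (subst insertion_superset[of "{m}"]) auto

lemma insertion_mult: "insertion h \<sigma> (p * q) = insertion h \<sigma> p * insertion h \<sigma> q"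
proof -
  have "p * q = (\<Sum>a\<in>keys p. \<Sum>b\<in>keys q.
          Poly_Mapping.single (a + b) (lookup p a * lookup q b))"
    using arg_cong2[OF poly_mapping_sum_single[of p] poly_mapping_sum_single[of q], of "(*)"]
    by (simp add: sum_product mult_single)
  then have "insertion h \<sigma> (p * q) = (\<Sum>a\<in>keys p. \<Sum>b\<in>keys q.
     (h (lookup p a) * (\<Prod>i\<in>keys a. \<sigma> i ^ lookup a i)) *
     (h (lookup q b) * (\<Prod>i\<in>keys b. \<sigma> i ^ lookup b i)))"
    by (simp add: insertion_sum insertion_single h_mult prod_keys_add mult_ac)
  then show ?thesis by (simp add: insertion_def sum_product)
qed

lemma insertion_Const: "insertion h \<sigma> (Const c) = h c"
  by (simp add: Const_def insertion_single)

lemma insertion_Var: "insertion h \<sigma> (Var i) = \<sigma> i"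
  by (simp add: Var_def monomial_def insertion_single h_1)

end

interpretation id_hom: coeff_hom "id :: real \<Rightarrow> real"
  by standard auto

interpretation Const_hom: coeff_hom Const
  by standard (auto simp: Const_add Const_mult)

lemma peval_add [simp]: "peval (p + q) s = peval p s + peval q s"
  and peval_mult [simp]: "peval (p * q) s = peval p s * peval q s"
  and peval_Const [simp]: "peval (Const c) s = c"
  and peval_Var [simp]: "peval (Var i) s = s i"
  and peval_sum [simp]: "peval (\<Sum>a\<in>A. f a) s = (\<Sum>a\<in>A. peval (f a) s)"
  by (simp_all add: peval_def id_hom.insertion_add id_hom.insertion_mult id_hom.insertion_Const
        id_hom.insertion_Var id_hom.insertion_sum)

lemma peval_0 [simp]: "peval 0 s = 0" and peval_1 [simp]: "peval 1 s = 1"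
  using peval_Const[of 0 s] peval_Const[of 1 s] by simp_all

lemma peval_uminus [simp]: "peval (- p) s = - peval p s"
  using peval_add[of "- p" p s] by simp

lemma peval_diff [simp]: "peval (p - q) s = peval p s - peval q s"
  using peval_add[of p "- q" s] by simp

text \<open>Fixing \<open>Const\<close> makes the map unital and linear over the reals, so that its
  values on the variables determine it.\<close>

definition alg_hom :: "(mpoly \<Rightarrow> mpoly) \<Rightarrow> bool" where
  "alg_hom \<phi> \<longleftrightarrow> (\<forall>p q. \<phi> (p + q) = \<phi> p + \<phi> q) \<and> (\<forall>p q. \<phi> (p * q) = \<phi> p * \<phi> q) \<and>
     (\<forall>c. \<phi> (Const c) = Const c)"

lemma alg_hom_add: "alg_hom \<phi> \<Longrightarrow> \<phi> (p + q) = \<phi> p + \<phi> q"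
  and alg_hom_mult: "alg_hom \<phi> \<Longrightarrow> \<phi> (p * q) = \<phi> p * \<phi> q"
  and alg_hom_Const: "alg_hom \<phi> \<Longrightarrow> \<phi> (Const c) = Const c"
  by (simp_all add: alg_hom_def)

lemma alg_hom_0: "alg_hom \<phi> \<Longrightarrow> \<phi> 0 = 0" and alg_hom_1: "alg_hom \<phi> \<Longrightarrow> \<phi> 1 = 1"
  using alg_hom_Const[of \<phi> 0] alg_hom_Const[of \<phi> 1] by simp_all

lemma alg_hom_diff: "alg_hom \<phi> \<Longrightarrow> \<phi> (p - q) = \<phi> p - \<phi> q"
  using alg_hom_add[of \<phi> "p - q" q] by simp

lemma alg_hom_power: "alg_hom \<phi> \<Longrightarrow> \<phi> (p ^ k) = \<phi> p ^ k"
  by (induction k) (simp_all add: alg_hom_mult alg_hom_1)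

lemma alg_hom_prod: "alg_hom \<phi> \<Longrightarrow> \<phi> (\<Prod>a\<in>A. f a) = (\<Prod>a\<in>A. \<phi> (f a))"
  by (induction A rule: infinite_finite_induct) (simp_all add: alg_hom_mult alg_hom_1)

lemmas alg_hom_simps = alg_hom_add alg_hom_mult alg_hom_Const alg_hom_0 alg_hom_1 alg_hom_diff
  alg_hom_power alg_hom_prod

lemma alg_hom_comp: "alg_hom \<phi> \<Longrightarrow> alg_hom \<psi> \<Longrightarrow> alg_hom (\<lambda>p. \<phi> (\<psi> p))"
  by (simp add: alg_hom_def)

lemma alg_hom_id: "alg_hom (\<lambda>p. p)"
  by (simp add: alg_hom_def)

lemma alg_hom_psubst: "alg_hom (psubst \<sigma>)"
  by (simp add: alg_hom_def psubst_def Const_hom.insertion_add Const_hom.insertion_mult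
        Const_hom.insertion_Const)

lemma psubst_Var: "psubst \<sigma> (Var i) = \<sigma> i"
  by (simp add: psubst_def Const_hom.insertion_Var)

lemma alg_hom_eqI:
  assumes "alg_hom \<phi>" "alg_hom \<psi>" "\<And>i. \<phi> (Var i) = \<psi> (Var i)"
  shows "\<phi> p = \<psi> p"
  using assms(3) by (induction p rule: mpoly_induct) (simp_all add: alg_hom_simps assms(1,2))

lemma peval_alg_hom:
  assumes "alg_hom \<phi>"
  shows "peval (\<phi> p) s = peval p (\<lambda>i. peval (\<phi> (Var i)) s)"
  by (induction p rule: mpoly_induct) (simp_all add: alg_hom_simps assms)

lemma alg_hom_swap: "alg_hom (swap_op i)"
  unfolding swap_op_def by (rule alg_hom_psubst)

lemma alg_hom_shift: "alg_hom (shift_op q i)"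
  unfolding shift_op_def by (rule alg_hom_psubst)

lemma alg_hom_fold_swap: "alg_hom (fold swap_op is)"
proof (induction "is")
  case Nil
  then show ?case by (simp add: alg_hom_def)
next
  case (Cons a as)
  have "alg_hom (\<lambda>p. fold swap_op as (swap_op a p))"
    by (rule alg_hom_comp[OF Cons alg_hom_swap])
  then show ?case by (simp add: comp_def)
qed

lemma alg_hom_omega: "alg_hom (omega_op n q)"
  unfolding omega_op_def [abs_def] by (rule alg_hom_comp[OF alg_hom_fold_swap alg_hom_shift])

lemma swap_Var: "swap_op i (Var k) = Var (adj i k)"
  by (simp add: swap_op_def psubst_Var Transposition.transpose_def)

lemma shift_Var: "shift_op q i (Var k) = (if k = i then Const q * Var k else Var k)"
  by (simp add: shift_op_def psubst_Var)

lemma swap_swap [simp]: "swap_op i (swap_op i p) = p"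
  by (rule alg_hom_eqI[OF alg_hom_comp[OF alg_hom_swap alg_hom_swap] alg_hom_id])
     (simp add: swap_Var)

text \<open>\<open>Var 1\<close> is carried up by every swap in turn, while each
  \<open>Var k\<close> with \<open>1 < k \<le> m\<close> is moved only by the swap
  \<open>k - 1\<close>, which lowers its index.\<close>

lemma fold_swap_Var:
  assumes "1 \<le> m"
  shows "fold swap_op [1..<m] (Var k) =
    (if k = 1 then Var m else if 1 < k \<and> k \<le> m then Var (k - 1) else Var k)"
  using assms
proof (induction m rule: dec_induct)
  case (step m)
  then show ?case by (auto simp: swap_Var Transposition.transpose_def)
qed auto

lemma omega_Var:
  assumes "1 \<le> n"
  shows "omega_op n q (Var k) =
    (if k = 1 then Const q * Var n else if 1 < k \<and> k \<le> n then Var (k - 1) else Var k)"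
  using fold_swap_Var[OF assms] unfolding omega_op_def
  by (auto simp: shift_Var alg_hom_simps[OF alg_hom_fold_swap])

section \<open>The operators T\<close>

abbreviation swap_factor :: "nat \<Rightarrow> mpoly" where
  "swap_factor i \<equiv> Var i - Var (Suc i)"

lemma Var_eq_iff [simp]: "Var i = Var j \<longleftrightarrow> i = j"
proof
  assume "Var i = Var j"
  then have "peval (Var i) (\<lambda>k. if k = i then 1 else 0) = peval (Var j) (\<lambda>k. if k = i then 1 else 0)"
    by simp
  then show "i = j" by (simp split: if_splits)
qed simp

lemma swap_factor_neq_0 [simp]: "swap_factor i \<noteq> 0"
  by simp

text \<open>The difference \<open>swap_op i f - f\<close> obeys a twisted Leibniz rule, so
  divisibility passes from the variables to all products.\<close>

lemma swap_factor_dvd: "swap_factor i dvd swap_op i f - f"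
proof (induction f rule: mpoly_induct)
  case (Const c)
  then show ?case by (simp add: alg_hom_simps[OF alg_hom_swap])
next
  case (Var k)
  show ?case
  proof (cases "k = i")
    case True
    have "swap_op i (Var k) - Var k = swap_factor i * (- 1)"
      using True by (simp add: swap_Var)
    then show ?thesis by (metis dvd_triv_left)
  next
    case False
    then show ?thesis by (auto simp: swap_Var Transposition.transpose_def)
  qed
next
  case (add p q)
  have "swap_op i (p + q) - (p + q) = (swap_op i p - p) + (swap_op i q - q)"
    by (simp add: alg_hom_simps[OF alg_hom_swap])
  then show ?case using add by (metis dvd_add)
next
  case (mult p q)
  have "swap_op i (p * q) - p * q = swap_op i p * (swap_op i q - q) + q * (swap_op i p - p)"
    by (simp add: alg_hom_simps[OF alg_hom_swap] algebra_simps)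
  then show ?case using mult by (metis dvd_add dvd_mult)
qed

lemma div_diff_eq: "swap_factor i * div_diff i f = swap_op i f - f"
proof -
  obtain g where g: "swap_op i f - f = swap_factor i * g"
    using swap_factor_dvd by (auto simp: dvd_def)
  have "\<exists>!g. swap_factor i * g = swap_op i f - f"
    by (rule ex1I[of _ g]) (auto simp: g)
  then show ?thesis unfolding div_diff_def by (rule theI')
qed

text \<open>With the denominator cleared, \<open>T\<close> is expressed by \<open>f\<close> and its
  swap alone. Identities for \<open>T\<close> are proved in this form, and \<open>T_op_eqI\<close>
  cancels the factor again.\<close>

lemma T_op_eq:
  "swap_factor i * T_op t i f =
     (Const t * Var i - Var (Suc i)) * swap_op i f + (1 - Const t) * Var (Suc i) * f"
proof -
  have "swap_factor i * T_op t i f = Const t * swap_factor i * f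
      + (Const t * Var i - Var (Suc i)) * (swap_factor i * div_diff i f)"
    unfolding T_op_def by (simp only: algebra_simps)
  then show ?thesis unfolding div_diff_eq by (simp add: algebra_simps)
qed

lemma T_op_eqI:
  assumes "swap_factor i * g =
     (Const t * Var i - Var (Suc i)) * swap_op i f + (1 - Const t) * Var (Suc i) * f"
  shows "T_op t i f = g"
proof -
  have "swap_factor i * T_op t i f = swap_factor i * g"
    by (simp only: assms T_op_eq)
  then show ?thesis using swap_factor_neq_0[of i] mult_left_cancel by blast
qed

lemma T_op_add: "T_op t i (f + g) = T_op t i f + T_op t i g"
  by (rule T_op_eqI) (simp only: distrib_left T_op_eq, simp add: alg_hom_simps[OF alg_hom_swap] algebra_simps)

text \<open>Symmetric factors pass through the divided difference. Besides scalars and the variables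
  other than \<open>Var i\<close> and \<open>Var (Suc i)\<close>, this covers symmetric combinations
  of these two.\<close>

lemma T_op_invariant_mult:
  assumes "swap_op i p = p"
  shows "T_op t i (p * f) = p * T_op t i f"
proof (rule T_op_eqI)
  have "swap_factor i * (p * T_op t i f) = p * (swap_factor i * T_op t i f)"
    by (simp only: mult_ac)
  then show "swap_factor i * (p * T_op t i f) = (Const t * Var i - Var (Suc i)) * swap_op i (p * f)
      + (1 - Const t) * Var (Suc i) * (p * f)"
    unfolding T_op_eq by (simp add: alg_hom_simps[OF alg_hom_swap] assms algebra_simps)
qed

lemma T_op_Const_mult: "T_op t i (Const c * f) = Const c * T_op t i f"
  by (rule T_op_invariant_mult) (simp add: alg_hom_simps[OF alg_hom_swap])

lemma T_op_Var_mult: "k \<noteq> i \<Longrightarrow> k \<noteq> Suc i \<Longrightarrow> T_op t i (Var k * f) = Var k * T_op t i f"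
  by (rule T_op_invariant_mult) (simp add: swap_Var)

lemma T_op_diff: "T_op t i (f - g) = T_op t i f - T_op t i g"
  using T_op_add[of t i "f - g" g] by simp

lemma T_op_1: "T_op t i 1 = Const t"
  by (rule T_op_eqI) (simp add: alg_hom_simps[OF alg_hom_swap] algebra_simps)

lemma T_op_Var_Suc: "T_op t i (Var (Suc i) * f) = Var i * T_op t i f + (Const t - 1) * Var (Suc i) * f"
proof (rule T_op_eqI)
  have "swap_factor i * (Var i * T_op t i f + (Const t - 1) * Var (Suc i) * f) =
      Var i * (swap_factor i * T_op t i f) + swap_factor i * ((Const t - 1) * Var (Suc i) * f)"
    by (simp only: algebra_simps)
  then show "swap_factor i * (Var i * T_op t i f + (Const t - 1) * Var (Suc i) * f) =
     (Const t * Var i - Var (Suc i)) * swap_op i (Var (Suc i) * f)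
        + (1 - Const t) * Var (Suc i) * (Var (Suc i) * f)"
    unfolding T_op_eq by (simp add: alg_hom_simps[OF alg_hom_swap] swap_Var algebra_simps)
qed

text \<open>\<open>Var i + Var (Suc i)\<close> is symmetric and passes through \<open>T\<close>, so
  the rule follows from the one for \<open>Var (Suc i)\<close>.\<close>

lemma T_op_Var: "T_op t i (Var i * f) = Var (Suc i) * T_op t i f - (Const t - 1) * Var (Suc i) * f"
proof -
  have "T_op t i ((Var i + Var (Suc i)) * f) = (Var i + Var (Suc i)) * T_op t i f"
    by (rule T_op_invariant_mult) (simp add: alg_hom_simps[OF alg_hom_swap] swap_Var)
  then have "T_op t i (Var i * f) + T_op t i (Var (Suc i) * f) = (Var i + Var (Suc i)) * T_op t i f"
    by (simp only: distrib_right T_op_add)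
  then show ?thesis
    unfolding T_op_Var_Suc by (simp add: algebra_simps eq_diff_eq)
qed

text \<open>After multiplication by the square of \<open>a - b\<close>, equation \<open>1\<close>
  and its image under the swap eliminate \<open>h\<close> and its swap, and both sides become
  combinations of \<open>f\<close> and \<open>sf\<close>.\<close>

lemma T_op_quadratic: "T_op t i (T_op t i f) = (Const t - 1) * T_op t i f + Const t * f"
proof -
  define a b c h where defs: "a = Var i" "b = Var (Suc i)" "c = Const t" "h = T_op t i f"
  define sf sh where defs2: "sf = swap_op i f" "sh = swap_op i h"
  have 1: "(a - b) * h = (c * a - b) * sf + (1 - c) * b * f"
    using T_op_eq[of i t f] by (simp only: defs defs2)
  have 2: "(b - a) * sh = (c * b - a) * f + (1 - c) * a * sf"
    using arg_cong[OF 1, of "swap_op i"]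
    by (simp only: defs defs2 alg_hom_simps[OF alg_hom_swap] swap_Var swap_swap) simp
  have 3: "(a - b) * T_op t i h = (c * a - b) * sh + (1 - c) * b * h"
    using T_op_eq[of i t h] by (simp only: defs defs2)
  have "(a - b) * ((a - b) * T_op t i h) = (a - b) * ((a - b) * ((c - 1) * h + c * f))"
  proof -
    have "(a - b) * ((a - b) * T_op t i h) = (1 - c) * b * ((a - b) * h) - (c * a - b) * ((b - a) * sh)"
      unfolding 3 by (simp add: algebra_simps)
    also have "\<dots> = (a - b) * ((c - 1) * ((a - b) * h) + (a - b) * (c * f))"
      unfolding 1 2 by (simp add: algebra_simps)
    also have "\<dots> = (a - b) * ((a - b) * ((c - 1) * h + c * f))"
      by (simp only: algebra_simps)
    finally show ?thesis .
  qed
  moreover have "a - b \<noteq> 0" unfolding defs by simp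
  ultimately show ?thesis unfolding defs(3,4) [symmetric] by simp
qed

text \<open>A common scalar \<open>c\<close> is allowed because \<open>T\<close> depends only on the
  ratio of the two variables. It occurs for the square of \<omega>, which sends \<open>Var 1\<close>
  and \<open>Var 2\<close> to \<open>q\<close> times the last two variables.\<close>

lemma alg_hom_T_op:
  assumes \<phi>: "alg_hom \<phi>" and c: "c \<noteq> 0"
    and swap: "\<And>k. \<phi> (swap_op i (Var k)) = swap_op j (\<phi> (Var k))"
    and V: "\<phi> (Var i) = Const c * Var j" "\<phi> (Var (Suc i)) = Const c * Var (Suc j)"
  shows "\<phi> (T_op t i f) = T_op t j (\<phi> f)"
proof (rule T_op_eqI[symmetric])
  have sw: "\<phi> (swap_op i f) = swap_op j (\<phi> f)"
    by (rule alg_hom_eqI[where \<phi> = "\<lambda>f. \<phi> (swap_op i f)" and \<psi> = "\<lambda>f. swap_op j (\<phi> f)"])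
       (simp_all add: alg_hom_comp[OF \<phi> alg_hom_swap] alg_hom_comp[OF alg_hom_swap \<phi>] swap)
  have "Const c * (swap_factor j * \<phi> (T_op t i f)) = \<phi> (swap_factor i * T_op t i f)"
    by (simp add: alg_hom_simps[OF \<phi>] V algebra_simps)
  also have "\<dots> = Const c * ((Const t * Var j - Var (Suc j)) * swap_op j (\<phi> f)
        + (1 - Const t) * Var (Suc j) * \<phi> f)"
    unfolding T_op_eq by (simp add: alg_hom_simps[OF \<phi>] V sw algebra_simps)
  finally show "swap_factor j * \<phi> (T_op t i f) = (Const t * Var j - Var (Suc j)) * swap_op j (\<phi> f)
        + (1 - Const t) * Var (Suc j) * \<phi> f"
    using c by simp
qed

lemma T_op_commute:
  assumes "Suc i < j \<or> Suc j < i"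
  shows "T_op t i (T_op t j f) = T_op t j (T_op t i f)"
proof (rule T_op_eqI[symmetric, of j])
  have sw: "swap_op j (T_op t i f) = T_op t i (swap_op j f)"
    by (rule alg_hom_T_op[OF alg_hom_swap, of 1])
       (use assms in \<open>auto simp: swap_Var Transposition.transpose_def\<close>)
  have T: "T_op t i (p * f) = p * T_op t i f" if "swap_op i p = p" for p f
    using that by (rule T_op_invariant_mult)
  have "swap_factor j * T_op t i (T_op t j f) = T_op t i (swap_factor j * T_op t j f)"
    by (rule T[symmetric]) (use assms in \<open>auto simp: swap_Var alg_hom_simps[OF alg_hom_swap]\<close>)
  also have "\<dots> = (Const t * Var j - Var (Suc j)) * T_op t i (swap_op j f) 
      + (1 - Const t) * Var (Suc j) * T_op t i f"
    unfolding T_op_eq T_op_add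
    by (subst (1 2) T) (use assms in \<open>auto simp: swap_Var alg_hom_simps[OF alg_hom_swap]\<close>)
  finally show "swap_factor j * T_op t i (T_op t j f) =
    (Const t * Var j - Var (Suc j)) * swap_op j (T_op t i f) + (1 - Const t) * Var (Suc j) * T_op t i f"
    unfolding sw .
qed

text \<open>Multiplied by the product of the three differences, each side becomes the same
  combination \<open>R\<close> of the images of \<open>f\<close> under the six permutations of three
  variables.\<close>

lemma T_op_braid:
  "T_op t i (T_op t (Suc i) (T_op t i f)) = T_op t (Suc i) (T_op t i (T_op t (Suc i) f))"
proof -
  define s1 s2 where s: "s1 = swap_op i" "s2 = swap_op (Suc i)"
  define A B C c where d: "A = Var i" "B = Var (Suc i)" "C = Var (Suc (Suc i))" "c = Const t"
  have hom: "alg_hom s1" "alg_hom s2" unfolding s by (rule alg_hom_swap)+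
  have V: "s1 A = B" "s1 B = A" "s1 C = C" "s2 A = A" "s2 B = C" "s2 C = B"
    unfolding s d by (simp_all add: swap_Var)
  have ss: "s1 (s1 p) = p" "s2 (s2 p) = p" for p unfolding s by simp_all
  have br: "s2 (s1 (s2 p)) = s1 (s2 (s1 p))" for p
    unfolding s
    by (rule alg_hom_eqI[where \<phi> = "\<lambda>p. swap_op (Suc i) (swap_op i (swap_op (Suc i) p))"
          and \<psi> = "\<lambda>p. swap_op i (swap_op (Suc i) (swap_op i p))"])
       (auto simp: swap_Var Transposition.transpose_def
         intro: alg_hom_comp[OF alg_hom_swap alg_hom_comp[OF alg_hom_swap alg_hom_swap]])
  have cc: "s1 c = c" "s2 c = c" unfolding s d by (simp_all add: alg_hom_simps[OF alg_hom_swap])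
  have T1: "(A - B) * T_op t i p = (c * A - B) * s1 p + (1 - c) * B * p" for p
    unfolding s d by (rule T_op_eq)
  have T2: "(B - C) * T_op t (Suc i) p = (c * B - C) * s2 p + (1 - c) * C * p" for p
    unfolding s d by (rule T_op_eq)
  note ap = V cc ss br alg_hom_simps[OF hom(1)] alg_hom_simps[OF hom(2)]
  have nz: "A - B \<noteq> 0" "B - C \<noteq> 0" "A - C \<noteq> 0" unfolding d by auto
  \<comment> \<open>The coefficient of \<open>f\<close> at which both computations arrive, in
    \<open>X\<close> and in \<open>X'\<close>.\<close>
  define G where "G = c * (B - C) * A - c * B * B + (1 - c + c * c) * B * C"
  define R where "R = (c * A - B) * (c * A - C) * (c * B - C) * s1 (s2 (s1 f))
    + (1 - c) * C * (c * A - B) * (c * A - C) * s1 (s2 f)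
    + (1 - c) * B * (c * B - C) * (c * A - C) * s2 (s1 f)
    + (1 - c) * (1 - c) * B * C * (c * B - C) * s2 f
    + (1 - c) * (1 - c) * C * C * (c * A - B) * s1 f + (1 - c) * C * G * f"
  define h where "h = T_op t i f"
  define k where "k = T_op t (Suc i) h"
  define m where "m = T_op t i k"
  define h' where "h' = T_op t (Suc i) f"
  define k' where "k' = T_op t i h'"
  define m' where "m' = T_op t (Suc i) k'"
  have e1: "(A - B) * h = (c * A - B) * s1 f + (1 - c) * B * f"
    unfolding h_def by (rule T1)
  have e2: "(B - C) * k = (c * B - C) * s2 h + (1 - c) * C * h"
    unfolding k_def by (rule T2)
  have e3: "(A - B) * m = (c * A - B) * s1 k + (1 - c) * B * k"
    unfolding m_def by (rule T1)
  have e4: "(A - C) * s2 h = (c * A - C) * s2 (s1 f) + (1 - c) * C * s2 f"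
    using arg_cong[OF e1, of s2] by (simp only: ap)
  have e5: "(B - A) * s1 h = (c * B - A) * f + (1 - c) * A * s1 f"
    using arg_cong[OF e1, of s1] by (simp only: ap)
  have e6: "(B - C) * s1 (s2 h) = (c * B - C) * s1 (s2 (s1 f)) + (1 - c) * C * s1 (s2 f)"
    using arg_cong[OF e4, of s1] by (simp only: ap)
  have e7: "(A - C) * s1 k = (c * A - C) * s1 (s2 h) + (1 - c) * C * s1 h"
    using arg_cong[OF e2, of s1] by (simp only: ap)
  \<comment> \<open>Each of \<open>h\<close> and \<open>s1 h\<close> has the denominator
    \<open>A - B\<close>; in this combination it cancels and leaves polynomial coefficients.\<close>
  have X: "(c * A - B) * (B - C) * s1 h + (1 - c) * B * (A - C) * h
      = (1 - c) * (c * A - B) * C * s1 f + G * f"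
  proof -
    have "(A - B) * ((c * A - B) * (B - C) * s1 h + (1 - c) * B * (A - C) * h)
       = (A - B) * ((1 - c) * (c * A - B) * C * s1 f + G * f)"
    proof -
      have "(A - B) * ((c * A - B) * (B - C) * s1 h + (1 - c) * B * (A - C) * h)
         = (1 - c) * B * (A - C) * ((A - B) * h) - (c * A - B) * (B - C) * ((B - A) * s1 h)"
        by (simp add: algebra_simps)
      also have "\<dots> = (A - B) * ((1 - c) * (c * A - B) * C * s1 f + G * f)"
        unfolding e1 e5 G_def by (simp add: algebra_simps)
      finally show ?thesis .
    qed
    then show ?thesis using nz by simp
  qed
  have m: "(A - B) * (A - C) * (B - C) * m = R"
  proof -
    have "(A - B) * (A - C) * (B - C) * m =
       (c * A - B) * (B - C) * ((A - C) * s1 k) + (1 - c) * B * (A - C) * ((B - C) * k)"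
    proof -
      have "(A - B) * (A - C) * (B - C) * m = (A - C) * (B - C) * ((A - B) * m)"
        by (simp only: mult_ac)
      then show ?thesis unfolding e3 by (simp add: algebra_simps)
    qed
    also have "\<dots> = (c * A - B) * (c * A - C) * ((B - C) * s1 (s2 h))
       + (1 - c) * B * (c * B - C) * ((A - C) * s2 h)
       + (1 - c) * C * ((c * A - B) * (B - C) * s1 h + (1 - c) * B * (A - C) * h)"
      unfolding e7 e2 by (simp only: algebra_simps)
    also have "\<dots> = R"
      unfolding e6 e4 X R_def by (simp only: algebra_simps)
    finally show ?thesis .
  qed
  have g1: "(B - C) * h' = (c * B - C) * s2 f + (1 - c) * C * f"
    unfolding h'_def by (rule T2)
  have g2: "(A - B) * k' = (c * A - B) * s1 h' + (1 - c) * B * h'"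
    unfolding k'_def by (rule T1)
  have g3: "(B - C) * m' = (c * B - C) * s2 k' + (1 - c) * C * k'"
    unfolding m'_def by (rule T2)
  have g4: "(A - C) * s1 h' = (c * A - C) * s1 (s2 f) + (1 - c) * C * s1 f"
    using arg_cong[OF g1, of s1] by (simp only: ap)
  have g5: "(C - B) * s2 h' = (c * C - B) * f + (1 - c) * B * s2 f"
    using arg_cong[OF g1, of s2] by (simp only: ap)
  have g6: "(A - B) * s2 (s1 h') = (c * A - B) * s1 (s2 (s1 f)) + (1 - c) * B * s2 (s1 f)"
    using arg_cong[OF g4, of s2] by (simp only: ap)
  have g7: "(A - C) * s2 k' = (c * A - C) * s2 (s1 h') + (1 - c) * C * s2 h'"
    using arg_cong[OF g2, of s2] by (simp only: ap)
  have X': "(c * B - C) * (A - B) * s2 h' + (1 - c) * B * (A - C) * h'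
      = (1 - c) * (c * B - C) * B * s2 f + G * f"
  proof -
    have "(B - C) * ((c * B - C) * (A - B) * s2 h' + (1 - c) * B * (A - C) * h')
       = (B - C) * ((1 - c) * (c * B - C) * B * s2 f + G * f)"
    proof -
      have "(B - C) * ((c * B - C) * (A - B) * s2 h' + (1 - c) * B * (A - C) * h')
         = (1 - c) * B * (A - C) * ((B - C) * h') - (c * B - C) * (A - B) * ((C - B) * s2 h')"
        by (simp add: algebra_simps)
      also have "\<dots> = (B - C) * ((1 - c) * (c * B - C) * B * s2 f + G * f)"
        unfolding g1 g5 G_def by (simp add: algebra_simps)
      finally show ?thesis .
    qed
    then show ?thesis using nz by simp
  qed
  have m': "(A - B) * (A - C) * (B - C) * m' = R"
  proof -
    have "(A - B) * (A - C) * (B - C) * m' =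
       (c * B - C) * (A - B) * ((A - C) * s2 k') + (1 - c) * C * (A - C) * ((A - B) * k')"
    proof -
      have "(A - B) * (A - C) * (B - C) * m' = (A - B) * (A - C) * ((B - C) * m')"
        by (simp only: mult_ac)
      then show ?thesis unfolding g3 by (simp add: algebra_simps)
    qed
    also have "\<dots> = (c * B - C) * (c * A - C) * ((A - B) * s2 (s1 h'))
       + (1 - c) * C * (c * A - B) * ((A - C) * s1 h')
       + (1 - c) * C * ((c * B - C) * (A - B) * s2 h' + (1 - c) * B * (A - C) * h')"
      unfolding g7 g2 by (simp only: algebra_simps)
    also have "\<dots> = R"
      unfolding g6 g4 X' R_def by (simp only: algebra_simps)
    finally show ?thesis .
  qed
  have "(A - B) * (A - C) * (B - C) * m = (A - B) * (A - C) * (B - C) * m'"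
    by (simp only: m m')
  then have "m = m'" using nz by simp
  then show ?thesis unfolding m_def m'_def k_def k'_def h_def h'_def .
qed

section \<open>The operators Y\<close>

definition mlinear :: "(mpoly \<Rightarrow> mpoly) \<Rightarrow> bool" where
  "mlinear \<phi> \<longleftrightarrow> (\<forall>f g. \<phi> (f + g) = \<phi> f + \<phi> g) \<and> (\<forall>c f. \<phi> (Const c * f) = Const c * \<phi> f)"

lemma mlinear_add: "mlinear \<phi> \<Longrightarrow> \<phi> (f + g) = \<phi> f + \<phi> g"
  and mlinear_Const: "mlinear \<phi> \<Longrightarrow> \<phi> (Const c * f) = Const c * \<phi> f"
  by (simp_all add: mlinear_def)

lemma mlinear_0: "mlinear \<phi> \<Longrightarrow> \<phi> 0 = 0"
  using mlinear_Const[of \<phi> 0 0] by simp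

lemma mlinear_uminus: "mlinear \<phi> \<Longrightarrow> \<phi> (- f) = - \<phi> f"
  using mlinear_Const[of \<phi> "- 1" f] by (simp add: Const_uminus)

lemma mlinear_diff: "mlinear \<phi> \<Longrightarrow> \<phi> (f - g) = \<phi> f - \<phi> g"
  using mlinear_add[of \<phi> f "- g"] by (simp add: mlinear_uminus)

lemma mlinear_sum: "mlinear \<phi> \<Longrightarrow> \<phi> (\<Sum>a\<in>A. f a) = (\<Sum>a\<in>A. \<phi> (f a))"
  by (induction A rule: infinite_finite_induct) (simp_all add: mlinear_0 mlinear_add)

lemma mlinear_comp: "mlinear \<phi> \<Longrightarrow> mlinear \<psi> \<Longrightarrow> mlinear (\<lambda>f. \<phi> (\<psi> f))"
  by (simp add: mlinear_def)

lemma mlinear_foldr: "(\<And>j. mlinear (F j)) \<Longrightarrow> mlinear (foldr F js)"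
  by (induction js) (simp_all add: mlinear_def)

lemma mlinear_mult: "mlinear ((*) p)"
  by (simp add: mlinear_def algebra_simps)

lemma mlinear_alg_hom: "alg_hom \<phi> \<Longrightarrow> mlinear \<phi>"
  by (simp add: mlinear_def alg_hom_def)

lemma mlinear_T_op: "mlinear (T_op t i)"
  by (simp add: mlinear_def T_op_add T_op_Const_mult)

lemma upt_split: "i \<le> j \<Longrightarrow> j \<le> k \<Longrightarrow> [i..<k] = [i..<j] @ [j..<k]"
  using upt_add_eq_append[of i j "k - j"] by simp

lemma foldr_intertwine:
  assumes "\<And>j f. j \<in> set js \<Longrightarrow> \<phi> (F (s j) f) = G j (\<phi> f)"
  shows "\<phi> (foldr F (map s js) f) = foldr G js (\<phi> f)"
  using assms by (induction js) auto

lemma foldr_commute_with: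
  assumes "\<And>j f. j \<in> set js \<Longrightarrow> \<phi> (F j f) = F j (\<phi> f)"
  shows "\<phi> (foldr F js f) = foldr F js (\<phi> f)"
  using foldr_intertwine[of js \<phi> F id F f] assms by simp

text \<open>The parameter \<open>t\<close> is arbitrary apart from \<open>t \<noteq> 0\<close>,
  because the value at \<open>t = 1\<close> is reached through all nearby values.\<close>

locale hecke =
  fixes n :: nat and q t :: real
  assumes n_ge_1: "1 \<le> n" and t_nz: "t \<noteq> 0" and q_nz: "q \<noteq> 0"
begin

abbreviation "T \<equiv> T_op t"
abbreviation "Ti \<equiv> \<lambda>i. inv (T_op t i)"
abbreviation "\<omega> \<equiv> omega_op n q"
abbreviation "Y \<equiv> Y_op n q t"

text \<open>The quadratic relation supplies the candidate \<open>S\<close>; being a two-sided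
  inverse, it equals \<open>inv (T_op t i)\<close>.\<close>

lemma
  shows Ti_eq: "Ti i f = Const (inverse t) * (T i f - (Const t - 1) * f)"
    and T_Ti [simp]: "T i (Ti i f) = f" and Ti_T [simp]: "Ti i (T i f) = f"
proof -
  define S where "S = (\<lambda>f. Const (inverse t) * (T i f - (Const t - 1) * f))"
  have c: "T i ((Const t - 1) * f) = (Const t - 1) * T i f" for f
    using T_op_Const_mult[of t i "t - 1" f] by (simp add: Const_diff)
  have t: "Const (inverse t) * (Const t * f) = f" for f
    using t_nz by (simp add: mult.assoc[symmetric] flip: Const_mult)
  have 1: "T i (S f) = f" "S (T i f) = f" for f
    unfolding S_def by (simp_all add: T_op_Const_mult T_op_diff c T_op_quadratic t)
  then have "Ti i = S"
    by (intro inv_unique_comp) (auto simp: fun_eq_iff)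
  then show "Ti i f = Const (inverse t) * (T i f - (Const t - 1) * f)" 
    "T i (Ti i f) = f" "Ti i (T i f) = f"
    by (simp_all add: 1, simp add: S_def)
qed

lemma Ti_intertwine:
  assumes "\<And>f. \<phi> (T i f) = T j (\<phi> f)"
  shows "\<phi> (Ti i f) = Ti j (\<phi> f)"
  by (metis T_Ti Ti_T assms)

lemma Ti_Var_mult: "k \<noteq> i \<Longrightarrow> k \<noteq> Suc i \<Longrightarrow> Ti i (Var k * f) = Var k * Ti i f"
  by (rule Ti_intertwine[of "(*) (Var k)", symmetric]) (simp add: T_op_Var_mult)

lemma mlinear_Ti: "mlinear (Ti i)"
  unfolding mlinear_def
proof (intro conjI allI)
  show "Ti i (f + g) = Ti i f + Ti i g" for f g
    by (metis T_Ti Ti_T T_op_add)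
  show "Ti i (Const c * f) = Const c * Ti i f" for c f
    by (rule Ti_intertwine[of "(*) (Const c)", symmetric]) (simp add: T_op_Const_mult)
qed

lemma Const_t_Ti: "Const t * Ti i f = T i f - (Const t - 1) * f"
  using t_nz unfolding Ti_eq by (simp add: mult.assoc[symmetric] flip: Const_mult)

lemma alg_hom_omega': "alg_hom \<omega>"
  by (rule alg_hom_omega)

lemmas omega_simps = alg_hom_simps[OF alg_hom_omega'] omega_Var[OF n_ge_1]

lemma mlinear_omega: "mlinear \<omega>"
  by (rule mlinear_alg_hom[OF alg_hom_omega'])

lemma Y_eq: "Y i f = Const (t powi (int i - int n)) *
    foldr T [i..<n] (\<omega> (foldr Ti [1..<i] f))"
  by (simp add: Y_op_def)

lemma mlinear_Y: "mlinear (Y i)"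
  unfolding Y_eq [abs_def]
  by (rule mlinear_comp[OF mlinear_mult mlinear_comp[OF mlinear_foldr[OF mlinear_T_op]
        mlinear_comp[OF mlinear_omega mlinear_foldr[OF mlinear_Ti]]]])

text \<open>In this range no index wraps around: \<omega> lowers both indices by one and does not
  rescale.\<close>

lemma omega_T:
  assumes "1 \<le> i" "Suc i < n"
  shows "\<omega> (T (Suc i) f) = T i (\<omega> f)"
proof (rule alg_hom_T_op[OF alg_hom_omega', of 1])
  show "\<omega> (swap_op (Suc i) (Var k)) = swap_op i (\<omega> (Var k))" for k
    using assms by (auto simp: swap_Var omega_simps alg_hom_simps[OF alg_hom_swap]
        Transposition.transpose_def)
qed (use assms in \<open>auto simp: omega_simps\<close>)

lemma omega_Ti:
  assumes "1 \<le> i" "Suc i < n"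
  shows "\<omega> (Ti (Suc i) f) = Ti i (\<omega> f)"
  by (rule Ti_intertwine) (rule omega_T[OF assms])

text \<open>A single \<omega> wraps \<open>Var 1\<close> around but not \<open>Var 2\<close>. The
  second one wraps the other variable, after which both carry the factor \<open>q\<close> and are
  neighbours in the right order.\<close>

lemma omega_omega_T:
  assumes "2 \<le> n"
  shows "\<omega> (\<omega> (T 1 f)) = T (n - 1) (\<omega> (\<omega> f))"
proof (rule alg_hom_T_op[OF alg_hom_comp[OF alg_hom_omega' alg_hom_omega'] q_nz])
  show "\<omega> (\<omega> (swap_op 1 (Var k))) = swap_op (n - 1) (\<omega> (\<omega> (Var k)))" for k
  proof -
    consider "k = 0" | "k = 1" | "k = 2" | "2 < k \<and> k \<le> n" | "n < k" by linarith
    then show ?thesis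
      using assms by cases (auto simp: swap_Var omega_simps alg_hom_simps[OF alg_hom_swap]
        Transposition.transpose_def)
  qed
qed (use assms in \<open>auto simp: omega_simps\<close>)

lemma omega_omega_Ti: "2 \<le> n \<Longrightarrow> \<omega> (\<omega> (Ti 1 f)) = Ti (n - 1) (\<omega> (\<omega> f))"
  by (rule Ti_intertwine[where \<phi> = "\<lambda>f. \<omega> (\<omega> f)"]) (rule omega_omega_T)

text \<open>Carrying the variable through turns \<open>T\<close> into its inverse, up to
  \<open>t\<close>. This accounts for the extra inverse of \<open>Y (Suc i)\<close> in
  \<open>Y_raise\<close>.\<close>

lemma T_Var: "T i (Var i * f) = Const t * (Var (Suc i) * Ti i f)"
proof -
  have "Const t * (Var (Suc i) * Ti i f) = Var (Suc i) * (Const t * Ti i f)"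
    by (simp only: mult_ac)
  then show ?thesis
    unfolding Const_t_Ti T_op_Var by (simp add: algebra_simps)
qed

lemma Ti_Var_Suc: "Ti i (Var (Suc i) * f) = Const (inverse t) * (Var i * T i f)"
  unfolding Ti_eq T_op_Var_Suc by (simp add: mult.assoc)

lemma Ti_T_commute: "Suc i < j \<or> Suc j < i \<Longrightarrow> Ti i (T j f) = T j (Ti i f)"
  by (rule Ti_intertwine[symmetric]) (metis T_op_commute)

lemma Ti_Ti_T: "Ti j (Ti (Suc j) (T j f)) = T (Suc j) (Ti j (Ti (Suc j) f))"
proof -
  have "T j f = T (Suc j) (T j (T (Suc j) (Ti j (Ti (Suc j) f))))"
    by (simp flip: T_op_braid)
  then show ?thesis by simp
qed

lemma powi_Suc: "t powi (int (Suc i) - int n) = t powi (int i - int n) * t"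
proof -
  have "int (Suc i) - int n = (int i - int n) + 1" by simp
  then show ?thesis using t_nz by (simp only: power_int_add_1 simp_thms)
qed

text \<open>The inverses \<open>Ti j\<close> in \<open>Y i\<close> pass \<open>Var n\<close> and
  become \<open>Ti (Suc j)\<close> behind \<omega>. Then \<omega> turns \<open>Var n\<close> into
  \<open>Var (n - 1)\<close>, which changes \<open>T (n - 1)\<close> into its inverse, and through
  two factors \<omega> that inverse becomes \<open>Ti 1\<close>. So one \<open>T\<close> is lost and
  one \<open>Ti\<close> is gained, as in \<open>Y (Suc i)\<close>.\<close>

lemma Y_raise:
  assumes "1 \<le> i" "i < n"
  shows "Y i (Var n * \<omega> f) = Var n * \<omega> (Y (Suc i) f)"
proof -
  have n2: "2 \<le> n" using assms by simp
  define g where "g = foldr Ti [2..<Suc i] f"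
  have s: "map Suc [a..<b] = [Suc a..<Suc b]" for a b by (rule map_Suc_upt)
  have "foldr Ti [1..<i] (Var n * \<omega> f) = Var n * foldr Ti [1..<i] (\<omega> f)"
    using assms by (intro foldr_commute_with[of _ "(*) (Var n)", symmetric] Ti_Var_mult[symmetric]) auto
  also have "foldr Ti [1..<i] (\<omega> f) = \<omega> (foldr Ti (map Suc [1..<i]) f)"
    using assms by (intro foldr_intertwine[symmetric] omega_Ti) auto
  also have "\<dots> = \<omega> g" unfolding s g_def by (simp add: numeral_2_eq_2)
  finally have 1: "\<omega> (foldr Ti [1..<i] (Var n * \<omega> f)) = Var (n - 1) * \<omega> (\<omega> g)"
    using n2 by (simp add: omega_simps)
  have "[i..<n] = [i..<n - 1] @ [n - 1]"
    using assms by (metis Suc_diff_1 Suc_leI le_less_trans upt_Suc_append zero_le diff_Suc_1 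
        less_Suc_eq_le not_less_eq_eq)
  then have "foldr T [i..<n] (Var (n - 1) * \<omega> (\<omega> g)) =
      foldr T [i..<n - 1] (T (n - 1) (Var (n - 1) * \<omega> (\<omega> g)))" by simp
  also have "T (n - 1) (Var (n - 1) * \<omega> (\<omega> g)) = Const t * (Var n * \<omega> (\<omega> (Ti 1 g)))"
    using omega_omega_Ti[OF n2, of g] n2 by (simp add: T_Var)
  also have "foldr T [i..<n - 1] \<dots> = Const t * foldr T [i..<n - 1] (Var n * \<omega> (\<omega> (Ti 1 g)))"
    by (rule mlinear_Const[OF mlinear_foldr[OF mlinear_T_op]])
  also have "foldr T [i..<n - 1] (Var n * \<omega> (\<omega> (Ti 1 g))) = Var n * foldr T [i..<n - 1] (\<omega> (\<omega> (Ti 1 g)))"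
    using assms by (intro foldr_commute_with[of _ "(*) (Var n)", symmetric] T_op_Var_mult[symmetric]) auto
  also have "foldr T [i..<n - 1] (\<omega> (\<omega> (Ti 1 g))) = \<omega> (foldr T (map Suc [i..<n - 1]) (\<omega> (Ti 1 g)))"
    using assms by (intro foldr_intertwine[symmetric] omega_T) auto
  also have "map Suc [i..<n - 1] = [Suc i..<n]" unfolding s using n2 by simp
  also have "Ti 1 g = foldr Ti [1..<Suc i] f"
  proof -
    have "[1..<Suc i] = 1 # [2..<Suc i]"
      using assms by (simp add: upt_conv_Cons numeral_2_eq_2 del: upt_Suc)
    then show ?thesis by (simp add: g_def del: upt_Suc)
  qed
  finally have 2: "foldr T [i..<n] (\<omega> (foldr Ti [1..<i] (Var n * \<omega> f))) =
      Const t * (Var n * \<omega> (foldr T [Suc i..<n] (\<omega> (foldr Ti [1..<Suc i] f))))"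
    unfolding 1 .
  have "t powi (int (Suc i) - int n) = t powi (int i - int n) * t"
    by (rule powi_Suc)
  then show ?thesis
    unfolding Y_eq 2 by (simp add: omega_simps Const_mult mult_ac)
qed

text \<open>\<open>Var m\<close> descends to \<open>Var 1\<close>, and each inverse that it passes
  becomes \<open>T\<close> at the cost of a factor \<open>inverse t\<close>.\<close>

lemma foldr_Ti_Var:
  "1 \<le> m \<Longrightarrow> foldr Ti [1..<m] (Var m * f) =
     Const (inverse t ^ (m - 1)) * (Var 1 * foldr T [1..<m] f)"
proof (induction m arbitrary: f rule: dec_induct)
  case (step m)
  have u: "[1..<Suc m] = [1..<m] @ [m]" using step by simp
  have "inverse t * inverse t ^ (m - 1) = inverse t ^ m"
    using step by (cases m) auto
  then have "Const (inverse t) * Const (inverse t ^ (m - Suc 0)) = Const (inverse t ^ m)"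
    by (simp flip: Const_mult)
  then show ?case
    unfolding u by (simp add: Ti_Var_Suc mlinear_Const[OF mlinear_foldr[OF mlinear_Ti]]
        step.IH[unfolded One_nat_def])
qed simp

text \<open>\<open>Var n\<close> descends to \<open>Var 1\<close> through all the inverses, and
  \<omega> carries it back to \<open>Var n\<close>; this last move contributes the
  \<open>q\<close>.\<close>

lemma Y_raise_last: "Y n (Var n * \<omega> f) = Const q * (Var n * \<omega> (Y 1 f))"
proof -
  have "inverse t ^ (n - 1) = t powi (1 - int n)"
    using n_ge_1 by (simp add: power_int_def nat_diff_distrib)
  then show ?thesis
    unfolding Y_eq foldr_Ti_Var[OF n_ge_1] by (simp add: omega_simps mult_ac)
qed

lemma Y_via_Suc:
  assumes "1 \<le> i" "i < n"
  shows "Y i f = Const (inverse t) * T i (Y (Suc i) (T i f))"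
proof -
  have u: "[1..<Suc i] = [1..<i] @ [i]" "[i..<n] = i # [Suc i..<n]"
    using assms by (simp_all add: upt_conv_Cons)
  have "t powi (int (Suc i) - int n) = t powi (int i - int n) * t"
    by (rule powi_Suc)
  then have "Const (t powi (int i - int n)) = Const (inverse t) * Const (t powi (int (Suc i) - int n))"
    using t_nz by (simp add: field_simps flip: Const_mult)
  then show ?thesis
    unfolding Y_eq u by (simp add: T_op_Const_mult mult_ac)
qed

text \<open>One braid relation, at the positions \<open>j - 1\<close> and \<open>j\<close>, lets the
  factor through and lowers its index; it commutes with all remaining factors.\<close>

lemma T_foldr_T:
  assumes "1 \<le> i" "i < j" "j < n"
  shows "T j (foldr T [i..<n] h) = foldr T [i..<n] (T (j - 1) h)"
proof -
  obtain k where k: "j = Suc k" using assms by (cases j) auto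
  have "[i..<n] = [i..<k] @ [k..<n]" using assms k by (intro upt_split) auto
  also have "[k..<n] = k # Suc k # [Suc (Suc k)..<n]"
    using assms k by (simp add: upt_conv_Cons)
  finally have u: "[i..<n] = [i..<k] @ k # Suc k # [Suc (Suc k)..<n]" .
  define h' where "h' = foldr T [Suc (Suc k)..<n] h"
  have h': "foldr T [Suc (Suc k)..<n] (T k h) = T k h'"
    unfolding h'_def by (rule foldr_commute_with[symmetric]) (auto intro: T_op_commute)
  have "T j (foldr T [i..<n] h) = foldr T [i..<k] (T (Suc k) (T k (T (Suc k) h')))"
    unfolding u by (simp add: k h'_def) (rule foldr_commute_with, auto intro: T_op_commute)
  also have "\<dots> = foldr T [i..<k] (T k (T (Suc k) (T k h')))"
    by (simp add: T_op_braid)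
  also have "\<dots> = foldr T [i..<n] (T (j - 1) h)"
    unfolding u by (simp add: k h')
  finally show ?thesis .
qed

lemma foldr_Ti_T:
  assumes "1 \<le> j" "Suc j < i"
  shows "foldr Ti [1..<i] (T j h) = T (Suc j) (foldr Ti [1..<i] h)"
proof -
  have "[1..<i] = [1..<j] @ [j..<i]" using assms by (intro upt_split) auto
  also have "[j..<i] = j # Suc j # [Suc (Suc j)..<i]"
    using assms by (simp add: upt_conv_Cons)
  finally have u: "[1..<i] = [1..<j] @ j # Suc j # [Suc (Suc j)..<i]" .
  define h' where "h' = foldr Ti [Suc (Suc j)..<i] h"
  have h': "foldr Ti [Suc (Suc j)..<i] (T j h) = T j h'"
    unfolding h'_def by (rule foldr_commute_with[symmetric]) (auto intro: Ti_T_commute[symmetric])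
  have "foldr Ti [1..<i] (T j h) = foldr Ti [1..<j] (T (Suc j) (Ti j (Ti (Suc j) h')))"
    unfolding u by (simp add: h' Ti_Ti_T)
  also have "\<dots> = T (Suc j) (foldr Ti [1..<j] (Ti j (Ti (Suc j) h')))"
    by (rule foldr_commute_with[symmetric]) (auto intro: Ti_T_commute[symmetric])
  finally show ?thesis unfolding u h'_def by simp
qed

text \<open>On its way through \<open>Y i\<close>, the factor changes its index by one at the
  product of the \<open>T\<close> (if \<open>i < j\<close>) or of the inverses (if
  \<open>Suc j < i\<close>), and \<omega> makes the opposite change.\<close>

lemma T_Y_commute:
  assumes "1 \<le> j" "j < n" "1 \<le> i" "i \<le> n" "i \<noteq> j" "i \<noteq> Suc j"
  shows "T j (Y i f) = Y i (T j f)"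
proof (cases "i < j")
  case True
  obtain k where k: "j = Suc k" using assms by (cases j) auto
  have 1: "foldr Ti [1..<i] (T j f) = T j (foldr Ti [1..<i] f)"
    by (rule foldr_commute_with[symmetric]) (use True in \<open>auto intro: Ti_T_commute[symmetric]\<close>)
  have 2: "\<omega> (T j g) = T (j - 1) (\<omega> g)" for g
    using omega_T[of k g] True assms k by simp
  show ?thesis
    unfolding Y_eq 1 2 T_op_Const_mult using T_foldr_T[of i j] True assms by simp
next
  case False
  then have j: "Suc j < i" using assms by simp
  have 2: "\<omega> (T (Suc j) g) = T j (\<omega> g)" for g
    using omega_T[of j g] assms j by simp
  have 3: "T j (foldr T [i..<n] g) = foldr T [i..<n] (T j g)" for g
    by (rule foldr_commute_with) (use j in \<open>auto intro: T_op_commute\<close>)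
  show ?thesis
    unfolding Y_eq foldr_Ti_T[OF assms(1) j] 2 T_op_Const_mult 3 ..
qed

text \<open>\<open>Y i\<close> maps \<open>T i E\<close> to \<open>b\<close> times itself plus
  \<open>a * (t - 1)\<close> times \<open>E\<close>, so the span of the two is stable. The constant
  is the solution of \<open>\<kappa> * (b - a) = a * (t - 1)\<close>, which makes \<open>g\<close>
  the second eigenvector.\<close>

lemma intertwiner:
  assumes i: "1 \<le> i" "i < n" and a: "Y i E = Const a * E" and b: "Y (Suc i) E = Const b * E"
    and ab: "a \<noteq> b"
  defines "g \<equiv> T i E + Const (a * (t - 1) / (b - a)) * E"
  shows "Y i g = Const b * g" "Y (Suc i) g = Const a * g"
proof -
  define \<kappa> where "\<kappa> = a * (t - 1) / (b - a)"
  have \<kappa>: "\<kappa> * b = a * \<kappa> + a * (t - 1)" using ab by (simp add: \<kappa>_def field_simps)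
  have cancel: "x = y" if "Const t * x = Const t * y" for x y
    using that t_nz by simp
  have tt: "Const t * (Const (inverse t) * f) = f" for f
    using t_nz by (simp add: mult.assoc[symmetric] flip: Const_mult)
  have Yt: "T i (Y (Suc i) (T i f)) = Const t * Y i f" for f
    using Y_via_Suc[OF i, of f] by (simp add: tt)
  have 1: "Y (Suc i) (T i E) = Const a * (T i E - (Const t - 1) * E)"
  proof -
    have "Y (Suc i) (T i E) = Ti i (T i (Y (Suc i) (T i E)))" by simp
    also have "\<dots> = Const a * (Const t * Ti i E)"
      unfolding Yt a mlinear_Const[OF mlinear_Ti] by (simp only: mult_ac)
    finally show ?thesis unfolding Const_t_Ti .
  qed
  have 2: "Const t * Y i (T i E) = Const t * ((Const t - 1) * Const a * E + Const b * T i E)"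
  proof -
    have c: "Y (Suc i) ((Const t - 1) * f) = (Const t - 1) * Y (Suc i) f" for f
      using mlinear_Const[OF mlinear_Y, of "Suc i" "t - 1" f] by (simp add: Const_diff)
    have c': "T i ((Const t - 1) * f) = (Const t - 1) * T i f" for f
      using T_op_Const_mult[of t i "t - 1" f] by (simp add: Const_diff)
    have "Const t * Y i (T i E) = T i (Y (Suc i) (T i (T i E)))"
      by (simp add: Yt)
    also have "\<dots> = T i (Y (Suc i) ((Const t - 1) * T i E + Const t * E))"
      by (simp only: T_op_quadratic)
    also have "\<dots> = (Const t - 1) * Const a * (T i (T i E) - (Const t - 1) * T i E)
        + Const t * Const b * T i E"
      by (simp only: mlinear_add[OF mlinear_Y] mlinear_Const[OF mlinear_Y] c 1 b
          T_op_add T_op_diff T_op_Const_mult c') (simp only: algebra_simps)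
    finally show ?thesis unfolding T_op_quadratic by (simp add: algebra_simps)
  qed
  have Y2: "Y i (T i E) = (Const t - 1) * Const a * E + Const b * T i E"
    using 2 by (rule cancel)
  have g: "g = T i E + Const \<kappa> * E" by (simp add: g_def \<kappa>_def)
  have k1: "Const (\<kappa> * b) = Const a * Const \<kappa> + Const a * (Const t - 1)"
    unfolding \<kappa> by (simp add: Const_add Const_mult Const_diff)
  show "Y i g = Const b * g"
  proof -
    have "Y i g = Const b * T i E + ((Const t - 1) * Const a + Const a * Const \<kappa>) * E"
      unfolding g mlinear_add[OF mlinear_Y] mlinear_Const[OF mlinear_Y] Y2 a
      by (simp only: algebra_simps)
    also have "(Const t - 1) * Const a + Const a * Const \<kappa> = Const (\<kappa> * b)"
      unfolding k1 by (simp add: algebra_simps)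
    finally show ?thesis unfolding g by (simp add: Const_mult algebra_simps)
  qed
  show "Y (Suc i) g = Const a * g"
  proof -
    have "Y (Suc i) g = Const a * (T i E - (Const t - 1) * E) + Const (\<kappa> * b) * E"
      unfolding g mlinear_add[OF mlinear_Y] mlinear_Const[OF mlinear_Y] 1 b Const_mult
      by (simp only: mult_ac)
    then show ?thesis unfolding g k1 by (simp add: algebra_simps)
  qed
qed

end

section \<open>An order on compositions\<close>

text \<open>The moves that \<open>T\<close> produces on exponents: two parts with fixed sum come
  closer together, or a larger part is exchanged with a smaller one to its right. The order
  generated by them is respected by the swap at an ascent and by \<open>rot\<close>.\<close>

definition low_step :: "nat \<Rightarrow> (nat \<Rightarrow> nat) \<Rightarrow> (nat \<Rightarrow> nat) \<Rightarrow> bool" where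
  "low_step n \<nu> \<eta> \<longleftrightarrow> (\<exists>a\<in>{1..n}. \<exists>b\<in>{1..n}. a \<noteq> b \<and> (\<forall>k. k \<noteq> a \<and> k \<noteq> b \<longrightarrow> \<nu> k = \<eta> k) \<and>
     \<nu> a + \<nu> b = \<eta> a + \<eta> b \<and>
     (max (\<nu> a) (\<nu> b) < max (\<eta> a) (\<eta> b) \<or> a < b \<and> \<eta> b < \<eta> a \<and> \<nu> a = \<eta> b \<and> \<nu> b = \<eta> a))"

abbreviation low :: "nat \<Rightarrow> (nat \<Rightarrow> nat) \<Rightarrow> (nat \<Rightarrow> nat) \<Rightarrow> bool" where
  "low n \<equiv> (low_step n)\<^sup>*\<^sup>*"

text \<open>The exponents of \<open>Var n\<close> times the image of a monomial under
  \<omega>.\<close>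

definition rot :: "nat \<Rightarrow> (nat \<Rightarrow> nat) \<Rightarrow> nat \<Rightarrow> nat" where
  "rot n \<eta> k = (if k = n then Suc (\<eta> 1) else if 1 \<le> k \<and> k < n then \<eta> (Suc k) else \<eta> k)"

lemma low_step_adj_up:
  assumes "1 \<le> i" "Suc i \<le> n" "\<eta> i < \<eta> (Suc i)"
  shows "low_step n \<eta> (\<eta> \<circ> adj i)"
  unfolding low_step_def
  using assms by (intro bexI[of _ i] bexI[of _ "Suc i"]) (auto simp: Transposition.transpose_def)

text \<open>Relabelling two neighbours keeps every step but one: the exchange of exactly these
  neighbours would change direction, but then the swap of \<open>\<nu>'\<close> is
  \<open>\<nu>\<close> itself.\<close>

lemma low_step_adj:
  assumes i: "1 \<le> i" "Suc i \<le> n" and "low_step n \<nu>' \<nu>"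
  shows "low_step n (\<nu>' \<circ> adj i) (\<nu> \<circ> adj i) \<or> \<nu>' \<circ> adj i = \<nu>"
proof -
  from assms(3) obtain a b where ab: "a \<in> {1..n}" "b \<in> {1..n}" "a \<noteq> b"
    "\<And>k. k \<noteq> a \<Longrightarrow> k \<noteq> b \<Longrightarrow> \<nu>' k = \<nu> k" "\<nu>' a + \<nu>' b = \<nu> a + \<nu> b"
    and c: "max (\<nu>' a) (\<nu>' b) < max (\<nu> a) (\<nu> b) \<or> a < b \<and> \<nu> b < \<nu> a \<and> \<nu>' a = \<nu> b \<and> \<nu>' b = \<nu> a"
    unfolding low_step_def by blast
  show ?thesis
  proof (cases "\<nu>' a = \<nu> b \<and> \<nu>' b = \<nu> a \<and> a = i \<and> b = Suc i")
    case True
    then have "\<nu>' \<circ> adj i = \<nu>"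
      using ab(4) by (auto simp: fun_eq_iff Transposition.transpose_def)
    then show ?thesis ..
  next
    case False
    have "a < b \<Longrightarrow> \<not> (a = i \<and> b = Suc i) \<Longrightarrow> adj i a < adj i b"
      by (auto simp: Transposition.transpose_def)
    moreover have "adj i a \<in> {1..n}" "adj i b \<in> {1..n}" "adj i a \<noteq> adj i b"
      using i ab(1-3) by (auto simp: Transposition.transpose_def)
    moreover have "\<nu>' (adj i k) = \<nu> (adj i k)" if "k \<noteq> adj i a" "k \<noteq> adj i b" for k
      using that by (intro ab(4)) (auto simp: transpose_eq_iff)
    ultimately have "low_step n (\<nu>' \<circ> adj i) (\<nu> \<circ> adj i)"
      unfolding low_step_def using ab(5) c False
      by (intro bexI[of _ "adj i a"] bexI[of _ "adj i b"]) auto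
    then show ?thesis ..
  qed
qed

text \<open>Both claims are carried along, since in the exceptional case of
  \<open>low_step_adj\<close> the second claim for \<open>\<nu>'\<close> is the first one for
  \<open>\<nu>\<close>. The ascent puts \<eta> below its swap, which starts the induction.\<close>

lemma low_adj:
  assumes i: "1 \<le> i" "Suc i \<le> n" and "\<eta> i < \<eta> (Suc i)" and "low n \<nu> \<eta>"
  shows "low n \<nu> (\<eta> \<circ> adj i) \<and> low n (\<nu> \<circ> adj i) (\<eta> \<circ> adj i)"
  using assms(4)
proof (induction rule: converse_rtranclp_induct)
  case base
  show ?case
    by (intro conjI r_into_rtranclp low_step_adj_up[OF i assms(3)] rtranclp.rtrancl_refl)
next
  case (step \<nu>' \<nu>)
  then show ?case
    using low_step_adj[OF i step(1)] by (metis converse_rtranclp_into_rtranclp)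
qed

text \<open>Only steps that involve the first part are critical, because it gains one and moves to
  the right end. If two parts come closer and \<open>Suc (\<nu> 1)\<close> reaches
  \<open>\<eta> b\<close>, the step becomes an exchange, and the new position of the first part
  gives it the permitted direction.\<close>

lemma low_step_rot:
  assumes "low_step n \<nu> \<eta>"
  shows "low_step n (rot n \<nu>) (rot n \<eta>) \<or> rot n \<nu> = rot n \<eta>"
proof -
  from assms obtain a b where ab: "a \<in> {1..n}" "b \<in> {1..n}" "a \<noteq> b"
    "\<And>k. k \<noteq> a \<Longrightarrow> k \<noteq> b \<Longrightarrow> \<nu> k = \<eta> k" "\<nu> a + \<nu> b = \<eta> a + \<eta> b"
    and c: "max (\<nu> a) (\<nu> b) < max (\<eta> a) (\<eta> b) \<or> a < b \<and> \<eta> b < \<eta> a \<and> \<nu> a = \<eta> b \<and> \<nu> b = \<eta> a"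
    unfolding low_step_def by blast
  have first: "low_step n (rot n \<nu>) (rot n \<eta>) \<or> rot n \<nu> = rot n \<eta>"
    if b: "b \<in> {1..n}" "b \<noteq> 1" and e: "\<And>k. k \<noteq> 1 \<Longrightarrow> k \<noteq> b \<Longrightarrow> \<nu> k = \<eta> k"
      and s: "\<nu> 1 + \<nu> b = \<eta> 1 + \<eta> b"
      and c: "max (\<nu> 1) (\<nu> b) < max (\<eta> 1) (\<eta> b) \<or> \<eta> b < \<eta> 1 \<and> \<nu> 1 = \<eta> b \<and> \<nu> b = \<eta> 1" for b
  proof -
    have e': "rot n \<nu> k = rot n \<eta> k" if "k \<noteq> n" "k \<noteq> b - 1" for k
      using that e b by (auto simp: rot_def)
    have v: "rot n \<mu> n = Suc (\<mu> 1)" "rot n \<mu> (b - 1) = \<mu> b" for \<mu>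
      using b by (auto simp: rot_def)
    consider "max (Suc (\<nu> 1)) (\<nu> b) < max (Suc (\<eta> 1)) (\<eta> b)"
      | "Suc (\<eta> 1) < \<eta> b" "Suc (\<nu> 1) = \<eta> b" "\<nu> b = Suc (\<eta> 1)"
      using s c by linarith
    then show ?thesis
    proof cases
      case 1
      then have "low_step n (rot n \<nu>) (rot n \<eta>)"
        unfolding low_step_def
        by (intro bexI[of _ n] bexI[of _ "b - 1"]) (use b s e' v in auto)
      then show ?thesis ..
    next
      case 2
      have "low_step n (rot n \<nu>) (rot n \<eta>)"
        unfolding low_step_def
        by (intro bexI[of _ n] bexI[of _ "b - 1"]) (use b s e' v 2 in auto)
      then show ?thesis ..
    qed
  qed
  consider "a = 1" | "b = 1" | "a \<noteq> 1" "b \<noteq> 1" by blast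
  then show ?thesis
  proof cases
    case 1
    then show ?thesis using first[of b] ab c by blast
  next
    case 2
    then show ?thesis using first[of a] ab c
      by (metis add.commute atLeastAtMost_iff leD max.commute)
  next
    case 3
    have v: "rot n \<mu> (a - 1) = \<mu> a" "rot n \<mu> (b - 1) = \<mu> b" for \<mu>
      using 3 ab by (auto simp: rot_def)
    have e': "rot n \<nu> k = rot n \<eta> k" if "k \<noteq> a - 1" "k \<noteq> b - 1" for k
    proof -
      have "\<nu> 1 = \<eta> 1" "Suc k \<noteq> a \<and> Suc k \<noteq> b" using 3 ab(4) that by auto
      moreover have "\<nu> k = \<eta> k" if "k = 0 \<or> k > n" using ab that by (intro ab(4)) auto
      ultimately show ?thesis using ab(4) by (auto simp: rot_def)
    qed
    have "low_step n (rot n \<nu>) (rot n \<eta>)"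
      unfolding low_step_def
      by (intro bexI[of _ "a - 1"] bexI[of _ "b - 1"]) (use 3 ab e' v c in auto)
    then show ?thesis ..
  qed
qed

lemma low_rot: "low n \<nu> \<eta> \<Longrightarrow> low n (rot n \<nu>) (rot n \<eta>)"
proof (induction rule: converse_rtranclp_induct)
  case (step \<nu>' \<nu>)
  then show ?case
    using low_step_rot[OF step(1)] by (metis converse_rtranclp_into_rtranclp)
qed simp

text \<open>For a decreasing list, the sum of the first \<open>p\<close> entries is the minimum over
  \<open>c\<close> of \<open>p * c\<close> plus the sum of the positive parts \<open>y - c\<close>
  (truncated subtraction). This is the bound; \<open>sum_list_take_eq\<close> names a
  \<open>c\<close> that attains it. Dominance of partitions is thus reduced to sums of convex
  functions of the parts.\<close>

lemma sum_list_take_le: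
  fixes ys :: "nat list"
  shows "sum_list (take p ys) \<le> p * c + sum_list (map (\<lambda>y. y - c) ys)"
proof (induction ys arbitrary: p)
  case (Cons y ys)
  show ?case
  proof (cases p)
    case (Suc r)
    then show ?thesis using Cons[of r] by simp
  qed simp
qed simp

lemma sum_list_take_eq:
  fixes ys :: "nat list"
  assumes "sorted (rev ys)" "p < length ys"
  shows "sum_list (take (Suc p) ys) = Suc p * (ys ! p) + sum_list (map (\<lambda>y. y - ys ! p) ys)"
proof -
  have s: "\<And>i j. i \<le> j \<Longrightarrow> j < length ys \<Longrightarrow> ys ! j \<le> ys ! i"
    using assms(1) by (simp add: sorted_rev_iff_nth_mono)
  define c where "c = ys ! p"
  have "sum_list (map (\<lambda>y. y - c) (drop (Suc p) ys)) = 0"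
    using s by (auto simp: c_def in_set_conv_nth)
  moreover have "sum_list (take (Suc p) ys) = Suc p * c + sum_list (map (\<lambda>y. y - c) (take (Suc p) ys))"
  proof -
    have "sum_list zs = length zs * c + sum_list (map (\<lambda>y. y - c) zs)" if "\<forall>z\<in>set zs. c \<le> z" for zs
      using that by (induction zs) auto
    moreover have "\<forall>z\<in>set (take (Suc p) ys). c \<le> z"
      using s assms(2) by (auto simp: c_def in_set_conv_nth)
    ultimately show ?thesis using assms(2) by fastforce
  qed
  ultimately have "sum_list (take (Suc p) ys) = Suc p * c + sum_list (map (\<lambda>y. y - c) (take (Suc p) ys @ drop (Suc p) ys))"
    unfolding map_append sum_list_append by simp
  then show ?thesis unfolding append_take_drop_id c_def .
qed

definition desc :: "nat \<Rightarrow> (nat \<Rightarrow> nat) \<Rightarrow> nat list" where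
  "desc n \<eta> = rev (sort (map \<eta> [1..<Suc n]))"

lemma length_desc [simp]: "length (desc n \<eta>) = n"
  by (simp add: desc_def)

lemma sorted_rev_desc: "sorted (rev (desc n \<eta>))"
  by (simp add: desc_def del: upt_Suc)

lemma sum_list_desc: "sum_list (map f (desc n \<eta>)) = (\<Sum>i=1..n. f (\<eta> i))"
  for f :: "nat \<Rightarrow> nat"
proof -
  have "sum_list (map f (desc n \<eta>)) = sum_mset (image_mset f (mset (map \<eta> [1..<Suc n])))"
    by (metis desc_def mset_map mset_rev mset_sort sum_mset_sum_list)
  also have "\<dots> = sum_list (map (\<lambda>i. f (\<eta> i)) [1..<Suc n])"
    by (metis (no_types, lifting) map_map mset_map sum_mset_sum_list comp_def map_eq_conv)
  also have "\<dots> = (\<Sum>i=1..n. f (\<eta> i))"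
    by (simp only: sum_list_distinct_conv_sum_set[OF distinct_upt] set_upt atLeastLessThanSuc_atLeastAtMost)
  finally show ?thesis .
qed

lemma partition_of_desc: "partition_of n \<eta> i = desc n \<eta> ! (i - 1)"
  by (simp add: partition_of_def desc_def)

lemma sum_partition_of:
  assumes "p \<le> n"
  shows "(\<Sum>i=1..p. partition_of n \<eta> i) = sum_list (take p (desc n \<eta>))"
  using assms
proof (induction p)
  case (Suc p)
  then show ?case
    by (simp add: partition_of_desc take_Suc_conv_app_nth)
qed simp

lemma desc_eq_iff:
  "desc n \<nu> = desc n \<eta> \<longleftrightarrow> (\<forall>i\<in>{1..n}. partition_of n \<nu> i = partition_of n \<eta> i)"
proof
  assume *: "\<forall>i\<in>{1..n}. partition_of n \<nu> i = partition_of n \<eta> i"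
  show "desc n \<nu> = desc n \<eta>"
  proof (rule nth_equalityI)
    fix i assume "i < length (desc n \<nu>)"
    then show "desc n \<nu> ! i = desc n \<eta> ! i"
      using *[rule_format, of "Suc i"] by (simp add: partition_of_desc)
  qed simp
qed (simp add: partition_of_desc)

definition dom_le :: "nat \<Rightarrow> (nat \<Rightarrow> nat) \<Rightarrow> (nat \<Rightarrow> nat) \<Rightarrow> bool" where
  "dom_le n \<nu> \<eta> \<longleftrightarrow> (\<forall>p\<in>{1..n}. (\<Sum>i=1..p. \<nu> i) \<le> (\<Sum>i=1..p. \<eta> i))"

lemma dominance_less_iff:
  "dominance_less n \<nu> \<eta> \<longleftrightarrow> (\<exists>i\<in>{1..n}. \<nu> i \<noteq> \<eta> i) \<and> dom_le n \<nu> \<eta>"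
proof -
  have "(\<Sum>i=1..p. int (\<eta> i) - int (\<nu> i)) \<ge> 0 \<longleftrightarrow> (\<Sum>i=1..p. \<nu> i) \<le> (\<Sum>i=1..p. \<eta> i)" for p
    by (simp add: sum_subtractf flip: of_nat_sum)
  then show ?thesis by (simp add: dominance_less_def dom_le_def)
qed

lemma dom_le_trans: "dom_le n a b \<Longrightarrow> dom_le n b c \<Longrightarrow> dom_le n a c"
  unfolding dom_le_def by (meson order_trans)

lemma dom_le_antisym:
  assumes "dom_le n a b" "dom_le n b a" "i \<in> {1..n}"
  shows "a i = b i"
proof -
  have eq: "(\<Sum>i=1..p. a i) = (\<Sum>i=1..p. b i)" if "p \<le> n" for p
    using assms(1,2) that unfolding dom_le_def
    by (cases "p = 0") (auto intro!: antisym)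
  obtain j where j: "i = Suc j" using assms(3) by (cases i) auto
  show ?thesis using eq[of j] eq[of "Suc j"] assms(3) j by simp
qed

lemma dom_le_cong:
  "(\<And>i. i \<in> {1..n} \<Longrightarrow> a i = a' i) \<Longrightarrow> (\<And>i. i \<in> {1..n} \<Longrightarrow> b i = b' i) \<Longrightarrow> dom_le n a b = dom_le n a' b'"
  unfolding dom_le_def by (intro ball_cong refl arg_cong2[of _ _ _ _ "(\<le>)"] sum.cong) auto

lemma dominance_less_trans:
  "dominance_less n a b \<Longrightarrow> dominance_less n b c \<Longrightarrow> dominance_less n a c"
  unfolding dominance_less_iff by (metis dom_le_antisym dom_le_trans dom_le_cong)

lemma comp_less_trans:
  assumes "comp_less n a b" "comp_less n b c"
  shows "comp_less n a c"
proof -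
  have 1: "dominance_less n x z" if "dominance_less n x y" "\<forall>i\<in>{1..n}. y i = z i" for x y z
    using that dom_le_cong[of n x x y z] unfolding dominance_less_iff by force
  have 2: "dominance_less n x z" if "dominance_less n y z" "\<forall>i\<in>{1..n}. x i = y i" for x y z
    using that dom_le_cong[of n x y z z] unfolding dominance_less_iff by force
  show ?thesis
    using assms dominance_less_trans 1 2 unfolding comp_less_def
    by (smt (verit))
qed

lemma comp_less_irrefl: "\<not> comp_less n a a"
  by (simp add: comp_less_def dominance_less_def)

lemma sum_two_point:
  fixes f g :: "nat \<Rightarrow> nat"
  assumes "finite A" "a \<in> A" "b \<in> A" "a \<noteq> b" "\<And>k. k \<noteq> a \<Longrightarrow> k \<noteq> b \<Longrightarrow> f k = g k"
  shows "\<exists>R. sum f A = f a + f b + R \<and> sum g A = g a + g b + R"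
proof -
  have "sum h A = h a + h b + sum h (A - {a} - {b})" for h :: "nat \<Rightarrow> nat"
    using assms(1-4) by (simp add: sum.remove[of A a] sum.remove[of "A - {a}" b])
  moreover have "sum f (A - {a} - {b}) = sum g (A - {a} - {b})"
    using assms(5) by (intro sum.cong) auto
  ultimately show ?thesis by metis
qed

text \<open>Bringing two parts closer with fixed sum does not increase any sum of positive parts
  \<open>y - c\<close>, hence no partial sum of the partition, and it strictly lowers the sum of
  squares, so the partition changes. An exchange keeps the partition and lowers the partial sums of
  the composition itself from \<open>a\<close> up to \<open>b - 1\<close>.\<close>

lemma low_step_comp_less:
  assumes "low_step n \<nu> \<eta>"
  shows "comp_less n \<nu> \<eta>"
proof -
  from assms obtain a b where ab: "a \<in> {1..n}" "b \<in> {1..n}" "a \<noteq> b"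
    "\<And>k. k \<noteq> a \<Longrightarrow> k \<noteq> b \<Longrightarrow> \<nu> k = \<eta> k" "\<nu> a + \<nu> b = \<eta> a + \<eta> b"
    and c: "max (\<nu> a) (\<nu> b) < max (\<eta> a) (\<eta> b) \<or> a < b \<and> \<eta> b < \<eta> a \<and> \<nu> a = \<eta> b \<and> \<nu> b = \<eta> a"
    unfolding low_step_def by blast
  have two: "\<exists>R. (\<Sum>i=1..n. f (\<nu> i)) = f (\<nu> a) + f (\<nu> b) + R \<and>
      (\<Sum>i=1..n. f (\<eta> i)) = f (\<eta> a) + f (\<eta> b) + R" for f :: "nat \<Rightarrow> nat"
    using ab(1-4) by (intro sum_two_point) auto
  have size: "(\<Sum>i=1..n. \<nu> i) = (\<Sum>i=1..n. \<eta> i)"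
    using two[of "\<lambda>x. x"] ab(5) by auto
  have dom: "dom_le n (partition_of n \<nu>) (partition_of n \<eta>)"
    unfolding dom_le_def
  proof
    fix p assume p: "p \<in> {1..n}"
    then obtain r where r: "p = Suc r" "r < n" by (cases p) auto
    \<comment> \<open>The smallest of the \<open>p\<close> largest parts of \<eta>: at this
      threshold the bound is attained on the side of \<eta>.\<close>
    define c where "c = desc n \<eta> ! r"
    have "(\<nu> a - c) + (\<nu> b - c) \<le> (\<eta> a - c) + (\<eta> b - c)"
      using ab(5) \<open>max (\<nu> a) (\<nu> b) < max (\<eta> a) (\<eta> b) \<or> _\<close> by linarith
    then have le: "(\<Sum>i=1..n. \<nu> i - c) \<le> (\<Sum>i=1..n. \<eta> i - c)"
      using two[of "\<lambda>x. x - c"] by auto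
    have "(\<Sum>i=1..p. partition_of n \<nu> i) = sum_list (take p (desc n \<nu>))"
      using p by (intro sum_partition_of) auto
    also have "\<dots> \<le> p * c + (\<Sum>i=1..n. \<nu> i - c)"
      using sum_list_take_le[of p "desc n \<nu>" c] sum_list_desc[of "\<lambda>x. x - c" n \<nu>] by simp
    also have "\<dots> \<le> p * c + (\<Sum>i=1..n. \<eta> i - c)" using le by simp
    also have "\<dots> = sum_list (take p (desc n \<eta>))"
      using sum_list_take_eq[OF sorted_rev_desc, of r n \<eta>] sum_list_desc[of "\<lambda>x. x - c" n \<eta>] r
      by (simp add: c_def)
    also have "\<dots> = (\<Sum>i=1..p. partition_of n \<eta> i)"
      using p by (intro sum_partition_of[symmetric]) auto
    finally show "(\<Sum>i=1..p. partition_of n \<nu> i) \<le> (\<Sum>i=1..p. partition_of n \<eta> i)" .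
  qed
  show ?thesis
  proof (cases "max (\<nu> a) (\<nu> b) < max (\<eta> a) (\<eta> b)")
    case True
    have sq: "\<nu> a * \<nu> a + \<nu> b * \<nu> b < \<eta> a * \<eta> a + \<eta> b * \<eta> b"
    proof -
      have *: "x * x + y * y < u * u + v * v"
        if "x + y = u + v" "x < u" "y < u" for x y u v :: int
      proof -
        have "u * u + v * v - (x * x + y * y) = 2 * ((u - x) * (u - y))"
          using that(1) by algebra
        moreover have "(u - x) * (u - y) > 0" using that by simp
        ultimately show ?thesis by linarith
      qed
      have "int (\<nu> a) * int (\<nu> a) + int (\<nu> b) * int (\<nu> b) < int (\<eta> a) * int (\<eta> a) + int (\<eta> b) * int (\<eta> b)"
      proof (cases "\<eta> b \<le> \<eta> a")
        case True
        then show ?thesis using * \<open>max _ _ < _\<close> ab(5) by (metis (no_types, lifting) max.absorb1 max_less_iff_conj of_nat_add of_nat_less_iff)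
      next
        case False
        then have "int (\<nu> a) * int (\<nu> a) + int (\<nu> b) * int (\<nu> b) < int (\<eta> b) * int (\<eta> b) + int (\<eta> a) * int (\<eta> a)"
          using \<open>max _ _ < _\<close> ab(5) by (intro *) auto
        then show ?thesis by simp
      qed
      then show ?thesis by (simp flip: of_nat_mult of_nat_add)
    qed
    have "desc n \<nu> \<noteq> desc n \<eta>"
    proof
      assume "desc n \<nu> = desc n \<eta>"
      then have "(\<Sum>i=1..n. \<nu> i * \<nu> i) = (\<Sum>i=1..n. \<eta> i * \<eta> i)"
        using sum_list_desc[of "\<lambda>x. x * x" n] by metis
      then show False using two[of "\<lambda>x. x * x"] sq by auto
    qed
    then show ?thesis
      unfolding comp_less_def dominance_less_iff using size dom desc_eq_iff by blast
  next
    case False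
    then have sw: "a < b" "\<eta> b < \<eta> a" "\<nu> a = \<eta> b" "\<nu> b = \<eta> a" using c by auto
    have "\<nu> = \<eta> \<circ> Transposition.transpose a b"
      using ab(4) sw by (auto simp: fun_eq_iff Transposition.transpose_def)
    then have "image_mset \<nu> (mset_set {1..n}) = image_mset \<eta> (image_mset (Transposition.transpose a b) (mset_set {1..n}))"
      by (simp add: multiset.map_comp)
    also have "image_mset (Transposition.transpose a b) (mset_set {1..n}) = mset_set {1..n}"
      using ab(1,2) by (subst image_mset_mset_set) (auto intro: inj_on_subset[OF inj_transpose])
    finally have ms: "image_mset \<nu> (mset_set {1..n}) = image_mset \<eta> (mset_set {1..n})" .
    have ms': "mset (map \<mu> [1..<Suc n]) = image_mset \<mu> (mset_set {1..n})" for \<mu> :: "nat \<Rightarrow> nat"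
      by (metis atLeastLessThanSuc_atLeastAtMost distinct_upt mset_map mset_set_set set_upt)
    have "sort (map \<nu> [1..<Suc n]) = sort (map \<eta> [1..<Suc n])"
      using ms unfolding ms'[symmetric] by (metis properties_for_sort mset_sort sorted_sort)
    then have "desc n \<nu> = desc n \<eta>"
      by (simp add: desc_def)
    moreover have "dom_le n \<nu> \<eta>"
      unfolding dom_le_def
    proof
      fix p assume p: "p \<in> {1..n}"
      consider "p < a" | "a \<le> p" "p < b" | "b \<le> p" by linarith
      then show "(\<Sum>i=1..p. \<nu> i) \<le> (\<Sum>i=1..p. \<eta> i)"
      proof cases
        case 1
        then show ?thesis using sw ab(4) by (intro eq_refl sum.cong) auto
      next
        case 2
        have "\<nu> i \<le> \<eta> i" if "i \<in> {1..p}" for i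
          using 2 sw ab(4)[of i] that by (cases "i = a") auto
        then show ?thesis by (rule sum_mono)
      next
        case 3
        have "\<exists>R. (\<Sum>i=1..p. \<nu> i) = \<nu> a + \<nu> b + R \<and> (\<Sum>i=1..p. \<eta> i) = \<eta> a + \<eta> b + R"
          using 3 sw ab by (intro sum_two_point) auto
        then show ?thesis using ab(5) by auto
      qed
    qed
    moreover have "\<exists>i\<in>{1..n}. \<nu> i \<noteq> \<eta> i" using ab(1) sw by (intro bexI[of _ a]) auto
    ultimately show ?thesis
      unfolding comp_less_def dominance_less_iff using size desc_eq_iff by blast
  qed
qed

lemma low_comp_less: "low n \<nu> \<eta> \<Longrightarrow> \<nu> = \<eta> \<or> comp_less n \<nu> \<eta>"
proof (induction rule: converse_rtranclp_induct)
  case (step \<nu>' \<nu>)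
  then show ?case using low_step_comp_less comp_less_trans by metis
qed simp

lemma low_antisym: "low n \<nu> \<eta> \<Longrightarrow> low n \<eta> \<nu> \<Longrightarrow> \<nu> = \<eta>"
  using low_comp_less comp_less_trans comp_less_irrefl by metis

section \<open>Leg lengths and partitions\<close>

text \<open>A strict linear order on the positions in which the leg length is the rank. Hence
  \<open>leg' n \<eta>\<close> is a bijection from \<open>{1..n}\<close> onto
  \<open>{..<n}\<close>.\<close>

definition beats :: "(nat \<Rightarrow> nat) \<Rightarrow> nat \<Rightarrow> nat \<Rightarrow> bool" where
  "beats \<eta> k i \<longleftrightarrow> \<eta> i < \<eta> k \<or> \<eta> k = \<eta> i \<and> k < i"

lemma leg'_eq_card_beats: "leg' n \<eta> i = card {k\<in>{1..n}. beats \<eta> k i}"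
proof -
  let ?A = "{k\<in>{1..n}. k < i \<and> \<eta> k \<ge> \<eta> i}" and ?B = "{k\<in>{1..n}. k > i \<and> \<eta> k > \<eta> i}"
  have "beats \<eta> k i \<longleftrightarrow> k < i \<and> \<eta> k \<ge> \<eta> i \<or> k > i \<and> \<eta> k > \<eta> i" for k
    unfolding beats_def by (cases k i rule: linorder_cases) auto
  then have "{k\<in>{1..n}. beats \<eta> k i} = ?A \<union> ?B" by blast
  moreover have "card (?A \<union> ?B) = card ?A + card ?B"
    by (rule card_Un_disjoint) auto
  ultimately show ?thesis by (simp add: leg'_def)
qed

lemma leg'_less_if_beats:
  assumes "beats \<eta> k i" "k \<in> {1..n}"
  shows "leg' n \<eta> k < leg' n \<eta> i"
  unfolding leg'_eq_card_beats
  using assms by (intro psubset_card_mono) (auto simp: beats_def)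

lemma leg'_less_iff_beats:
  assumes "k \<in> {1..n}" "i \<in> {1..n}"
  shows "leg' n \<eta> k < leg' n \<eta> i \<longleftrightarrow> beats \<eta> k i"
proof -
  have "k = i \<or> beats \<eta> k i \<or> beats \<eta> i k" by (auto simp: beats_def)
  then show ?thesis using leg'_less_if_beats assms by (metis less_asym less_irrefl beats_def)
qed

lemma leg'_less: "i \<in> {1..n} \<Longrightarrow> leg' n \<eta> i < n"
proof -
  assume i: "i \<in> {1..n}"
  have "leg' n \<eta> i \<le> card ({1..n} - {i})"
    unfolding leg'_eq_card_beats by (intro card_mono) (auto simp: beats_def)
  then show ?thesis using i by (simp, linarith)
qed

lemma bij_betw_leg': "bij_betw (leg' n \<eta>) {1..n} {..<n}"
proof -
  have inj: "inj_on (leg' n \<eta>) {1..n}"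
  proof (rule inj_onI)
    fix i k assume *: "i \<in> {1..n}" "k \<in> {1..n}" "leg' n \<eta> i = leg' n \<eta> k"
    have "k = i \<or> beats \<eta> k i \<or> beats \<eta> i k" by (auto simp: beats_def)
    then show "i = k" using leg'_less_if_beats[of \<eta>] * by fastforce
  qed
  moreover have "leg' n \<eta> ` {1..n} = {..<n}"
    by (rule card_subset_eq) (use leg'_less card_image[OF inj] in auto)
  ultimately show ?thesis by (simp add: bij_betw_def)
qed

text \<open>Reading the parts in the order of their ranks gives a decreasing list with the same
  multiset of entries, and such a list is unique.\<close>

lemma partition_of_leg':
  assumes "i \<in> {1..n}"
  shows "partition_of n \<eta> (Suc (leg' n \<eta> i)) = \<eta> i"
proof -
  define p where "p = inv_into {1..n} (leg' n \<eta>)"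
  have p: "bij_betw p {..<n} {1..n}" unfolding p_def by (rule bij_betw_inv_into[OF bij_betw_leg'])
  have lp: "leg' n \<eta> (p r) = r" if "r < n" for r
    using that bij_betw_leg'[of n \<eta>] unfolding p_def by (metis bij_betw_def f_inv_into_f lessThan_iff)
  define zs where "zs = map (\<lambda>r. \<eta> (p r)) [0..<n]"
  have "mset zs = image_mset \<eta> (image_mset p (mset_set {..<n}))"
    unfolding zs_def by (simp add: multiset.map_comp comp_def atLeast0LessThan)
  also have "image_mset p (mset_set {..<n}) = mset_set {1..n}"
    using p by (simp add: image_mset_mset_set bij_betw_def)
  also have "image_mset \<eta> (mset_set {1..n}) = mset (map \<eta> [1..<Suc n])"
    by (metis atLeastLessThanSuc_atLeastAtMost distinct_upt mset_map mset_set_set set_upt)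
  finally have "mset (rev zs) = mset (map \<eta> [1..<Suc n])" by simp
  moreover have "sorted (rev zs)"
    unfolding sorted_rev_iff_nth_mono
  proof (intro allI impI)
    fix r s assume rs: "r \<le> s" "s < length zs"
    then have rs': "r < n" "s < n" by (auto simp: zs_def)
    then have "p r \<in> {1..n}" "p s \<in> {1..n}" using p by (auto simp: bij_betw_def)
    then have "\<not> beats \<eta> (p s) (p r)"
      using leg'_less_iff_beats[of "p s" n "p r" \<eta>] lp rs rs' by simp
    then show "zs ! s \<le> zs ! r" using rs' by (auto simp: zs_def beats_def)
  qed
  ultimately have "sort (map \<eta> [1..<Suc n]) = rev zs"
    by (metis properties_for_sort)
  then have d: "desc n \<eta> = zs" by (simp add: desc_def)
  have "p (leg' n \<eta> i) = i"
    using assms bij_betw_leg'[of n \<eta>] by (simp add: p_def bij_betw_def)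
  then show ?thesis
    using leg'_less[OF assms, of \<eta>] by (simp add: partition_of_desc d zs_def)
qed

text \<open>Turns products over the eigenvalues of \<open>E\<close>, which involve \<eta> and its
  leg lengths, into products over the parts of the partition.\<close>

lemma prod_leg'_eq:
  fixes h :: "nat \<Rightarrow> nat \<Rightarrow> 'a::comm_monoid_mult"
  shows "(\<Prod>i=1..n. h (\<eta> i) (leg' n \<eta> i)) = (\<Prod>i=1..n. h (partition_of n \<eta> i) (i - 1))"
proof -
  have b: "bij_betw (\<lambda>i. Suc (leg' n \<eta> i)) {1..n} {1..n}"
  proof -
    have "bij_betw Suc {..<n} {1..n}" 
      by (auto simp: bij_betw_def image_Suc_lessThan)
    from bij_betw_trans[OF bij_betw_leg' this] show ?thesis by (simp add: comp_def)
  qed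
  have "(\<Prod>i=1..n. h (partition_of n \<eta> i) (i - 1)) =
      (\<Prod>i=1..n. h (partition_of n \<eta> (Suc (leg' n \<eta> i))) (Suc (leg' n \<eta> i) - 1))"
    by (rule prod.reindex_bij_betw[OF b, symmetric])
  also have "\<dots> = (\<Prod>i=1..n. h (\<eta> i) (leg' n \<eta> i))"
    by (intro prod.cong refl) (simp add: partition_of_leg')
  finally show ?thesis ..
qed

lemma leg'_reindex:
  assumes bij: "bij_betw c {1..n} {1..n}"
    and eq: "\<And>k. k \<in> {1..n} \<Longrightarrow> beats \<eta> k i \<longleftrightarrow> beats \<eta>' (c k) (c i)"
  shows "leg' n \<eta>' (c i) = leg' n \<eta> i"
proof -
  have "{k\<in>{1..n}. beats \<eta>' k (c i)} = c ` {k\<in>{1..n}. beats \<eta> k i}"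
  proof (intro equalityI subsetI)
    fix k assume k: "k \<in> {k\<in>{1..n}. beats \<eta>' k (c i)}"
    then obtain l where "l \<in> {1..n}" "k = c l" using bij unfolding bij_betw_def by blast
    then show "k \<in> c ` {k\<in>{1..n}. beats \<eta> k i}" using k eq by auto
  next
    fix k assume "k \<in> c ` {k\<in>{1..n}. beats \<eta> k i}"
    then show "k \<in> {k\<in>{1..n}. beats \<eta>' k (c i)}" using eq bij unfolding bij_betw_def by blast
  qed
  moreover have "inj_on c {k\<in>{1..n}. beats \<eta> k i}"
    using bij by (auto simp: bij_betw_def intro: inj_on_subset)
  ultimately show ?thesis unfolding leg'_eq_card_beats by (simp add: card_image)
qed

lemma bij_betw_adj:
  assumes "1 \<le> i" "Suc i \<le> n"
  shows "bij_betw (adj i) {1..n} {1..n}"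
proof -
  have "bij_betw (adj i) UNIV UNIV" by simp
  moreover have "adj i ` {1..n} = {1..n}"
    using assms by (intro transpose_image_eq) auto
  ultimately show ?thesis by (metis bij_betw_def inj_on_subset subset_UNIV)
qed

text \<open>The exchanged parts differ, so no tie between these two positions has to be
  broken.\<close>

lemma leg'_adj:
  assumes "1 \<le> i" "Suc i \<le> n" "\<eta> i \<noteq> \<eta> (Suc i)"
  shows "leg' n (\<eta> \<circ> adj i) j = leg' n \<eta> (adj i j)"
proof -
  have "leg' n (\<eta> \<circ> adj i) (adj i (adj i j)) = leg' n \<eta> (adj i j)"
  proof (rule leg'_reindex[OF bij_betw_adj])
    have *: "adj i k < adj i l \<longleftrightarrow> k < l" if "\<eta> k = \<eta> l" for k l
    proof -
      have "\<not> (k = i \<and> l = Suc i)" "\<not> (k = Suc i \<and> l = i)" using that assms(3) by auto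
      then show ?thesis by (cases "k = i"; cases "k = Suc i"; cases "l = i"; cases "l = Suc i"; auto)
    qed
    show "beats \<eta> k (adj i j) \<longleftrightarrow> beats (\<eta> \<circ> adj i) (adj i k) (adj i (adj i j))" for k
      using *[of k "adj i j"] unfolding beats_def comp_def transpose_involutory by blast
  qed (use assms in auto)
  then show ?thesis by simp
qed

text \<open>The first part loses its leftmost position but gains one. Equal parts, which lost the
  tie against it, are now smaller; parts larger by one, which beat it, now win a tie.\<close>

lemma leg'_rot:
  assumes "j \<in> {1..n}"
  shows "leg' n (rot n \<eta>) (if j = 1 then n else j - 1) = leg' n \<eta> j"
proof -
  define c where "c = (\<lambda>j. if j = 1 then n else j - 1)"
  have "bij_betw c {1..n} {1..n}"
    by (rule bij_betw_byWitness[of _ "\<lambda>k. if k = n then 1 else Suc k"]) (auto simp: c_def)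
  then have "leg' n (rot n \<eta>) (c j) = leg' n \<eta> j"
  proof (rule leg'_reindex)
    show "beats \<eta> k j \<longleftrightarrow> beats (rot n \<eta>) (c k) (c j)" if "k \<in> {1..n}" for k
    proof -
      have "rot n \<eta> (c l) = (if l = 1 then Suc (\<eta> 1) else \<eta> l)" if "l \<in> {1..n}" for l
        using that by (auto simp: rot_def c_def)
      moreover have "c k < c j \<longleftrightarrow> j = 1 \<and> k \<noteq> 1 \<or> j \<noteq> 1 \<and> k \<noteq> 1 \<and> k < j"
        using that assms unfolding c_def by auto
      ultimately show ?thesis
        using that assms unfolding beats_def by auto
    qed
  qed
  then show ?thesis by (simp add: c_def)
qed

lemma sum_leg': "(\<Sum>i=1..n. leg' n \<eta> i) = n choose 2"
proof -
  have "(\<Sum>i=1..n. leg' n \<eta> i) = (\<Sum>r<n. r)"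
    by (rule sum.reindex_bij_betw[OF bij_betw_leg'])
  also have "\<dots> = n choose 2"
    by (simp add: lessThan_atLeast0 gauss_sum_nat choose_two Sum_Ico_nat)
  finally show ?thesis .
qed

lemma leg'_const: "i \<in> {1..n} \<Longrightarrow> leg' n (\<lambda>_. c) i = i - 1"
proof -
  assume "i \<in> {1..n}"
  then have "{k\<in>{1..n}. beats (\<lambda>_. c) k i} = {1..<i}" by (auto simp: beats_def)
  then show ?thesis by (simp add: leg'_eq_card_beats)
qed

text \<open>Distinct spectral vectors at \<open>t = q ^ \<lambda>\<close>: the exponents \<open>e i = \<eta> i - \<lambda> l'(i)\<close> are
  strictly decreasing along \<open>beats\<close>, so they determine \<open>l'\<close> and then \<open>\<eta>\<close>.\<close>

lemma spectral_exponents_inj: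
  assumes "1 \<le> lam"
    and eq: "\<And>i. i \<in> {1..n} \<Longrightarrow> int (\<eta> i) - int lam * int (leg' n \<eta> i) = int (\<nu> i) - int lam * int (leg' n \<nu> i)"
    and i: "i \<in> {1..n}"
  shows "\<eta> i = \<nu> i"
proof -
  define e where "e = (\<lambda>\<eta> i. int (\<eta> i) - int lam * int (leg' n \<eta> i))"
  have mono: "e \<mu> i < e \<mu> k" if "beats \<mu> k i" "k \<in> {1..n}" for \<mu> i k
  proof -
    have "int lam * int (leg' n \<mu> k) < int lam * int (leg' n \<mu> i)"
      using leg'_less_if_beats[OF that] assms(1) by simp
    moreover have "\<mu> i \<le> \<mu> k" using that by (auto simp: beats_def)
    ultimately show ?thesis unfolding e_def by linarith
  qed
  have iff: "beats \<mu> k i \<longleftrightarrow> e \<mu> i < e \<mu> k" if "k \<in> {1..n}" "i \<in> {1..n}" for \<mu> i k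
  proof -
    have "k = i \<or> beats \<mu> k i \<or> beats \<mu> i k" by (auto simp: beats_def)
    then show ?thesis using mono that by (metis less_asym less_irrefl)
  qed
  have "leg' n \<eta> i = leg' n \<nu> i"
  proof -
    have "{k\<in>{1..n}. beats \<eta> k i} = {k\<in>{1..n}. beats \<nu> k i}"
      using iff i eq by (auto simp: e_def)
    then show ?thesis by (simp add: leg'_eq_card_beats)
  qed
  then show ?thesis using eq[OF i] by simp
qed

section \<open>The operators T on monomials\<close>

lemma lookup_map_key: "inj f \<Longrightarrow> lookup (Poly_Mapping.map_key f p) = lookup p \<circ> f"
  by (simp add: Poly_Mapping.map_key.rep_eq)

lemma map_key_sum:
  "inj f \<Longrightarrow> Poly_Mapping.map_key f (\<Sum>a\<in>A. g a) = (\<Sum>a\<in>A. Poly_Mapping.map_key f (g a))"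
  by (induction A rule: infinite_finite_induct) (simp_all add: Poly_Mapping.map_key_plus)

text \<open>\<open>map_key f\<close> precomposes the exponents with \<open>f\<close>, so the
  variable \<open>k\<close> moves to its preimage \<open>g k\<close>.\<close>

lemma monomial_map_key:
  assumes "inj f" "\<And>k. f (g k) = k"
  shows "monomial (Poly_Mapping.map_key f \<nu>) = (\<Prod>k\<in>keys \<nu>. Var (g k) ^ lookup \<nu> k)"
proof -
  have "Poly_Mapping.map_key f \<nu> = (\<Sum>k\<in>keys \<nu>. Poly_Mapping.map_key f (Poly_Mapping.single k (lookup \<nu> k)))"
    using map_key_sum[OF assms(1), of "\<lambda>k. Poly_Mapping.single k (lookup \<nu> k)" "keys \<nu>"]
    by (simp add: poly_mapping_sum_single)
  also have "\<dots> = (\<Sum>k\<in>keys \<nu>. Poly_Mapping.single (g k) (lookup \<nu> k))"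
  proof (rule sum.cong[OF refl])
    fix k
    show "Poly_Mapping.map_key f (Poly_Mapping.single k (lookup \<nu> k)) = Poly_Mapping.single (g k) (lookup \<nu> k)"
      using Poly_Mapping.map_key_single[OF assms(1), of "g k"] by (simp add: assms(2))
  qed
  finally show ?thesis by (simp add: monomial_sum monomial_single)
qed

abbreviation swap_exp :: "nat \<Rightarrow> expvec \<Rightarrow> expvec" where
  "swap_exp i \<equiv> Poly_Mapping.map_key (adj i)"

lemma lookup_swap_exp [simp]: "lookup (swap_exp i \<nu>) = lookup \<nu> \<circ> adj i"
  by (rule lookup_map_key) simp

lemma swap_op_monomial: "swap_op i (monomial \<nu>) = monomial (swap_exp i \<nu>)"
proof -
  have "swap_op i (monomial \<nu>) = (\<Prod>k\<in>keys \<nu>. Var (adj i k) ^ lookup \<nu> k)"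
    unfolding monomial_eq_prod_Var[of \<nu>] by (simp add: alg_hom_simps[OF alg_hom_swap] swap_Var)
  then show ?thesis by (simp add: monomial_map_key[of "adj i" "adj i"])
qed

definition cyc :: "nat \<Rightarrow> nat \<Rightarrow> nat" where
  "cyc n k = (if k = n then 1 else if 1 \<le> k \<and> k < n then Suc k else k)"

definition rot_exp :: "nat \<Rightarrow> expvec \<Rightarrow> expvec" where
  "rot_exp n \<nu> = Poly_Mapping.map_key (cyc n) \<nu> + Poly_Mapping.single n 1"

lemma inj_cyc: "1 \<le> n \<Longrightarrow> inj (cyc n)"
  by (rule inj_on_inverseI[of _ "\<lambda>k. if k = 1 then n else if 1 < k \<and> k \<le> n then k - 1 else k"])
     (simp add: cyc_def, linarith)

lemma lookup_rot_exp: "1 \<le> n \<Longrightarrow> lookup (rot_exp n \<nu>) = rot n (lookup \<nu>)"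
  by (auto simp: rot_exp_def lookup_add lookup_map_key[OF inj_cyc] lookup_single when_def
      rot_def cyc_def fun_eq_iff)

lemma inj_rot_exp: "1 \<le> n \<Longrightarrow> rot_exp n \<mu> = rot_exp n \<nu> \<Longrightarrow> \<mu> = \<nu>"
proof -
  assume n: "1 \<le> n" and "rot_exp n \<mu> = rot_exp n \<nu>"
  then have "Poly_Mapping.map_key (cyc n) \<mu> = Poly_Mapping.map_key (cyc n) \<nu>"
    by (simp add: rot_exp_def)
  then have "lookup \<mu> \<circ> cyc n = lookup \<nu> \<circ> cyc n"
    using n by (metis inj_cyc lookup_map_key)
  moreover have "k \<in> range (cyc n)" for k
  proof -
    have "k = cyc n (if k = 1 then n else if 1 < k \<and> k \<le> n then k - 1 else k)"
      using n by (auto simp: cyc_def)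
    then show ?thesis by (rule range_eqI)
  qed
  ultimately have "lookup \<mu> k = lookup \<nu> k" for k
    by (metis comp_apply imageE)
  then show ?thesis by (rule poly_mapping_eqI)
qed

lemma Var_omega_monomial:
  assumes n: "1 \<le> n" and k: "keys \<nu> \<subseteq> {1..n}"
  shows "Var n * omega_op n q (monomial \<nu>) = Const (q ^ lookup \<nu> 1) * monomial (rot_exp n \<nu>)"
proof -
  define g where "g = (\<lambda>k. if k = 1 then n else if 1 < k \<and> k \<le> n then k - 1 else k)"
  have g: "cyc n (g k) = k" for k using n by (auto simp: cyc_def g_def)
  have "omega_op n q (monomial \<nu>) = (\<Prod>k\<in>keys \<nu>. omega_op n q (Var k) ^ lookup \<nu> k)"
    unfolding monomial_eq_prod_Var[of \<nu>] by (simp add: alg_hom_simps[OF alg_hom_omega])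
  also have "\<dots> = (\<Prod>k\<in>keys \<nu>. Const (if k = 1 then q ^ lookup \<nu> k else 1) * Var (g k) ^ lookup \<nu> k)"
    using n k by (intro prod.cong refl) (auto simp: omega_Var g_def power_mult_distrib Const_power)
  also have "\<dots> = Const (q ^ lookup \<nu> 1) * (\<Prod>k\<in>keys \<nu>. Var (g k) ^ lookup \<nu> k)"
  proof -
    have "(\<Prod>k\<in>keys \<nu>. Const (if k = 1 then q ^ lookup \<nu> k else 1)) =
        (\<Prod>k\<in>keys \<nu>. if k = 1 then Const (q ^ lookup \<nu> 1) else 1)"
      by (intro prod.cong) auto
    also have "\<dots> = Const (q ^ lookup \<nu> 1)"
      by (simp add: prod.delta in_keys_iff)
    finally show ?thesis by (simp add: prod.distrib)
  qed
  also have "(\<Prod>k\<in>keys \<nu>. Var (g k) ^ lookup \<nu> k) = monomial (Poly_Mapping.map_key (cyc n) \<nu>)"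
    using monomial_map_key[OF inj_cyc[OF n] g] by simp
  finally show ?thesis
    by (simp add: rot_exp_def monomial_add Var_def mult_ac)
qed

lemma keys_sum_Const_monomial:
  "(\<And>a. a \<in> A \<Longrightarrow> e a \<in> S) \<Longrightarrow> keys (\<Sum>a\<in>A. Const (c a) * monomial (e a)) \<subseteq> S"
  using Poly_Mapping.keys_sum[of "\<lambda>a. Const (c a) * monomial (e a)" A] keys_Const_mult by fastforce

lemma keys_linear_image:
  assumes "mlinear \<phi>" "\<And>\<nu>. \<nu> \<in> keys f \<Longrightarrow> keys (\<phi> (monomial \<nu>)) \<subseteq> S"
  shows "keys (\<phi> f) \<subseteq> S"
proof -
  have "\<phi> f = (\<Sum>\<nu>\<in>keys f. Const (lookup f \<nu>) * \<phi> (monomial \<nu>))"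
    by (subst (1) mpoly_eq_sum_monomials[of f, symmetric])
       (simp add: mlinear_sum[OF assms(1)] mlinear_Const[OF assms(1)])
  then show ?thesis
    using Poly_Mapping.keys_sum[of "\<lambda>\<nu>. Const (lookup f \<nu>) * \<phi> (monomial \<nu>)" "keys f"]
      keys_Const_mult assms(2) by fastforce
qed

lemma lookup_linear_image:
  assumes "mlinear \<phi>" "finite S" "keys f \<subseteq> S"
  shows "lookup (\<phi> f) m = (\<Sum>\<nu>\<in>S. lookup f \<nu> * lookup (\<phi> (monomial \<nu>)) m)"
proof -
  have "\<phi> f = (\<Sum>\<nu>\<in>S. Const (lookup f \<nu>) * \<phi> (monomial \<nu>))"
    by (subst (1) mpoly_eq_sum_monomials'[OF assms(2,3)])
       (simp add: mlinear_sum[OF assms(1)] mlinear_Const[OF assms(1)])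
  then show ?thesis by (simp add: lookup_sum)
qed

text \<open>One factor \<open>Var (Suc i)\<close> at a time is moved through \<open>T\<close>. The
  upper limit matters: the original power reappears here with coefficient \<open>t - 1\<close>,
  whereas it is absent from \<open>T_op_Var_power\<close>.\<close>

lemma T_op_Var_Suc_power:
  "T_op t i (Var (Suc i) ^ Suc d) =
     Const t * Var i ^ Suc d + (\<Sum>k=1..Suc d. Const (t - 1) * (Var i ^ (Suc d - k) * Var (Suc i) ^ k))"
proof (induction d)
  case 0
  show ?case using T_op_Var_Suc[of t i 1] by (simp add: T_op_1 Const_diff mult_ac)
next
  case (Suc d)
  have "(\<Sum>k=1..Suc (Suc d). Const (t - 1) * (Var i ^ (Suc (Suc d) - k) * Var (Suc i) ^ k))
     = Var i * (\<Sum>k=1..Suc d. Const (t - 1) * (Var i ^ (Suc d - k) * Var (Suc i) ^ k))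
        + Const (t - 1) * Var (Suc i) ^ Suc (Suc d)"
  proof -
    have "(\<Sum>k=1..Suc d. Const (t - 1) * (Var i ^ (Suc (Suc d) - k) * Var (Suc i) ^ k)) =
      Var i * (\<Sum>k=1..Suc d. Const (t - 1) * (Var i ^ (Suc d - k) * Var (Suc i) ^ k))"
      unfolding sum_distrib_left
      by (intro sum.cong refl) (auto simp: Suc_diff_le mult_ac)
    then show ?thesis by simp
  qed
  moreover define S where "S = (\<Sum>k=1..Suc d. Const (t - 1) * (Var i ^ (Suc d - k) * Var (Suc i) ^ k))"
  ultimately have S: "(\<Sum>k=1..Suc (Suc d). Const (t - 1) * (Var i ^ (Suc (Suc d) - k) * Var (Suc i) ^ k))
     = Var i * S + Const (t - 1) * Var (Suc i) ^ Suc (Suc d)" by simp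
  have "T_op t i (Var (Suc i) ^ Suc (Suc d)) =
      Var i * (Const t * Var i ^ Suc d + S) + (Const t - 1) * Var (Suc i) * Var (Suc i) ^ Suc d"
    unfolding power_Suc[of _ "Suc d"] T_op_Var_Suc Suc.IH S_def ..
  also have "\<dots> = Const t * Var i ^ Suc (Suc d) + (Var i * S + Const (t - 1) * Var (Suc i) ^ Suc (Suc d))"
    by (simp add: distrib_left Const_diff mult_ac)
  finally show ?case unfolding S .
qed

lemma T_op_Var_power:
  "T_op t i (Var i ^ Suc d) =
     Var (Suc i) ^ Suc d - (\<Sum>k=1..d. Const (t - 1) * (Var i ^ (Suc d - k) * Var (Suc i) ^ k))"
proof (induction d)
  case 0
  show ?case using T_op_Var[of t i 1] by (simp add: T_op_1 algebra_simps)
next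
  case (Suc d)
  have "(\<Sum>k=1..Suc d. Const (t - 1) * (Var i ^ (Suc (Suc d) - k) * Var (Suc i) ^ k))
     = Var (Suc i) * (\<Sum>k=1..d. Const (t - 1) * (Var i ^ (Suc d - k) * Var (Suc i) ^ k))
        + Const (t - 1) * (Var i ^ Suc d * Var (Suc i))"
  unfolding One_nat_def sum.atLeast1_atMost_eq sum.lessThan_Suc_shift sum_distrib_left
    by (simp add: mult_ac)
  moreover define S where "S = (\<Sum>k=1..d. Const (t - 1) * (Var i ^ (Suc d - k) * Var (Suc i) ^ k))"
  ultimately have S: "(\<Sum>k=1..Suc d. Const (t - 1) * (Var i ^ (Suc (Suc d) - k) * Var (Suc i) ^ k))
     = Var (Suc i) * S + Const (t - 1) * (Var i ^ Suc d * Var (Suc i))" by simp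
  have "T_op t i (Var i ^ Suc (Suc d)) =
      Var (Suc i) * (Var (Suc i) ^ Suc d - S) - (Const t - 1) * Var (Suc i) * Var i ^ Suc d"
    unfolding power_Suc[of _ "Suc d"] T_op_Var Suc.IH S_def ..
  also have "\<dots> = Var (Suc i) ^ Suc (Suc d) - (Var (Suc i) * S + Const (t - 1) * (Var i ^ Suc d * Var (Suc i)))"
    by (simp add: Const_diff algebra_simps)
  finally show ?case unfolding S .
qed

definition set_pair :: "nat \<Rightarrow> expvec \<Rightarrow> nat \<Rightarrow> nat \<Rightarrow> expvec" where
  "set_pair i \<nu> a b = Poly_Mapping.update i 0 (Poly_Mapping.update (Suc i) 0 \<nu>)
     + Poly_Mapping.single i a + Poly_Mapping.single (Suc i) b"

lemma lookup_set_pair: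
  "lookup (set_pair i \<nu> a b) = (lookup \<nu>)(i := a, Suc i := b)"
  by (auto simp: set_pair_def lookup_add lookup_update lookup_single when_def fun_eq_iff)

lemma set_pair_same: "set_pair i \<nu> (lookup \<nu> i) (lookup \<nu> (Suc i)) = \<nu>"
  by (rule poly_mapping_eqI) (simp add: lookup_set_pair)

lemma set_pair_swap: "set_pair i \<nu> (lookup \<nu> (Suc i)) (lookup \<nu> i) = swap_exp i \<nu>"
  by (rule poly_mapping_eqI) (auto simp: lookup_set_pair Transposition.transpose_def)

text \<open>The part of the monomial in the other variables; it is symmetric and passes through
  \<open>T\<close>.\<close>

definition off_pair :: "nat \<Rightarrow> expvec \<Rightarrow> mpoly" where
  "off_pair i \<nu> = monomial (Poly_Mapping.update i 0 (Poly_Mapping.update (Suc i) 0 \<nu>))"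

lemma monomial_set_pair:
  "monomial (set_pair i \<nu> a b) = off_pair i \<nu> * (Var i ^ a * Var (Suc i) ^ b)"
  by (simp add: set_pair_def off_pair_def monomial_add monomial_single mult_ac)

lemma swap_off_pair: "swap_op i (off_pair i \<nu>) = off_pair i \<nu>"
  unfolding off_pair_def swap_op_monomial
  by (rule arg_cong[of _ _ monomial], rule poly_mapping_eqI)
     (auto simp: lookup_update Transposition.transpose_def)

text \<open>All but a pure power of one variable is symmetric: \<open>P\<close> collects the other
  variables and the common power of the two, and \<open>T_op_Var_Suc_power\<close> handles the
  rest.\<close>

lemma T_op_set_pair_less:
  assumes ab: "a < b"
  shows "T_op t i (monomial (set_pair i \<nu> a b)) = Const t * monomial (set_pair i \<nu> b a) +
    (\<Sum>k=1..b - a. Const (t - 1) * monomial (set_pair i \<nu> (b - k) (a + k)))"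
proof -
  obtain d where d: "b = a + Suc d" using ab by (metis less_imp_Suc_add add_Suc_right)
  define P where "P = off_pair i \<nu> * (Var i * Var (Suc i)) ^ a"
  have inv: "swap_op i P = P"
    unfolding P_def by (simp add: alg_hom_simps[OF alg_hom_swap] swap_off_pair swap_Var mult_ac)
  have mono: "monomial (set_pair i \<nu> (a + r) (a + s)) = P * (Var i ^ r * Var (Suc i) ^ s)" for r s
    by (simp add: monomial_set_pair P_def power_add power_mult_distrib mult_ac)
  have "T_op t i (monomial (set_pair i \<nu> a b)) = P * T_op t i (Var (Suc i) ^ Suc d)"
    using mono[of 0 "Suc d"] T_op_invariant_mult[OF inv] by (simp add: d)
  also have "\<dots> = Const t * (P * (Var i ^ Suc d * Var (Suc i) ^ 0)) + 
     (\<Sum>k=1..Suc d. Const (t - 1) * (P * (Var i ^ (Suc d - k) * Var (Suc i) ^ k)))"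
    unfolding T_op_Var_Suc_power by (simp add: distrib_left sum_distrib_left mult_ac)
  also have "\<dots> = Const t * monomial (set_pair i \<nu> b a) +
     (\<Sum>k=1..Suc d. Const (t - 1) * monomial (set_pair i \<nu> (b - k) (a + k)))"
  proof -
    have "P * (Var i ^ (Suc d - k) * Var (Suc i) ^ k) = monomial (set_pair i \<nu> (b - k) (a + k))"
      if "k \<in> {1..Suc d}" for k
      using that by (simp add: mono[symmetric] d)
    moreover have "P * (Var i ^ Suc d * Var (Suc i) ^ 0) = monomial (set_pair i \<nu> b a)"
      by (simp only: mono[symmetric] d add_0_right)
    ultimately show ?thesis by simp
  qed
  finally show ?thesis by (simp add: d)
qed

lemma T_op_set_pair_greater:
  assumes ab: "b < a"
  shows "T_op t i (monomial (set_pair i \<nu> a b)) = monomial (set_pair i \<nu> b a) -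
    (\<Sum>k=1..a - b - 1. Const (t - 1) * monomial (set_pair i \<nu> (a - k) (b + k)))"
proof -
  obtain d where d: "a = b + Suc d" using ab by (metis less_imp_Suc_add add_Suc_right)
  define P where "P = off_pair i \<nu> * (Var i * Var (Suc i)) ^ b"
  have inv: "swap_op i P = P"
    unfolding P_def by (simp add: alg_hom_simps[OF alg_hom_swap] swap_off_pair swap_Var mult_ac)
  have mono: "monomial (set_pair i \<nu> (b + r) (b + s)) = P * (Var i ^ r * Var (Suc i) ^ s)" for r s
    by (simp add: monomial_set_pair P_def power_add power_mult_distrib mult_ac)
  have "T_op t i (monomial (set_pair i \<nu> a b)) = P * T_op t i (Var i ^ Suc d)"
    using mono[of "Suc d" 0] T_op_invariant_mult[OF inv] by (simp add: d)
  also have "\<dots> = P * (Var i ^ 0 * Var (Suc i) ^ Suc d) -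
     (\<Sum>k=1..d. Const (t - 1) * (P * (Var i ^ (Suc d - k) * Var (Suc i) ^ k)))"
    unfolding T_op_Var_power by (simp add: right_diff_distrib sum_distrib_left mult_ac)
  also have "\<dots> = monomial (set_pair i \<nu> b a) -
     (\<Sum>k=1..d. Const (t - 1) * monomial (set_pair i \<nu> (a - k) (b + k)))"
  proof -
    have "P * (Var i ^ (Suc d - k) * Var (Suc i) ^ k) = monomial (set_pair i \<nu> (a - k) (b + k))"
      if "k \<in> {1..d}" for k
      using that by (simp add: mono[symmetric] d)
    moreover have "P * (Var i ^ 0 * Var (Suc i) ^ Suc d) = monomial (set_pair i \<nu> b a)"
      by (simp only: mono[symmetric] d add_0_right)
    ultimately show ?thesis by simp
  qed
  finally show ?thesis by (simp add: d)
qed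

lemma T_op_set_pair_equal: "T_op t i (monomial (set_pair i \<nu> a a)) = Const t * monomial (set_pair i \<nu> a a)"
proof -
  have "swap_op i (monomial (set_pair i \<nu> a a)) = monomial (set_pair i \<nu> a a)"
    by (simp add: monomial_set_pair alg_hom_simps[OF alg_hom_swap] swap_off_pair swap_Var mult_ac)
  from T_op_invariant_mult[OF this, of t 1] show ?thesis by (simp add: T_op_1 mult_ac)
qed

definition comps :: "nat \<Rightarrow> expvec set" where
  "comps n = {\<nu>. keys \<nu> \<subseteq> {1..n}}"

definition low_set :: "nat \<Rightarrow> expvec \<Rightarrow> expvec set" where
  "low_set n \<eta> = {\<nu>\<in>comps n. low n (lookup \<nu>) (lookup \<eta>)}"

lemma comps_iff: "\<nu> \<in> comps n \<longleftrightarrow> (\<forall>k. k \<notin> {1..n} \<longrightarrow> lookup \<nu> k = 0)"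
  by (auto simp: comps_def subset_iff in_keys_iff simp del: atLeastAtMost_iff)

lemma set_pair_comps:
  "\<nu> \<in> comps n \<Longrightarrow> 1 \<le> i \<Longrightarrow> Suc i \<le> n \<Longrightarrow> set_pair i \<nu> a b \<in> comps n"
  by (auto simp: comps_iff lookup_set_pair)

lemma set_pair_low:
  assumes "\<nu> \<in> comps n" "1 \<le> i" "Suc i \<le> n" "a + b = lookup \<nu> i + lookup \<nu> (Suc i)"
    "max a b < max (lookup \<nu> i) (lookup \<nu> (Suc i))"
  shows "set_pair i \<nu> a b \<in> low_set n \<nu>"
proof -
  have "low_step n (lookup (set_pair i \<nu> a b)) (lookup \<nu>)"
    unfolding low_step_def lookup_set_pair
    using assms by (intro bexI[of _ i] bexI[of _ "Suc i"]) auto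
  then show ?thesis using set_pair_comps[OF assms(1-3)] by (auto simp: low_set_def)
qed

lemma self_low: "\<nu> \<in> comps n \<Longrightarrow> \<nu> \<in> low_set n \<nu>"
  by (simp add: low_set_def)

lemma swap_exp_comps: "\<nu> \<in> comps n \<Longrightarrow> 1 \<le> i \<Longrightarrow> Suc i \<le> n \<Longrightarrow> swap_exp i \<nu> \<in> comps n"
  unfolding set_pair_swap[symmetric] by (rule set_pair_comps)

text \<open>Isolates the leading term: at an ascent the swapped monomial is not below \<nu>
  (\<open>swap_exp_not_low\<close>), and its coefficient \<open>t\<close> is what
  \<open>isE_swap\<close> divides out.\<close>

lemma T_op_monomial_less:
  assumes \<nu>: "\<nu> \<in> comps n" and i: "1 \<le> i" "Suc i \<le> n" and less: "lookup \<nu> i < lookup \<nu> (Suc i)"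
  shows "\<exists>g. T_op t i (monomial \<nu>) = Const t * monomial (swap_exp i \<nu>) + g \<and> keys g \<subseteq> low_set n \<nu>"
proof -
  let ?a = "lookup \<nu> i" and ?b = "lookup \<nu> (Suc i)"
  define g where "g = (\<Sum>k=1..?b - ?a. Const (t - 1) * monomial (set_pair i \<nu> (?b - k) (?a + k)))"
  have "keys g \<subseteq> low_set n \<nu>"
    unfolding g_def
  proof (rule keys_sum_Const_monomial)
    fix k assume k: "k \<in> {1..?b - ?a}"
    show "set_pair i \<nu> (?b - k) (?a + k) \<in> low_set n \<nu>"
    proof (cases "k = ?b - ?a")
      case True
      then show ?thesis using less by (simp add: set_pair_same self_low[OF \<nu>])
    next
      case False
      then show ?thesis using k by (intro set_pair_low[OF \<nu> i]) auto
    qed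
  qed
  moreover have "T_op t i (monomial \<nu>) = Const t * monomial (swap_exp i \<nu>) + g"
    using T_op_set_pair_less[OF less, of t i \<nu>] by (simp add: set_pair_same set_pair_swap g_def)
  ultimately show ?thesis by blast
qed

lemma keys_T_op_monomial:
  assumes \<nu>: "\<nu> \<in> comps n" and i: "1 \<le> i" "Suc i \<le> n"
  shows "keys (T_op t i (monomial \<nu>)) \<subseteq> insert (swap_exp i \<nu>) (low_set n \<nu>)"
proof -
  let ?a = "lookup \<nu> i" and ?b = "lookup \<nu> (Suc i)"
  consider "?a < ?b" | "?b < ?a" | "?a = ?b" by linarith
  then show ?thesis
  proof cases
    case 1
    from T_op_monomial_less[OF \<nu> i this, of t] obtain g
      where g: "T_op t i (monomial \<nu>) = Const t * monomial (swap_exp i \<nu>) + g" "keys g \<subseteq> low_set n \<nu>"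
      by blast
    show ?thesis
      unfolding g(1) using g(2) keys_Const_mult[of t "monomial (swap_exp i \<nu>)"]
        Poly_Mapping.keys_add[of "Const t * monomial (swap_exp i \<nu>)" g] by auto
  next
    case 2
    define g where "g = (\<Sum>k=1..?a - ?b - 1. Const (t - 1) * monomial (set_pair i \<nu> (?a - k) (?b + k)))"
    have "keys g \<subseteq> low_set n \<nu>"
      unfolding g_def
      by (rule keys_sum_Const_monomial, rule set_pair_low[OF \<nu> i]) auto
    moreover have "T_op t i (monomial \<nu>) = monomial (swap_exp i \<nu>) - g"
      using T_op_set_pair_greater[OF 2, of t i \<nu>] by (simp add: set_pair_same set_pair_swap g_def)
    moreover have "keys (monomial (swap_exp i \<nu>) - g) \<subseteq> insert (swap_exp i \<nu>) (keys g)"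
      by (auto simp: in_keys_iff lookup_minus lookup_monomial split: if_splits)
    ultimately show ?thesis by auto
  next
    case 3
    have "T_op t i (monomial \<nu>) = Const t * monomial \<nu>"
      using T_op_set_pair_equal[of t i \<nu> ?a] set_pair_same[of i \<nu>] 3 by simp
    then show ?thesis using keys_Const_mult[of t "monomial \<nu>"] self_low[OF \<nu>] by auto
  qed
qed

section \<open>Existence\<close>

definition spec_val :: "nat \<Rightarrow> real \<Rightarrow> real \<Rightarrow> (nat \<Rightarrow> nat) \<Rightarrow> nat \<Rightarrow> real" where
  "spec_val n q t \<eta> i = q ^ \<eta> i * t powi (- int (leg' n \<eta> i))"

abbreviation wt :: "nat \<Rightarrow> expvec \<Rightarrow> nat" where
  "wt n \<nu> \<equiv> \<Sum>i=1..n. lookup \<nu> i"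

lemma rot_exp_low_set:
  "1 \<le> n \<Longrightarrow> \<nu> \<in> low_set n \<eta> \<Longrightarrow> rot_exp n \<nu> \<in> low_set n (rot_exp n \<eta>)"
  by (auto simp: low_set_def comps_iff lookup_rot_exp low_rot) (auto simp: rot_def)

lemma low_set_trans: "\<mu> \<in> low_set n \<nu> \<Longrightarrow> \<nu> \<in> low_set n \<eta> \<Longrightarrow> \<mu> \<in> low_set n \<eta>"
  by (auto simp: low_set_def)

lemma swap_exp_low_set:
  assumes i: "1 \<le> i" "Suc i \<le> n" and \<eta>: "lookup \<eta> i < lookup \<eta> (Suc i)" and \<nu>: "\<nu> \<in> low_set n \<eta>"
  shows "\<nu> \<in> low_set n (swap_exp i \<eta>)" "swap_exp i \<nu> \<in> low_set n (swap_exp i \<eta>)"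
  using low_adj[OF i \<eta>, of "lookup \<nu>"] \<nu> swap_exp_comps[OF _ i] by (auto simp: low_set_def)

lemma swap_exp_not_low:
  assumes i: "1 \<le> i" "Suc i \<le> n" and \<eta>: "lookup \<eta> i < lookup \<eta> (Suc i)"
  shows "swap_exp i \<eta> \<notin> low_set n \<eta>"
proof
  assume "swap_exp i \<eta> \<in> low_set n \<eta>"
  then have "low n (lookup \<eta> \<circ> adj i) (lookup \<eta>)" by (simp add: low_set_def)
  moreover have "low n (lookup \<eta>) (lookup \<eta> \<circ> adj i)"
    using low_step_adj_up[OF i \<eta>] by blast
  ultimately have "lookup \<eta> \<circ> adj i = lookup \<eta>" by (rule low_antisym)
  from fun_cong[OF this, of i] show False using \<eta> by simp
qed

context hecke
begin

text \<open>The support is bounded by \<open>low\<close>, which can be followed through swaps and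
  rotations; \<open>isE_imp_nonsym_macdonald\<close> passes to the order of the original
  definition.\<close>

definition isE :: "expvec \<Rightarrow> mpoly \<Rightarrow> bool" where
  "isE \<eta> E \<longleftrightarrow> keys E \<subseteq> low_set n \<eta> \<and> lookup E \<eta> = 1 \<and>
     (\<forall>i\<in>{1..n}. Y i E = Const (spec_val n q t (lookup \<eta>) i) * E)"

lemma foldr_T_1: "foldr T js 1 = Const (t ^ length js)"
proof (induction js)
  case (Cons j js)
  then show ?case using T_op_Const_mult[of t j "t ^ length js" 1] by (simp add: T_op_1 Const_mult mult_ac)
qed simp

lemma Ti_1: "Ti j 1 = Const (inverse t)"
proof -
  have "Const t * Ti j 1 = 1" 
    using Const_t_Ti[of j 1] by (simp add: T_op_1)
  also have "1 = Const t * Const (inverse t)" using t_nz by (simp add: Const_mult_inverse)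
  finally show ?thesis using t_nz by simp
qed

lemma foldr_Ti_1: "foldr Ti js 1 = Const (inverse t ^ length js)"
proof (induction js)
  case (Cons j js)
  have "Ti j (Const (inverse t ^ length js) * 1) = Const (inverse t ^ length js) * Ti j 1"
    by (rule mlinear_Const[OF mlinear_Ti])
  then show ?case using Cons by (simp add: Ti_1 mult_ac flip: Const_mult)
qed simp

text \<open>On 1 every \<open>T\<close> acts as \<open>t\<close> and \<omega> trivially, so only
  powers of \<open>t\<close> have to be collected.\<close>

lemma isE_0: "isE 0 1"
proof -
  have "Y i 1 = Const (spec_val n q t (lookup 0) i) * 1" if i: "i \<in> {1..n}" for i
  proof -
    have "foldr T [i..<n] (Const (inverse t ^ (i - 1)) * 1) = Const (inverse t ^ (i - 1)) * Const (t ^ (n - i))"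
      unfolding mlinear_Const[OF mlinear_foldr[OF mlinear_T_op]] foldr_T_1 by simp
    then have "Y i 1 = Const (t powi (int i - int n) * (inverse t ^ (i - 1) * t ^ (n - i)))"
      unfolding Y_eq foldr_Ti_1 by (simp add: omega_simps Const_mult)
    also have "t powi (int i - int n) * (inverse t ^ (i - 1) * t ^ (n - i)) = t powi (- int (i - 1))"
    proof -
      have "t powi (int i - int n) * t ^ (n - i) = 1"
      proof -
        have "t ^ (n - i) = t powi (int n - int i)" using i by (simp add: power_int_def nat_diff_distrib)
        then show ?thesis using t_nz by (simp add: power_int_add[symmetric])
      qed
      moreover have "inverse t ^ (i - 1) = t powi (- int (i - 1))"
        by (simp add: power_int_minus power_inverse)
      ultimately show ?thesis by (simp add: mult_ac)
    qed
    also have "t powi (- int (i - 1)) = spec_val n q t (lookup 0) i"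
    proof -
      have z: "lookup (0::expvec) = (\<lambda>_. 0)" by (simp add: fun_eq_iff)
      show ?thesis unfolding spec_val_def z leg'_const[OF i] by simp
    qed
    finally show ?thesis by simp
  qed
  then show ?thesis by (auto simp: isE_def low_set_def comps_def)
qed

text \<open>\<open>Y_raise\<close> shifts the eigenvalues by one place and
  \<open>Y_raise_last\<close> puts \<open>q\<close> times the first one at the end, just as
  \<open>rot\<close> treats the parts. The scalar removes the factor
  \<open>q ^ lookup \<eta> 1\<close> that \<omega> gives the leading monomial.\<close>

lemma isE_rot:
  assumes \<eta>: "\<eta> \<in> comps n" and E: "isE \<eta> E"
  shows "isE (rot_exp n \<eta>) (Const (inverse (q ^ lookup \<eta> 1)) * (Var n * \<omega> E))"
proof -
  define G where "G = Var n * \<omega> E"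
  define c where "c = inverse (q ^ lookup \<eta> 1)"
  have lin: "mlinear (\<lambda>f. Var n * \<omega> f)"
    by (rule mlinear_comp[OF mlinear_mult mlinear_omega])
  have kE: "keys E \<subseteq> low_set n \<eta>" using E by (simp add: isE_def)
  have mono: "Var n * \<omega> (monomial \<nu>) = Const (q ^ lookup \<nu> 1) * monomial (rot_exp n \<nu>)"
    if "\<nu> \<in> keys E" for \<nu>
    using that kE by (intro Var_omega_monomial n_ge_1) (auto simp: low_set_def comps_def)
  have "keys G \<subseteq> low_set n (rot_exp n \<eta>)"
    unfolding G_def
  proof (rule keys_linear_image[OF lin])
    fix \<nu> assume \<nu>: "\<nu> \<in> keys E"
    then have "rot_exp n \<nu> \<in> low_set n (rot_exp n \<eta>)"
      using kE by (intro rot_exp_low_set n_ge_1) auto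
    then show "keys (Var n * \<omega> (monomial \<nu>)) \<subseteq> low_set n (rot_exp n \<eta>)"
      unfolding mono[OF \<nu>] using keys_Const_mult[of "q ^ lookup \<nu> 1" "monomial (rot_exp n \<nu>)"] by auto
  qed
  moreover have "lookup G (rot_exp n \<eta>) = q ^ lookup \<eta> 1"
  proof -
    have "lookup G (rot_exp n \<eta>) = (\<Sum>\<nu>\<in>keys E. lookup E \<nu> * lookup (Var n * \<omega> (monomial \<nu>)) (rot_exp n \<eta>))"
      unfolding G_def by (rule lookup_linear_image[OF lin]) auto
    also have "\<dots> = (\<Sum>\<nu>\<in>keys E. if \<nu> = \<eta> then q ^ lookup \<eta> 1 else 0)"
    proof (rule sum.cong[OF refl])
      fix \<nu> assume \<nu>: "\<nu> \<in> keys E"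
      show "lookup E \<nu> * lookup (Var n * \<omega> (monomial \<nu>)) (rot_exp n \<eta>) = (if \<nu> = \<eta> then q ^ lookup \<eta> 1 else 0)"
        unfolding mono[OF \<nu>] lookup_Const_mult lookup_monomial
        using E inj_rot_exp[OF n_ge_1, of \<eta> \<nu>] by (auto simp: isE_def)
    qed
    also have "\<dots> = q ^ lookup \<eta> 1"
      using E by (auto simp: sum.delta isE_def in_keys_iff)
    finally show ?thesis .
  qed
  moreover have "Y i G = Const (spec_val n q t (lookup (rot_exp n \<eta>)) i) * G" if i: "i \<in> {1..n}" for i
  proof (cases "i = n")
    case True
    have "leg' n (rot n (lookup \<eta>)) n = leg' n (lookup \<eta>) 1"
      using leg'_rot[of 1 n "lookup \<eta>"] n_ge_1 by simp
    moreover have "rot n (lookup \<eta>) n = Suc (lookup \<eta> 1)" by (simp add: rot_def)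
    ultimately have "spec_val n q t (lookup (rot_exp n \<eta>)) n = q * spec_val n q t (lookup \<eta>) 1"
      by (simp add: spec_val_def lookup_rot_exp[OF n_ge_1])
    moreover have "Y 1 E = Const (spec_val n q t (lookup \<eta>) 1) * E"
      using E n_ge_1 by (auto simp: isE_def)
    ultimately show ?thesis
      using Y_raise_last[of E] True by (simp add: G_def omega_simps Const_mult mult_ac)
  next
    case False
    then have i': "1 \<le> i" "i < n" using i by auto
    have "leg' n (rot n (lookup \<eta>)) i = leg' n (lookup \<eta>) (Suc i)"
      using leg'_rot[of "Suc i" n "lookup \<eta>"] i' by simp
    moreover have "rot n (lookup \<eta>) i = lookup \<eta> (Suc i)" using i' by (simp add: rot_def)
    ultimately have "spec_val n q t (lookup (rot_exp n \<eta>)) i = spec_val n q t (lookup \<eta>) (Suc i)"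
      by (simp add: spec_val_def lookup_rot_exp[OF n_ge_1])
    moreover have "Y (Suc i) E = Const (spec_val n q t (lookup \<eta>) (Suc i)) * E"
      using E i' by (auto simp: isE_def)
    ultimately show ?thesis
      using Y_raise[OF i', of E] by (simp add: G_def omega_simps mult_ac)
  qed
  ultimately show ?thesis
    unfolding isE_def G_def[symmetric] c_def[symmetric]
    using keys_Const_mult[of c G] q_nz
    by (simp add: c_def mlinear_Const[OF mlinear_Y] mult.left_commute)
qed

text \<open>The intertwiner exchanges the two eigenvalues and moves up in the order. The coefficient
  of the swapped monomial comes from \<eta> alone: any other \<nu> in the support would have to
  share the swap of \<eta> or lie above it, and both are excluded.\<close>

lemma isE_swap:
  assumes \<eta>: "\<eta> \<in> comps n" and i: "1 \<le> i" "Suc i \<le> n" and less: "lookup \<eta> i < lookup \<eta> (Suc i)"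
    and E: "isE \<eta> E"
    and ab: "spec_val n q t (lookup \<eta>) i \<noteq> spec_val n q t (lookup \<eta>) (Suc i)"
  defines "a \<equiv> spec_val n q t (lookup \<eta>) i" and "b \<equiv> spec_val n q t (lookup \<eta>) (Suc i)"
  shows "isE (swap_exp i \<eta>) (Const (inverse t) * (T i E + Const (a * (t - 1) / (b - a)) * E))"
proof -
  define \<kappa> where "\<kappa> = a * (t - 1) / (b - a)"
  define G where "G = T i E + Const \<kappa> * E"
  have kE: "keys E \<subseteq> low_set n \<eta>" using E by (simp add: isE_def)
  have YE: "Y j E = Const (spec_val n q t (lookup \<eta>) j) * E" if "j \<in> {1..n}" for j
    using E that by (simp add: isE_def)
  have notin: "swap_exp i \<eta> \<notin> low_set n \<eta>" by (rule swap_exp_not_low[OF i less])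
  have kT: "keys (T i E) \<subseteq> low_set n (swap_exp i \<eta>)"
  proof (rule keys_linear_image[OF mlinear_T_op])
    fix \<nu> assume "\<nu> \<in> keys E"
    then have \<nu>: "\<nu> \<in> low_set n \<eta>" using kE by auto
    then have "\<nu> \<in> comps n" by (simp add: low_set_def)
    then show "keys (T i (monomial \<nu>)) \<subseteq> low_set n (swap_exp i \<eta>)"
      using keys_T_op_monomial[of \<nu> n i t] i swap_exp_low_set[OF i less \<nu>] low_set_trans by blast
  qed
  have "keys G \<subseteq> low_set n (swap_exp i \<eta>)"
    unfolding G_def using kT kE swap_exp_low_set(1)[OF i less] keys_Const_mult[of \<kappa> E]
      Poly_Mapping.keys_add[of "T i E" "Const \<kappa> * E"] by blast
  moreover have "lookup G (swap_exp i \<eta>) = t"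
  proof -
    have "lookup (T i E) (swap_exp i \<eta>) = (\<Sum>\<nu>\<in>keys E. lookup E \<nu> * lookup (T i (monomial \<nu>)) (swap_exp i \<eta>))"
      by (rule lookup_linear_image[OF mlinear_T_op]) auto
    also have "\<dots> = (\<Sum>\<nu>\<in>keys E. if \<nu> = \<eta> then t else 0)"
    proof (rule sum.cong[OF refl])
      fix \<nu> assume "\<nu> \<in> keys E"
      then have \<nu>: "\<nu> \<in> low_set n \<eta>" using kE by auto
      then have c: "\<nu> \<in> comps n" by (simp add: low_set_def)
      show "lookup E \<nu> * lookup (T i (monomial \<nu>)) (swap_exp i \<eta>) = (if \<nu> = \<eta> then t else 0)"
      proof (cases "\<nu> = \<eta>")
        case True
        from T_op_monomial_less[OF \<eta> i less, of t] obtain g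
          where g: "T i (monomial \<eta>) = Const t * monomial (swap_exp i \<eta>) + g" "keys g \<subseteq> low_set n \<eta>" by blast
        have "lookup g (swap_exp i \<eta>) = 0" using g(2) notin by (auto simp: in_keys_iff)
        then show ?thesis using True E by (simp add: g(1) lookup_add lookup_monomial isE_def)
      next
        case False
        have "swap_exp i \<eta> \<noteq> swap_exp i \<nu>"
        proof
          assume "swap_exp i \<eta> = swap_exp i \<nu>"
          then have "lookup \<eta> \<circ> adj i = lookup \<nu> \<circ> adj i" by (metis lookup_swap_exp)
          then have "lookup \<eta> (adj i (adj i k)) = lookup \<nu> (adj i (adj i k))" for k
            by (metis comp_apply)
          then have "\<eta> = \<nu>" by (intro poly_mapping_eqI) (simp only: transpose_involutory)
          then show False using False by simp
        qed
        moreover have "swap_exp i \<eta> \<notin> low_set n \<nu>" using notin low_set_trans[OF _ \<nu>] by blast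
        ultimately have "swap_exp i \<eta> \<notin> keys (T i (monomial \<nu>))"
          using keys_T_op_monomial[OF c i, of t] by auto
        then show ?thesis using False by (simp add: in_keys_iff)
      qed
    qed
    also have "\<dots> = t"
      using E by (auto simp: sum.delta isE_def in_keys_iff)
    finally have "lookup (T i E) (swap_exp i \<eta>) = t" .
    moreover have "lookup E (swap_exp i \<eta>) = 0" using kE notin by (auto simp: in_keys_iff)
    ultimately show ?thesis by (simp add: G_def lookup_add)
  qed
  moreover have "Y j G = Const (spec_val n q t (lookup (swap_exp i \<eta>)) j) * G" if j: "j \<in> {1..n}" for j
  proof -
    have sv: "spec_val n q t (lookup (swap_exp i \<eta>)) j = spec_val n q t (lookup \<eta>) (adj i j)"
      using leg'_adj[OF i, of "lookup \<eta>" j] less by (simp add: spec_val_def)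
    have ni: "i < n" using i by simp
    have "Y i E = Const a * E" "Y (Suc i) E = Const b * E" "a \<noteq> b"
      using YE i ab by (auto simp: a_def b_def)
    from intertwiner[OF i(1) ni this] have I: "Y i G = Const b * G" "Y (Suc i) G = Const a * G"
      by (simp_all add: G_def \<kappa>_def)
    show ?thesis
    proof (cases "j = i \<or> j = Suc i")
      case True
      then show ?thesis unfolding sv using I by (auto simp: a_def b_def)
    next
      case False
      then have "Y j (T i E) = Const (spec_val n q t (lookup \<eta>) j) * T i E"
        using T_Y_commute[of i j E] i j YE[OF j] by (simp add: T_op_Const_mult)
      then have "Y j G = Const (spec_val n q t (lookup \<eta>) j) * G"
        unfolding G_def mlinear_add[OF mlinear_Y] mlinear_Const[OF mlinear_Y] YE[OF j]
        by (simp add: distrib_left mult_ac)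
      then show ?thesis unfolding sv using False by simp
    qed
  qed
  ultimately show ?thesis
    unfolding isE_def G_def[symmetric] \<kappa>_def[symmetric]
    using keys_Const_mult[of "inverse t" G] t_nz
    by (simp add: mlinear_Const[OF mlinear_Y] mult.left_commute)
qed

end

section \<open>Uniqueness\<close>

context hecke
begin

text \<open>Both statements are proved together by removing a maximal \<nu> from the down-closed
  set. Existing eigenvectors replace any computation of \<open>Y\<close> on monomials: modulo the
  monomials of the smaller set, everything is a multiple of \<open>Ef \<nu>\<close>, so stability of
  the smaller span gives stability of the larger one.\<close>

lemma eigenvector_unique:
  assumes "finite S" "S \<subseteq> comps n" "\<And>\<nu>. \<nu> \<in> S \<Longrightarrow> isE \<nu> (Ef \<nu>)"
    "\<And>\<nu> \<mu>. \<nu> \<in> S \<Longrightarrow> \<mu> \<in> low_set n \<nu> \<Longrightarrow> \<mu> \<in> S"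
  shows "(\<forall>D. keys D \<subseteq> S \<longrightarrow> (\<forall>i\<in>{1..n}. keys (Y i D) \<subseteq> S)) \<and>
    (\<forall>D z. keys D \<subseteq> S \<longrightarrow> (\<forall>i\<in>{1..n}. Y i D = Const (z i) * D) \<longrightarrow>
       (\<forall>\<nu>\<in>S. \<exists>i\<in>{1..n}. spec_val n q t (lookup \<nu>) i \<noteq> z i) \<longrightarrow> D = 0)"
  using assms
proof (induction S rule: finite_psubset_induct)
  case (psubset S)
  show ?case
  proof (cases "S = {}")
    case True
    then show ?thesis by (auto simp: mlinear_0[OF mlinear_Y])
  next
    case False
    define R where "R = (\<lambda>\<mu> \<nu>. comp_less n (lookup \<mu>) (lookup \<nu>))"
    have "asymp_on S R"
      by (rule asymp_onI) (use comp_less_trans comp_less_irrefl in \<open>unfold R_def, blast\<close>)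
    moreover have "transp_on S R"
      by (rule transp_onI) (use comp_less_trans in \<open>unfold R_def, blast\<close>)
    ultimately have "\<exists>m\<in>S. \<forall>x\<in>S. x \<noteq> m \<longrightarrow> \<not> R m x"
      by (rule Finite_Set.bex_max_element[OF psubset.hyps(1) _ _ False])
    then obtain \<nu>
      where \<nu>: "\<nu> \<in> S" and max: "\<And>\<mu>. \<mu> \<in> S \<Longrightarrow> \<mu> \<noteq> \<nu> \<Longrightarrow> \<not> R \<nu> \<mu>" by blast
    define S' where "S' = S - {\<nu>}"
    have S': "S' \<subset> S" using \<nu> by (auto simp: S'_def)
    have down: "\<mu> \<in> S'" if "\<mu>' \<in> S'" "\<mu> \<in> low_set n \<mu>'" for \<mu> \<mu>'
    proof -
      have "\<mu> \<noteq> \<nu>"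
      proof
        assume "\<mu> = \<nu>"
        then have "low n (lookup \<nu>) (lookup \<mu>')" using that by (simp add: low_set_def)
        then have "lookup \<nu> = lookup \<mu>' \<or> R \<nu> \<mu>'" unfolding R_def by (rule low_comp_less)
        then have "\<nu> = \<mu>' \<or> R \<nu> \<mu>'" by (simp only: poly_mapping.lookup_inject)
        then show False using that(1) max[of \<mu>'] by (auto simp: S'_def)
      qed
      then show ?thesis using psubset.prems(3) that by (auto simp: S'_def)
    qed
    have E\<nu>: "isE \<nu> (Ef \<nu>)" using psubset.prems(2) \<nu> .
    have kE: "keys (Ef \<nu>) \<subseteq> S" using E\<nu> psubset.prems(3)[OF \<nu>] by (auto simp: isE_def)
    have H: "(\<forall>D. keys D \<subseteq> S' \<longrightarrow> (\<forall>i\<in>{1..n}. keys (Y i D) \<subseteq> S')) \<and>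
      (\<forall>D z. keys D \<subseteq> S' \<longrightarrow> (\<forall>i\<in>{1..n}. Y i D = Const (z i) * D) \<longrightarrow>
         (\<forall>\<nu>\<in>S'. \<exists>i\<in>{1..n}. spec_val n q t (lookup \<nu>) i \<noteq> z i) \<longrightarrow> D = 0)"
    proof (rule psubset.IH[OF S'])
      show "S' \<subseteq> comps n" using S' psubset.prems(1) by auto
      show "isE \<nu> (Ef \<nu>)" if "\<nu> \<in> S'" for \<nu>
        using psubset.prems(2) that S' by auto
    qed (rule down)
    have IH: "keys D \<subseteq> S' \<Longrightarrow> i \<in> {1..n} \<Longrightarrow> keys (Y i D) \<subseteq> S'" for D i
      using H[THEN conjunct1, THEN spec, of D] by blast
    \<comment> \<open>As \<open>Ef \<nu>\<close> has coefficient 1 at \<nu>, this subtraction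
      removes that coefficient of \<open>D\<close>.\<close>
    define rest where "rest = (\<lambda>D. D - Const (lookup D \<nu>) * Ef \<nu>)"
    have rest: "keys (rest D) \<subseteq> S'" if "keys D \<subseteq> S" for D
    proof
      fix m assume m: "m \<in> keys (rest D)"
      have "m \<noteq> \<nu>" using m E\<nu> by (auto simp: rest_def in_keys_iff lookup_minus isE_def)
      moreover have "m \<in> keys D \<union> keys (Ef \<nu>)"
        using m by (auto simp: rest_def in_keys_iff lookup_minus)
      then have "m \<in> S" using that kE by blast
      ultimately show "m \<in> S'" by (simp add: S'_def)
    qed
    have YD: "Y i D = Y i (rest D) + Const (spec_val n q t (lookup \<nu>) i) * (D - rest D)"
      if "i \<in> {1..n}" for i D
    proof -
      have "Y i (D - rest D) = Const (spec_val n q t (lookup \<nu>) i) * (D - rest D)"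
        using E\<nu> that by (simp add: rest_def isE_def mlinear_Const[OF mlinear_Y] mult.left_commute)
      then show ?thesis using mlinear_add[OF mlinear_Y, of i "rest D" "D - rest D"] by simp
    qed
    show ?thesis
    proof (intro conjI allI impI ballI)
      fix D :: mpoly and i assume D: "keys D \<subseteq> S" and i: "i \<in> {1..n}"
      show "keys (Y i D) \<subseteq> S"
      proof
        fix m assume "m \<in> keys (Y i D)"
        then have "m \<in> keys (Y i (rest D)) \<union> keys D \<union> keys (rest D)"
          by (subst (asm) YD[OF i, of D]) (auto simp: in_keys_iff lookup_add lookup_minus)
        then show "m \<in> S"
          using IH[OF rest[OF D] i] rest[OF D] D S' by blast
      qed
    next
      fix D :: mpoly and z assume D: "keys D \<subseteq> S" and eig: "\<forall>i\<in>{1..n}. Y i D = Const (z i) * D"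
        and sep: "\<forall>\<nu>\<in>S. \<exists>i\<in>{1..n}. spec_val n q t (lookup \<nu>) i \<noteq> z i"
      obtain i where i: "i \<in> {1..n}" and ne: "spec_val n q t (lookup \<nu>) i \<noteq> z i"
        using sep \<nu> by blast
      define c where "c = spec_val n q t (lookup \<nu>) i"
      have "keys D \<subseteq> S'"
      proof
        fix m assume m: "m \<in> keys D"
        have "Const (z i) * D = Y i (rest D) + Const c * (D - rest D)"
          using eig i YD[OF i, of D] by (simp add: c_def)
        then have "lookup (Const (z i) * D) m = lookup (Y i (rest D) + Const c * (D - rest D)) m" by simp
        then have "z i * lookup D m = lookup (Y i (rest D)) m + c * (lookup D m - lookup (rest D) m)"
          by (simp only: lookup_add lookup_minus lookup_Const_mult)
        \<comment> \<open>The right-hand side is supported in \<open>S'\<close> and the factor on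
          the left is nonzero, so \<open>D\<close> is supported in \<open>S'\<close> as
          well.\<close>
        then have p: "(z i - c) * lookup D m = lookup (Y i (rest D)) m - c * lookup (rest D) m"
          unfolding left_diff_distrib right_diff_distrib by linarith
        have "z i - c \<noteq> 0" unfolding c_def using ne by simp
        moreover have "lookup D m \<noteq> 0" using m by (simp add: in_keys_iff)
        ultimately have "(z i - c) * lookup D m \<noteq> 0" by (rule no_zero_divisors)
        then have "\<not> (lookup (Y i (rest D)) m = 0 \<and> lookup (rest D) m = 0)"
          unfolding p by fastforce
        then have "m \<in> keys (Y i (rest D)) \<union> keys (rest D)" by (simp add: in_keys_iff)
        then show "m \<in> S'" using IH[OF rest[OF D] i] rest[OF D] by blast
      qed
      moreover have sep': "\<forall>\<nu>\<in>S'. \<exists>i\<in>{1..n}. spec_val n q t (lookup \<nu>) i \<noteq> z i"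
        using sep S' by blast
      ultimately show "D = 0"
        using H[THEN conjunct2, THEN spec, THEN spec, of D z] eig by blast
    qed
  qed
qed

lemma low_set_lower_comps: "\<nu> \<in> low_set n \<eta> \<Longrightarrow> \<nu> = \<eta> \<or> \<nu> \<in> lower_comps n \<eta>"
proof -
  assume \<nu>: "\<nu> \<in> low_set n \<eta>"
  then have "lookup \<nu> = lookup \<eta> \<or> comp_less n (lookup \<nu>) (lookup \<eta>)"
    by (intro low_comp_less) (simp add: low_set_def)
  then show ?thesis
    using \<nu> by (auto simp: low_set_def lower_comps_def comps_def poly_mapping.lookup_inject)
qed

lemma self_not_lower: "\<eta> \<notin> lower_comps n \<eta>"
  by (simp add: lower_comps_def comp_less_irrefl)

lemma isE_imp_nonsym_macdonald:
  assumes "isE \<eta> E"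
  shows "is_nonsym_macdonald n q t \<eta> E"
  unfolding is_nonsym_macdonald_def
proof (intro conjI exI)
  have "keys E \<subseteq> insert \<eta> (lower_comps n \<eta>)"
    using assms low_set_lower_comps by (auto simp: isE_def)
  from mpoly_eq_sum_monomials'[OF _ this]
  have "E = Const (lookup E \<eta>) * monomial \<eta> + (\<Sum>\<nu>\<in>lower_comps n \<eta>. Const (lookup E \<nu>) * monomial \<nu>)"
    by (simp add: finite_lower_comps self_not_lower)
  then show "E = monomial \<eta> + (\<Sum>\<nu>\<in>lower_comps n \<eta>. Const (lookup E \<nu>) * monomial \<nu>)"
    using assms by (simp add: isE_def)
qed (use assms in \<open>simp add: isE_def spec_val_def\<close>)

text \<open>Two candidates are both monic in \<eta>, so their difference lives on strictly smaller
  compositions but still has the spectrum of \<eta>; \<open>eigenvector_unique\<close> on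
  \<open>lower_comps n \<eta>\<close> makes it vanish.\<close>

lemma nonsym_macdonald_eq:
  assumes E: "isE \<eta> E" and Ef: "\<And>\<nu>. \<nu> \<in> lower_comps n \<eta> \<Longrightarrow> \<exists>E. isE \<nu> E"
    and sep: "\<And>\<nu>. \<nu> \<in> lower_comps n \<eta> \<Longrightarrow>
      \<exists>i\<in>{1..n}. spec_val n q t (lookup \<nu>) i \<noteq> spec_val n q t (lookup \<eta>) i"
  shows "nonsym_macdonald n q t \<eta> = E"
  unfolding nonsym_macdonald_def
proof (rule the_equality)
  show "is_nonsym_macdonald n q t \<eta> E" by (rule isE_imp_nonsym_macdonald[OF E])
  fix E' assume E': "is_nonsym_macdonald n q t \<eta> E'"
  then obtain b where b: "E' = monomial \<eta> + (\<Sum>\<nu>\<in>lower_comps n \<eta>. Const (b \<nu>) * monomial \<nu>)"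
    unfolding is_nonsym_macdonald_def by blast
  define D where "D = E' - E"
  have "keys D \<subseteq> lower_comps n \<eta>"
  proof
    fix m assume m: "m \<in> keys D"
    define r where "r = (\<Sum>\<nu>\<in>lower_comps n \<eta>. Const (b \<nu>) * monomial \<nu>)"
    have k: "keys r \<subseteq> lower_comps n \<eta>"
      unfolding r_def using keys_sum_Const_monomial[of "lower_comps n \<eta>" "\<lambda>\<nu>. \<nu>" "lower_comps n \<eta>" b] by simp
    have lE': "lookup E' m = lookup (monomial \<eta>) m" if "m \<notin> lower_comps n \<eta>"
    proof -
      have "m \<notin> keys r" using k that by blast
      then have "lookup r m = 0" by (simp add: in_keys_iff)
      then show ?thesis by (simp add: b lookup_add flip: r_def)
    qed
    show "m \<in> lower_comps n \<eta>"
    proof (rule ccontr)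
      assume nm: "m \<notin> lower_comps n \<eta>"
      have "lookup E m = lookup (monomial \<eta>) m"
      proof (cases "m = \<eta>")
        case True
        then show ?thesis using E by (simp add: isE_def lookup_monomial)
      next
        case False
        then have "m \<notin> low_set n \<eta>" using nm low_set_lower_comps by blast
        then have "lookup E m = 0" using E by (metis in_keys_iff isE_def subsetD)
        then show ?thesis using False by (simp add: lookup_monomial)
      qed
      then show False using lE'[OF nm] m by (simp add: D_def in_keys_iff lookup_minus)
    qed
  qed
  moreover have eig: "\<forall>i\<in>{1..n}. Y i D = Const (spec_val n q t (lookup \<eta>) i) * D"
    using E E' by (auto simp: D_def is_nonsym_macdonald_def isE_def spec_val_def
        mlinear_diff[OF mlinear_Y] right_diff_distrib)
  moreover have U: "\<forall>D z. keys D \<subseteq> lower_comps n \<eta> \<longrightarrow> (\<forall>i\<in>{1..n}. Y i D = Const (z i) * D) \<longrightarrow>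
      (\<forall>\<nu>\<in>lower_comps n \<eta>. \<exists>i\<in>{1..n}. spec_val n q t (lookup \<nu>) i \<noteq> z i) \<longrightarrow> D = 0"
  proof (rule eigenvector_unique[OF finite_lower_comps, THEN conjunct2])
    show "isE \<nu> (SOME E. isE \<nu> E)" if "\<nu> \<in> lower_comps n \<eta>" for \<nu>
      using Ef[OF that] by (rule someI_ex)
    show "\<mu> \<in> lower_comps n \<eta>" if "\<nu> \<in> lower_comps n \<eta>" and "\<mu> \<in> low_set n \<nu>" for \<mu> \<nu>
      using low_set_lower_comps[OF that(2)]
    proof
      assume "\<mu> \<in> lower_comps n \<nu>"
      then show "\<mu> \<in> lower_comps n \<eta>"
        using that(1) comp_less_trans[of n "lookup \<mu>" "lookup \<nu>" "lookup \<eta>"]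
        by (simp add: lower_comps_def)
    qed (use that in simp)
  qed (auto simp: lower_comps_def comps_def)
  ultimately have "D = 0"
    using U[THEN spec, THEN spec, of D "spec_val n q t (lookup \<eta>)"] sep by blast
  then show "E' = E" by (simp add: D_def)
qed

end

section \<open>Continuity in t and the value at t = 1\<close>

text \<open>The common finite support turns evaluation at a point into a finite sum of continuous
  coefficients.\<close>

definition coeff_cont :: "(real \<Rightarrow> mpoly) \<Rightarrow> bool" where
  "coeff_cont F \<longleftrightarrow> (\<exists>S. finite S \<and> (\<forall>u. keys (F u) \<subseteq> S)) \<and> (\<forall>m. isCont (\<lambda>u. lookup (F u) m) 1)"

lemma coeff_cont_const: "coeff_cont (\<lambda>_. p)"
  by (auto simp: coeff_cont_def intro: exI[of _ "keys p"])

lemma coeff_cont_add: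
  assumes "coeff_cont F" "coeff_cont G"
  shows "coeff_cont (\<lambda>u. F u + G u)"
proof -
  obtain S S' where S: "finite S" "\<And>u. keys (F u) \<subseteq> S" "finite S'" "\<And>u. keys (G u) \<subseteq> S'"
    using assms unfolding coeff_cont_def by blast
  have "keys (F u + G u) \<subseteq> S \<union> S'" for u
    using S(2)[of u] S(4)[of u] Poly_Mapping.keys_add[of "F u" "G u"] by blast
  then have "\<exists>S. finite S \<and> (\<forall>u. keys (F u + G u) \<subseteq> S)"
    using S by (intro exI[of _ "S \<union> S'"]) auto
  then show ?thesis
    using assms unfolding coeff_cont_def lookup_add by (auto intro!: continuous_intros)
qed

lemma coeff_cont_scale:
  assumes "coeff_cont F" "isCont c 1"
  shows "coeff_cont (\<lambda>u. Const (c u) * F u)"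
proof -
  obtain S where S: "finite S" "\<And>u. keys (F u) \<subseteq> S"
    using assms(1) unfolding coeff_cont_def by blast
  then have "keys (Const (c u) * F u) \<subseteq> S" for u
    using keys_Const_mult by fast
  then have "\<exists>S. finite S \<and> (\<forall>u. keys (Const (c u) * F u) \<subseteq> S)"
    using S(1) by blast
  moreover have "isCont (\<lambda>u. c u * lookup (F u) m) 1" for m
    using assms unfolding coeff_cont_def by (intro continuous_intros) auto
  ultimately show ?thesis unfolding coeff_cont_def lookup_Const_mult by blast
qed

lemma coeff_cont_linear:
  assumes "coeff_cont F" "mlinear \<phi>"
  shows "coeff_cont (\<lambda>u. \<phi> (F u))"
proof -
  obtain S where S: "finite S" "\<And>u. keys (F u) \<subseteq> S"
    using assms(1) unfolding coeff_cont_def by blast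
  define S' where "S' = (\<Union>\<nu>\<in>S. keys (\<phi> (monomial \<nu>)))"
  have "finite S'" using S(1) by (auto simp: S'_def)
  moreover have "keys (\<phi> (F u)) \<subseteq> S'" for u
    by (rule keys_linear_image[OF assms(2)]) (use S(2)[of u] in \<open>auto simp: S'_def\<close>)
  moreover have "isCont (\<lambda>u. lookup (\<phi> (F u)) m) 1" for m
    unfolding lookup_linear_image[OF assms(2) S]
    using assms(1) unfolding coeff_cont_def by (intro continuous_intros) auto
  ultimately show ?thesis unfolding coeff_cont_def by blast
qed

lemma isCont_peval:
  assumes "coeff_cont F"
  shows "isCont (\<lambda>u. peval (F u) s) 1"
proof -
  obtain S where S: "finite S" "\<And>u. keys (F u) \<subseteq> S"
    using assms unfolding coeff_cont_def by blast
  have "peval (F u) s = (\<Sum>\<nu>\<in>S. lookup (F u) \<nu> * peval (monomial \<nu>) s)" for u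
    by (subst mpoly_eq_sum_monomials'[OF S(1) S(2)[of u]]) simp
  then show ?thesis
    using assms unfolding coeff_cont_def by (auto intro!: continuous_intros)
qed

text \<open>Reduces continuity in \<open>u\<close> to the two fixed linear operators
  \<open>T_op 1 i\<close> and \<open>T_op 0 i\<close>.\<close>

lemma T_op_affine: "T_op u i f = Const u * T_op 1 i f + Const (1 - u) * T_op 0 i f"
  by (simp add: T_op_def Const_diff algebra_simps)

lemma coeff_cont_T_op:
  assumes "coeff_cont F"
  shows "coeff_cont (\<lambda>u. T_op u i (F u))"
proof -
  have "(\<lambda>u. T_op u i (F u)) = (\<lambda>u. Const u * T_op 1 i (F u) + Const (1 - u) * T_op 0 i (F u))"
    by (rule ext, rule T_op_affine)
  moreover have "coeff_cont \<dots>"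
    by (intro coeff_cont_add coeff_cont_scale coeff_cont_linear[OF assms] mlinear_T_op continuous_intros)
  ultimately show ?thesis by simp
qed

lemma isCont_spec_val: "isCont (\<lambda>u. spec_val n q u \<eta> i) 1"
  unfolding spec_val_def by (intro continuous_intros) auto

lemma spec_val_1 [simp]: "spec_val n q 1 \<eta> i = q ^ \<eta> i"
  by (simp add: spec_val_def)

text \<open>Ensures that no intertwiner used for compositions of weight at most \<open>N\<close> has
  a vanishing denominator.\<close>

definition gap :: "nat \<Rightarrow> real \<Rightarrow> real \<Rightarrow> nat \<Rightarrow> bool" where
  "gap n q t N \<longleftrightarrow> (\<forall>\<eta>\<in>comps n. wt n \<eta> \<le> N \<longrightarrow>
     (\<forall>i. 1 \<le> i \<longrightarrow> Suc i \<le> n \<longrightarrow> lookup \<eta> i < lookup \<eta> (Suc i) \<longrightarrow>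
        spec_val n q t (lookup \<eta>) i \<noteq> spec_val n q t (lookup \<eta>) (Suc i)))"

lemma wt_rot_exp:
  assumes "1 \<le> n"
  shows "wt n (rot_exp n \<nu>) = Suc (wt n \<nu>)"
proof -
  obtain m where m: "n = Suc m" using assms by (cases n) auto
  have "(\<Sum>k=1..n. rot n (lookup \<nu>) k) = (\<Sum>k=1..m. lookup \<nu> (Suc k)) + Suc (lookup \<nu> 1)"
    unfolding m by (simp add: rot_def)
  also have "\<dots> = Suc (\<Sum>k=1..n. lookup \<nu> k)"
    unfolding m One_nat_def sum.atLeast1_atMost_eq sum.lessThan_Suc_shift by simp
  finally show ?thesis by (simp add: lookup_rot_exp[OF assms])
qed

lemma wt_swap_exp:
  assumes "1 \<le> i" "Suc i \<le> n"
  shows "wt n (swap_exp i \<nu>) = wt n \<nu>"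
  using sum.reindex_bij_betw[OF bij_betw_adj[OF assms], of "lookup \<nu>"] by simp

lemma rot_exp_surj:
  assumes \<eta>: "\<eta> \<in> comps n" and n: "1 \<le> n" and pos: "0 < lookup \<eta> n"
  shows "\<exists>\<nu>\<in>comps n. rot_exp n \<nu> = \<eta>"
proof -
  define g where "g = (\<lambda>k. if k = 1 then n else if 1 < k \<and> k \<le> n then k - 1 else k)"
  have cg: "g (cyc n k) = k" for k using n by (auto simp: cyc_def g_def)
  have gc: "cyc n (g k) = k" for k using n by (auto simp: cyc_def g_def)
  have inj: "inj g" by (rule inj_on_inverseI[of _ "cyc n"]) (rule gc)
  define \<nu> where "\<nu> = Poly_Mapping.map_key g (\<eta> - Poly_Mapping.single n 1)"
  have l: "lookup \<nu> k = (if g k = n then lookup \<eta> n - 1 else lookup \<eta> (g k))" for k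
    by (simp add: \<nu>_def lookup_map_key[OF inj] lookup_minus lookup_single when_def)
  have "\<nu> \<in> comps n" using \<eta> n by (auto simp: comps_iff l g_def)
  moreover have "rot_exp n \<nu> = \<eta>"
  proof (rule poly_mapping_eqI)
    fix k
    show "lookup (rot_exp n \<nu>) k = lookup \<eta> k"
      using pos n by (auto simp: lookup_rot_exp[OF n] rot_def l g_def)
  qed
  ultimately show ?thesis by blast
qed

text \<open>Without a descent the parts would increase weakly up to the last one, which is
  zero.\<close>

lemma comp_descent:
  assumes \<eta>: "\<eta> \<in> comps n" and z: "lookup \<eta> n = 0" "\<eta> \<noteq> 0"
  shows "\<exists>i. 1 \<le> i \<and> Suc i \<le> n \<and> lookup \<eta> (Suc i) < lookup \<eta> i"
proof (rule ccontr)
  assume *: "\<not> ?thesis"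
  have "lookup \<eta> k = 0" if k: "1 \<le> k" "k \<le> n" for k
  proof -
    have "lookup \<eta> k \<le> lookup \<eta> n"
      using k(2) k(1)
    proof (induction rule: inc_induct)
      case (step m)
      then have "lookup \<eta> m \<le> lookup \<eta> (Suc m)" using * by (metis Suc_leI le_trans not_less less_imp_le)
      then show ?case using step by simp
    qed simp
    then show ?thesis using z(1) by simp
  qed
  moreover have "lookup \<eta> k = 0" if "\<not> (1 \<le> k \<and> k \<le> n)" for k
    using \<eta> that by (auto simp: comps_iff)
  ultimately have "\<eta> = 0" by (intro poly_mapping_eqI) (metis lookup_zero)
  then show False using z(2) by simp
qed

lemma swap_weight_less:
  assumes i: "1 \<le> i" "Suc i \<le> n" and less: "lookup \<eta> (Suc i) < lookup \<eta> i"
  shows "(\<Sum>k=1..n. lookup (swap_exp i \<eta>) k * (n - k)) < (\<Sum>k=1..n. lookup \<eta> k * (n - k))"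
proof -
  have "\<exists>R. (\<Sum>k=1..n. lookup (swap_exp i \<eta>) k * (n - k)) =
      lookup (swap_exp i \<eta>) i * (n - i) + lookup (swap_exp i \<eta>) (Suc i) * (n - Suc i) + R \<and>
      (\<Sum>k=1..n. lookup \<eta> k * (n - k)) = lookup \<eta> i * (n - i) + lookup \<eta> (Suc i) * (n - Suc i) + R"
    by (rule sum_two_point) (use i in \<open>auto simp: Transposition.transpose_def\<close>)
  moreover obtain m where "n - i = Suc m" "n - Suc i = m" using i
    by (metis Suc_diff_le diff_Suc_Suc)
  ultimately show ?thesis using less by auto
qed

text \<open>A composition is traced back to 0: a positive last part comes from a rotation, and
  otherwise a descent comes from a swap at an ascent. These choices do not depend on
  \<open>t\<close>, so they define one family, continuous at 1.\<close>

lemma isE_family: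
  assumes n: "1 \<le> n" and q: "0 < q" "q < 1" and \<eta>: "\<eta> \<in> comps n" "wt n \<eta> \<le> N"
  shows "\<exists>F. coeff_cont F \<and> (\<forall>t. t \<noteq> 0 \<longrightarrow> gap n q t N \<longrightarrow> hecke.isE n q t \<eta> (F t))"
proof -
  have hecke: "hecke n q t" if "t \<noteq> 0" for t
    using that n q by unfold_locales auto
  \<comment> \<open>Undoing a rotation lowers the weight; undoing a swap keeps it and moves a larger
    part to the right, which lowers the second entry.\<close>
  have "wf (measures [wt n, \<lambda>\<eta>. \<Sum>k=1..n. lookup \<eta> k * (n - k)])" by simp
  then show ?thesis
    using \<eta>
  proof (induction \<eta> rule: wf_induct_rule)
    case (less \<eta>)
    consider "\<eta> = 0" | "0 < lookup \<eta> n" | "lookup \<eta> n = 0" "\<eta> \<noteq> 0" by blast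
    then show ?case
    proof cases
      case 1
      have "\<forall>t. t \<noteq> 0 \<longrightarrow> gap n q t N \<longrightarrow> hecke.isE n q t \<eta> 1"
        unfolding 1 using hecke hecke.isE_0 by blast
      then show ?thesis using coeff_cont_const[of 1] by (intro exI[of _ "\<lambda>_. 1"]) simp
    next
      case 2
      obtain \<nu> where \<nu>: "\<nu> \<in> comps n" "rot_exp n \<nu> = \<eta>"
        using rot_exp_surj[OF less.prems(1) n 2] by blast
      have w: "wt n \<eta> = Suc (wt n \<nu>)" using wt_rot_exp[OF n, of \<nu>] \<nu> by simp
      obtain F where F: "coeff_cont F" "\<And>t. t \<noteq> 0 \<Longrightarrow> gap n q t N \<Longrightarrow> hecke.isE n q t \<nu> (F t)"
        using less.IH[of \<nu>] less.prems \<nu> w by auto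
      define G where "G = (\<lambda>u. Const (inverse (q ^ lookup \<nu> 1)) * (Var n * omega_op n q (F u)))"
      have "coeff_cont G"
        unfolding G_def
        by (intro coeff_cont_scale coeff_cont_linear[OF F(1)] mlinear_comp[OF mlinear_mult]
            mlinear_alg_hom alg_hom_omega continuous_intros)
      moreover have "hecke.isE n q t \<eta> (G t)" if "t \<noteq> 0" "gap n q t N" for t
        using hecke.isE_rot[OF hecke[OF that(1)] \<nu>(1) F(2)[OF that]] by (simp add: \<nu>(2) G_def)
      ultimately show ?thesis by blast
    next
      case 3
      obtain i where i: "1 \<le> i" "Suc i \<le> n" "lookup \<eta> (Suc i) < lookup \<eta> i"
        using comp_descent[OF less.prems(1) 3] by blast
      define \<nu> where "\<nu> = swap_exp i \<eta>"
      have \<nu>: "\<nu> \<in> comps n" "wt n \<nu> = wt n \<eta>"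
        unfolding \<nu>_def by (rule swap_exp_comps[OF less.prems(1) i(1,2)], rule wt_swap_exp[OF i(1,2)])
      have sw: "swap_exp i \<nu> = \<eta>"
        by (rule poly_mapping_eqI) (simp add: \<nu>_def)
      have asc: "lookup \<nu> i < lookup \<nu> (Suc i)" using i(3) by (simp add: \<nu>_def)
      have "(\<nu>, \<eta>) \<in> measures [wt n, \<lambda>\<eta>. \<Sum>k=1..n. lookup \<eta> k * (n - k)]"
        using swap_weight_less[OF i] \<nu>(2) by (simp add: \<nu>_def)
      then obtain F where F: "coeff_cont F" "\<And>t. t \<noteq> 0 \<Longrightarrow> gap n q t N \<Longrightarrow> hecke.isE n q t \<nu> (F t)"
        using less.IH[of \<nu>] less.prems \<nu> by auto
      define a b where "a = (\<lambda>u. spec_val n q u (lookup \<nu>) i)" and "b = (\<lambda>u. spec_val n q u (lookup \<nu>) (Suc i))"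
      define G where "G = (\<lambda>u. Const (inverse u) * (T_op u i (F u) + Const (a u * (u - 1) / (b u - a u)) * F u))"
      \<comment> \<open>At \<open>t = 1\<close> the eigenvalues are powers of \<open>q\<close> with
        different exponents, so the constant of the intertwiner is continuous there.\<close>
      have "b 1 - a 1 \<noteq> 0"
        using q asc by (simp add: a_def b_def power_inject_exp')
      then have "coeff_cont G"
        unfolding G_def
        by (intro coeff_cont_scale coeff_cont_add coeff_cont_T_op F(1) continuous_intros)
           (auto simp: a_def b_def isCont_spec_val)
      moreover have "hecke.isE n q t \<eta> (G t)" if t: "t \<noteq> 0" "gap n q t N" for t
      proof -
        have "spec_val n q t (lookup \<nu>) i \<noteq> spec_val n q t (lookup \<nu>) (Suc i)"
          using t(2) \<nu> less.prems(2) i asc unfolding gap_def by simp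
        from hecke.isE_swap[OF hecke[OF t(1)] \<nu>(1) i(1,2) asc F(2)[OF t] this]
        show ?thesis by (simp only: sw G_def a_def b_def)
      qed
      ultimately show ?thesis by blast
    qed
  qed
qed

definition separated :: "nat \<Rightarrow> real \<Rightarrow> real \<Rightarrow> expvec \<Rightarrow> bool" where
  "separated n q t \<eta> \<longleftrightarrow> (\<forall>\<nu>\<in>lower_comps n \<eta>.
     \<exists>i\<in>{1..n}. spec_val n q t (lookup \<nu>) i \<noteq> spec_val n q t (lookup \<eta>) i)"

lemma lower_comps_differs:
  assumes "\<nu> \<in> lower_comps n \<eta>"
  shows "\<exists>i\<in>{1..n}. lookup \<nu> i \<noteq> lookup \<eta> i"
proof (rule ccontr)
  assume "\<not> ?thesis"
  then have eq: "\<And>i. i \<in> {1..n} \<Longrightarrow> lookup \<nu> i = lookup \<eta> i" by blast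
  then have "map (lookup \<nu>) [1..<Suc n] = map (lookup \<eta>) [1..<Suc n]"
    by (intro map_cong) auto
  then have "partition_of n (lookup \<nu>) = partition_of n (lookup \<eta>)"
    by (simp only: partition_of_def [abs_def])
  then have "\<not> comp_less n (lookup \<nu>) (lookup \<eta>)"
    using eq by (auto simp: comp_less_def dominance_less_def)
  then show False using assms by (simp add: lower_comps_def)
qed

lemma finite_comps: "finite {\<eta>\<in>comps n. wt n \<eta> \<le> N}"
proof -
  have "lookup ` {\<eta>\<in>comps n. wt n \<eta> \<le> N}
      \<subseteq> {f. \<forall>i. (i \<in> {1..n} \<longrightarrow> f i \<in> {..N}) \<and> (i \<notin> {1..n} \<longrightarrow> f i = 0)}"
  proof (intro image_subsetI CollectI allI conjI impI)
    fix \<nu> i assume \<nu>: "\<nu> \<in> {\<eta>\<in>comps n. wt n \<eta> \<le> N}"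
    show "lookup \<nu> i \<in> {..N}" if "i \<in> {1..n}"
    proof -
      have "lookup \<nu> i \<le> wt n \<nu>" using that by (intro member_le_sum) auto
      then show ?thesis using \<nu> by simp
    qed
    show "lookup \<nu> i = 0" if "i \<notin> {1..n}" using \<nu> that by (simp add: comps_iff)
  qed
  moreover have "finite {f. \<forall>i. (i \<in> {1..n} \<longrightarrow> f i \<in> {..N}) \<and> (i \<notin> {1..n} \<longrightarrow> f i = (0::nat))}"
    by (intro finite_set_of_finite_funs) auto
  ultimately have "finite (lookup ` {\<eta>\<in>comps n. wt n \<eta> \<le> N})" by (rule finite_subset)
  then show ?thesis by (rule finite_imageD) (simp add: inj_on_def)
qed

lemma spec_val_power:
  assumes "0 < q"
  shows "spec_val n q (q ^ lam) \<eta> i = q powr (real_of_int (int (\<eta> i) - int lam * int (leg' n \<eta> i)))"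
proof -
  have "(q ^ lam) powi (- int (leg' n \<eta> i)) = q powi (int lam * (- int (leg' n \<eta> i)))"
    unfolding power_int_mult by simp
  then have "spec_val n q (q ^ lam) \<eta> i = q powi (int (\<eta> i) + int lam * (- int (leg' n \<eta> i)))"
    unfolding spec_val_def using assms by (subst power_int_add) auto
  then show ?thesis by (subst powr_real_of_int') (use assms in simp_all)
qed

text \<open>At an ascent the larger part also has the shorter leg, so the two contributions to the
  exponent of the eigenvalue cannot cancel.\<close>

lemma gap_power:
  assumes q: "0 < q" "q < 1"
  shows "gap n q (q ^ lam) N"
  unfolding gap_def
proof (intro ballI allI impI)
  fix \<eta> :: expvec and i assume i: "1 \<le> i" "Suc i \<le> n" and less: "lookup \<eta> i < lookup \<eta> (Suc i)"
  have "leg' n (lookup \<eta>) (Suc i) < leg' n (lookup \<eta>) i"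
    using i less by (intro leg'_less_if_beats) (auto simp: beats_def)
  then have "int lam * int (leg' n (lookup \<eta>) (Suc i)) \<le> int lam * int (leg' n (lookup \<eta>) i)"
    by (intro mult_left_mono) auto
  then have "int (lookup \<eta> i) - int lam * int (leg' n (lookup \<eta>) i) \<noteq>
      int (lookup \<eta> (Suc i)) - int lam * int (leg' n (lookup \<eta>) (Suc i))"
    using less by linarith
  then show "spec_val n q (q ^ lam) (lookup \<eta>) i \<noteq> spec_val n q (q ^ lam) (lookup \<eta>) (Suc i)"
    unfolding spec_val_power[OF q(1)] using q by (simp only: powr_inj of_int_eq_iff) simp
qed

lemma separated_power:
  assumes q: "0 < q" "q < 1"
  shows "separated n q (q ^ lam) \<eta>"
  unfolding separated_def
proof
  fix \<nu> assume \<nu>: "\<nu> \<in> lower_comps n \<eta>"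
  show "\<exists>i\<in>{1..n}. spec_val n q (q ^ lam) (lookup \<nu>) i \<noteq> spec_val n q (q ^ lam) (lookup \<eta>) i"
  proof (rule ccontr)
    assume "\<not> ?thesis"
    then have eq: "int (lookup \<nu> i) - int lam * int (leg' n (lookup \<nu>) i) =
        int (lookup \<eta> i) - int lam * int (leg' n (lookup \<eta>) i)" if "i \<in> {1..n}" for i
      using that q unfolding spec_val_power[OF q(1)]
      by (metis powr_inj of_int_eq_iff less_irrefl)
    have "lookup \<nu> i = lookup \<eta> i" if i: "i \<in> {1..n}" for i
    proof (cases "lam = 0")
      case True
      then show ?thesis using eq[OF i] by simp
    next
      case False
      then show ?thesis using spectral_exponents_inj[of lam n "lookup \<nu>" "lookup \<eta>" i] eq i by simp
    qed
    then show False using lower_comps_differs[OF \<nu>] by blast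
  qed
qed

text \<open>Only finitely many compositions are involved, and each condition says that a function
  continuous at 1 and nonzero there stays nonzero.\<close>

lemma eventually_gap:
  assumes q: "0 < q" "q < 1"
  shows "\<forall>\<^sub>F u in at 1. gap n q u N"
proof -
  let ?v = "\<lambda>u \<eta> i. spec_val n q u (lookup \<eta>) i"
  have "\<forall>\<^sub>F u in at 1. \<forall>\<eta>\<in>{\<eta>\<in>comps n. wt n \<eta> \<le> N}. \<forall>i\<in>{1..n}. 
      lookup \<eta> i < lookup \<eta> (Suc i) \<longrightarrow> ?v u \<eta> i - ?v u \<eta> (Suc i) \<noteq> 0"
  proof (intro eventually_ball_finite ballI finite_comps finite_atLeastAtMost)
    fix \<eta> :: expvec and i
    show "\<forall>\<^sub>F u in at 1. lookup \<eta> i < lookup \<eta> (Suc i) \<longrightarrow> ?v u \<eta> i - ?v u \<eta> (Suc i) \<noteq> 0"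
    proof (cases "lookup \<eta> i < lookup \<eta> (Suc i)")
      case True
      have "((\<lambda>u. ?v u \<eta> i - ?v u \<eta> (Suc i)) \<longlongrightarrow> ?v 1 \<eta> i - ?v 1 \<eta> (Suc i)) (at 1)"
        using isCont_spec_val[of n q] by (intro tendsto_diff) (auto simp: isCont_def simp del: spec_val_1)
      moreover have "?v 1 \<eta> i - ?v 1 \<eta> (Suc i) \<noteq> 0"
        using True q by (simp add: power_inject_exp')
      ultimately have "\<forall>\<^sub>F u in at 1. ?v u \<eta> i - ?v u \<eta> (Suc i) \<noteq> 0"
        by (rule tendsto_imp_eventually_ne)
      then show ?thesis by (rule eventually_mono) simp
    qed simp
  qed
  then show ?thesis
    by (rule eventually_mono) (auto simp: gap_def)
qed

lemma eventually_separated: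
  assumes q: "0 < q" "q < 1"
  shows "\<forall>\<^sub>F u in at 1. separated n q u \<eta>"
  unfolding separated_def
proof (intro eventually_ball_finite finite_lower_comps ballI)
  let ?v = "\<lambda>u \<eta> i. spec_val n q u (lookup \<eta>) i"
  fix \<nu> assume "\<nu> \<in> lower_comps n \<eta>"
  then obtain i where i: "i \<in> {1..n}" "lookup \<nu> i \<noteq> lookup \<eta> i"
    using lower_comps_differs by blast
  have "((\<lambda>u. ?v u \<nu> i - ?v u \<eta> i) \<longlongrightarrow> ?v 1 \<nu> i - ?v 1 \<eta> i) (at 1)"
    using isCont_spec_val[of n q] by (intro tendsto_diff) (auto simp: isCont_def simp del: spec_val_1)
  moreover have "?v 1 \<nu> i - ?v 1 \<eta> i \<noteq> 0"
    using i q by (simp add: power_inject_exp')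
  ultimately have "\<forall>\<^sub>F u in at 1. ?v u \<nu> i - ?v u \<eta> i \<noteq> 0"
    by (rule tendsto_imp_eventually_ne)
  then show "\<forall>\<^sub>F u in at 1. \<exists>i\<in>{1..n}. ?v u \<nu> i \<noteq> ?v u \<eta> i"
    by (rule eventually_mono) (use i(1) in auto)
qed

lemma nonsym_macdonald_family:
  assumes n: "1 \<le> n" and q: "0 < q" "q < 1" and \<eta>: "\<eta> \<in> comps n"
  shows "\<exists>F. coeff_cont F \<and> (\<forall>t. t \<noteq> 0 \<longrightarrow> gap n q t (wt n \<eta>) \<longrightarrow> separated n q t \<eta> \<longrightarrow>
     hecke.isE n q t \<eta> (F t) \<and> nonsym_macdonald n q t \<eta> = F t)"
proof -
  obtain F where F: "coeff_cont F" "\<And>t. t \<noteq> 0 \<Longrightarrow> gap n q t (wt n \<eta>) \<Longrightarrow> hecke.isE n q t \<eta> (F t)"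
    using isE_family[OF n q \<eta>, of "wt n \<eta>"] by auto
  have "nonsym_macdonald n q t \<eta> = F t"
    if t: "t \<noteq> 0" "gap n q t (wt n \<eta>)" and sep: "separated n q t \<eta>" for t
  proof (rule hecke.nonsym_macdonald_eq)
    show "hecke n q t" using t n q by unfold_locales auto
    show "hecke.isE n q t \<eta> (F t)" by (rule F(2)[OF t])
    show "\<exists>E. hecke.isE n q t \<nu> E" if "\<nu> \<in> lower_comps n \<eta>" for \<nu>
    proof -
      have "\<nu> \<in> comps n" "wt n \<nu> \<le> wt n \<eta>"
        using that by (auto simp: lower_comps_def comps_def comp_less_def)
      then show ?thesis using isE_family[OF n q, of \<nu> "wt n \<eta>"] t by blast
    qed
    show "\<exists>i\<in>{1..n}. spec_val n q t (lookup \<nu>) i \<noteq> spec_val n q t (lookup \<eta>) i"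
      if "\<nu> \<in> lower_comps n \<eta>" for \<nu>
      using sep that by (simp add: separated_def)
  qed
  then show ?thesis using F by blast
qed

text \<open>For \<open>t = 1\<close> the polynomial \<open>F 1\<close> serves twice: it is an
  eigenvector, because the conditions on \<open>t\<close> hold at every \<open>q ^ lam\<close>, and
  its values are the limits that define \<open>macdonald_E\<close>.\<close>

theorem macdonald_E_eigenvector:
  assumes n: "1 \<le> n" and q: "0 < q" "q < 1" and \<eta>: "\<eta> \<in> comps n"
  shows "\<exists>E. hecke.isE n q (q ^ lam) \<eta> E \<and> (\<forall>s. macdonald_E n \<eta> s q (q ^ lam) = peval E s)"
proof -
  obtain F where F: "coeff_cont F" "\<And>t. t \<noteq> 0 \<Longrightarrow> gap n q t (wt n \<eta>) \<Longrightarrow> separated n q t \<eta> \<Longrightarrow>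
     hecke.isE n q t \<eta> (F t) \<and> nonsym_macdonald n q t \<eta> = F t"
    using nonsym_macdonald_family[OF n q \<eta>] by blast
  define t where "t = q ^ lam"
  have E: "hecke.isE n q t \<eta> (F t)" "nonsym_macdonald n q t \<eta> = F t"
    using F(2)[of t] gap_power[OF q] separated_power[OF q] q by (auto simp: t_def)
  have "macdonald_E n \<eta> s q t = peval (F t) s" for s
  proof (cases "t = 1")
    case True
    have "\<forall>\<^sub>F u in at (1::real). u \<noteq> 0"
      by (rule tendsto_imp_eventually_ne[OF tendsto_ident_at]) simp
    then have "\<forall>\<^sub>F u in at 1. peval (F u) s = peval (nonsym_macdonald n q u \<eta>) s"
      using eventually_gap[OF q, of n "wt n \<eta>"] eventually_separated[OF q, of n \<eta>]
      by eventually_elim (use F(2) in auto)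
    moreover have "((\<lambda>u. peval (F u) s) \<longlongrightarrow> peval (F 1) s) (at 1)"
      using isCont_peval[OF F(1), of s] by (simp add: isCont_def)
    ultimately have "((\<lambda>u. peval (nonsym_macdonald n q u \<eta>) s) \<longlongrightarrow> peval (F 1) s) (at 1)"
      by (rule Lim_transform_eventually[rotated])
    then have "Lim (at 1) (\<lambda>u. peval (nonsym_macdonald n q u \<eta>) s) = peval (F 1) s"
      by (intro tendsto_Lim) auto
    then show ?thesis using True by (simp add: macdonald_E_def)
  next
    case False
    then show ?thesis by (simp add: macdonald_E_def E(2))
  qed
  then show ?thesis using E(1) unfolding t_def by blast
qed

section \<open>Sums over the q-grid\<close>

lemma summable_on_geometric_PiE:
  fixes r :: real
  assumes "finite I" "0 \<le> r" "r < 1"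
  shows "(\<lambda>k. \<Prod>i\<in>I. r ^ k i) summable_on PiE I (\<lambda>_. UNIV :: nat set)"
proof -
  have "Infinite_Set_Sum.abs_summable_on (\<lambda>g. \<Prod>i\<in>I. r ^ g i) (PiE I (\<lambda>_. UNIV :: nat set))"
    by (rule abs_summable_on_prod_PiE[where f = "\<lambda>_ k. r ^ k"])
       (use assms in \<open>auto simp: abs_summable_on_nat_iff' intro!: summable_geometric\<close>)
  then have "(\<lambda>k. norm (\<Prod>i\<in>I. r ^ k i)) summable_on PiE I (\<lambda>_. UNIV :: nat set)"
    unfolding abs_summable_equivalent[symmetric] .
  then show ?thesis using assms by (simp add: abs_prod)
qed

text \<open>The iterated sums are merged into one unconditional sum, which can afterwards be
  reindexed by exchanges and rotations of the coordinates. Summability over the full grid justifies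
  each merging.\<close>

lemma qintegral_iter_eq_infsum:
  assumes "distinct js" and q: "q \<noteq> 0"
    and "(\<lambda>k. F (\<lambda>l. if l \<in> set js then q ^ k l else s l) * q ^ (\<Sum>i\<in>set js. k i))
      summable_on PiE (set js) (\<lambda>_. UNIV)"
  shows "qintegral_iter q js F s = (1 - q) ^ length js *
    (\<Sum>\<^sub>\<infinity>k\<in>PiE (set js) (\<lambda>_. UNIV). F (\<lambda>l. if l \<in> set js then q ^ k l else s l) * q ^ (\<Sum>i\<in>set js. k i))"
  using assms(1,3)
proof (induction js arbitrary: s)
  case Nil
  then show ?case by (simp add: PiE_empty_domain)
next
  case (Cons i js)
  define J where "J = set js"
  have i: "i \<notin> J" and fin: "finite J" using Cons.prems(1) by (auto simp: J_def)
  define K where "K = PiE J (\<lambda>_. UNIV :: nat set)"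
  define G where "G = (\<lambda>k. F (\<lambda>l. if l \<in> insert i J then q ^ k l else s l) * q ^ (\<Sum>i\<in>insert i J. k i))"
  define H where "H = (\<lambda>j k. F (\<lambda>l. if l \<in> J then q ^ k l else (s(i := q ^ j)) l) * q ^ (\<Sum>i\<in>J. k i))"
  have bij: "bij_betw (\<lambda>(j, k). k(i := j)) (UNIV \<times> K) (PiE (insert i J) (\<lambda>_. UNIV))"
    unfolding bij_betw_def PiE_insert_eq K_def using i by (auto intro!: inj_combinator)
  have GH: "G (k(i := j)) = H j k * q ^ j" if "k \<in> K" for j k
  proof -
    have "(\<lambda>l. if l \<in> insert i J then q ^ (k(i := j)) l else s l) = (\<lambda>l. if l \<in> J then q ^ k l else (s(i := q ^ j)) l)"
      using i by (auto simp: fun_eq_iff)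
    moreover have "(\<Sum>l\<in>insert i J. (k(i := j)) l) = j + (\<Sum>l\<in>J. k l)"
      using i fin by (auto intro!: sum.cong)
    ultimately show ?thesis unfolding G_def H_def by (simp only: power_add mult_ac)
  qed
  have "(\<lambda>p. G (case p of (j, k) \<Rightarrow> k(i := j))) summable_on UNIV \<times> K"
    using Cons.prems(2) summable_on_reindex_bij_betw[OF bij, of G] by (simp add: G_def J_def)
  also have "?this \<longleftrightarrow> (\<lambda>(j, k). H j k * q ^ j) summable_on UNIV \<times> K"
    by (rule summable_on_cong) (auto simp: GH)
  finally have summ: "(\<lambda>(j, k). H j k * q ^ j) summable_on UNIV \<times> K" .
  have inner: "qintegral_iter q js F (s(i := q ^ j)) * q ^ j =
      (1 - q) ^ length js * (\<Sum>\<^sub>\<infinity>k\<in>K. H j k * q ^ j)" for j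
  proof -
    have nz: "q ^ j \<noteq> 0" using q by simp
    have "(\<lambda>k. H j k * q ^ j) summable_on K"
      using summable_on_SigmaD1[OF summ, of j] by simp
    then have "H j summable_on K"
      using summable_on_cmult_left'[OF nz] by blast
    then have "qintegral_iter q js F (s(i := q ^ j)) = (1 - q) ^ length js * infsum (H j) (K)"
      unfolding H_def J_def K_def using Cons.prems(1) by (intro Cons.IH) simp_all
    then show ?thesis by (simp add: infsum_cmult_left' mult_ac)
  qed
  have "(\<lambda>j. \<Sum>\<^sub>\<infinity>k\<in>K. H j k * q ^ j) summable_on UNIV"
    using summable_on_Sigma_banach[OF summ] .
  then have "(\<lambda>j. \<Sum>\<^sub>\<infinity>k\<in>K. H j k * q ^ j) sums
      (\<Sum>\<^sub>\<infinity>j. \<Sum>\<^sub>\<infinity>k\<in>K. H j k * q ^ j)"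
    by (intro has_sum_imp_sums has_sum_infsum)
  then have "(\<lambda>j. qintegral_iter q js F (s(i := q ^ j)) * q ^ j) sums
      ((1 - q) ^ length js * (\<Sum>\<^sub>\<infinity>j. \<Sum>\<^sub>\<infinity>k\<in>K. H j k * q ^ j))"
    unfolding inner by (rule sums_mult)
  then have "qintegral_iter q (i # js) F s = (1 - q) ^ Suc (length js) *
      (\<Sum>\<^sub>\<infinity>j. \<Sum>\<^sub>\<infinity>k\<in>K. H j k * q ^ j)"
    by (simp add: qintegral_def sums_iff)
  also have "(\<Sum>\<^sub>\<infinity>j. \<Sum>\<^sub>\<infinity>k\<in>K. H j k * q ^ j) =
      (\<Sum>\<^sub>\<infinity>(j, k)\<in>UNIV \<times> K. H j k * q ^ j)"
    by (rule infsum_Sigma'_banach[OF summ])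
  also have "\<dots> = (\<Sum>\<^sub>\<infinity>p\<in>UNIV \<times> K. G (case p of (j, k) \<Rightarrow> k(i := j)))"
    by (rule infsum_cong) (auto simp: GH)
  also have "\<dots> = infsum G (PiE (insert i J) (\<lambda>_. UNIV))"
    by (rule infsum_reindex_bij_betw[OF bij])
  finally show ?case by (simp add: G_def J_def)
qed

section \<open>Infinite q-Pochhammer symbols\<close>

context
  fixes q :: real
  assumes q: "0 < q" "q < 1"
begin

lemma convergent_prod_qpoch: "convergent_prod (\<lambda>i. 1 - z * q ^ i)"
proof (rule abs_convergent_prod_imp_convergent_prod, rule summable_imp_abs_convergent_prod)
  have "summable (\<lambda>i. norm z * q ^ i)"
    using q by (intro summable_mult summable_geometric) auto
  then show "summable (\<lambda>i. norm (1 - z * q ^ i - 1))"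
    using q by (simp add: abs_mult)
qed

lemma qpoch_inf_factor_pos: "z < 1 \<Longrightarrow> 0 \<le> z \<Longrightarrow> 0 < 1 - z * q ^ i"
  using mult_mono[of z z "q ^ i" 1] q by (simp add: power_le_one)

lemma qpoch_inf_pos: "z < 1 \<Longrightarrow> 0 \<le> z \<Longrightarrow> 0 < qpoch_inf z q"
  unfolding qpoch_inf_def by (intro less_0_prodinf convergent_prod_qpoch qpoch_inf_factor_pos)

lemma qpoch_inf_split:
  assumes "z < 1" "0 \<le> z"
  shows "qpoch_inf z q = qpoch z q m * qpoch_inf (z * q ^ m) q"
proof -
  have "qpoch_inf z q = prodinf (\<lambda>i. 1 - z * q ^ (i + m)) * (\<Prod>i<m. 1 - z * q ^ i)"
    unfolding qpoch_inf_def
    by (rule prodinf_split_initial_segment[OF convergent_prod_qpoch])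
       (use qpoch_inf_factor_pos[OF assms] in \<open>metis less_irrefl\<close>)
  then show ?thesis by (simp add: qpoch_inf_def qpoch_def power_add mult_ac)
qed

lemma qpoch_tendsto: "(\<lambda>m. qpoch z q m) \<longlonglongrightarrow> qpoch_inf z q"
proof -
  have "(\<lambda>m. \<Prod>i\<le>m. 1 - z * q ^ i) \<longlonglongrightarrow> qpoch_inf z q"
    unfolding qpoch_inf_def by (rule convergent_prod_LIMSEQ[OF convergent_prod_qpoch])
  then have "(\<lambda>m. qpoch z q (Suc m)) \<longlonglongrightarrow> qpoch_inf z q"
    by (simp add: qpoch_def lessThan_Suc_atMost)
  then show ?thesis by (rule LIMSEQ_imp_Suc)
qed

lemma qpoch_le_1:
  assumes "z < 1" "0 \<le> z"
  shows "qpoch z q m \<le> 1" and "0 < qpoch z q m"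
proof -
  show "qpoch z q m \<le> 1"
    unfolding qpoch_def using qpoch_inf_factor_pos[OF assms] assms q
    by (intro prod_le_1) (auto intro: less_imp_le)
  show "0 < qpoch z q m"
    unfolding qpoch_def using qpoch_inf_factor_pos[OF assms] by (intro prod_pos) auto
qed

lemma qpoch_inf_le_1: "z < 1 \<Longrightarrow> 0 \<le> z \<Longrightarrow> qpoch_inf z q \<le> 1"
  by (rule LIMSEQ_le_const2[OF qpoch_tendsto]) (auto intro: qpoch_le_1)

lemma qpoch_inf_mono:
  assumes "z < 1" "0 \<le> z"
  shows "qpoch_inf z q \<le> qpoch_inf (z * q ^ m) q"
proof -
  have "z * q ^ m \<le> z * 1" using assms q by (intro mult_left_mono power_le_one) auto
  then have "0 < qpoch_inf (z * q ^ m) q" using assms q by (intro qpoch_inf_pos) auto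
  then have "qpoch z q m * qpoch_inf (z * q ^ m) q \<le> 1 * qpoch_inf (z * q ^ m) q"
    using qpoch_le_1[OF assms, of m] by (intro mult_right_mono) auto
  then show ?thesis using qpoch_inf_split[OF assms, of m] by simp
qed

end

text \<open>One factor of the double product in the integrand with its denominators cleared: a
  homogeneous polynomial, meaningful also when a coordinate is 0.\<close>

definition pair_factor :: "real \<Rightarrow> nat \<Rightarrow> real \<Rightarrow> real \<Rightarrow> real" where
  "pair_factor q lam a b = (\<Prod>m<2 * lam. a - q powi (1 - int lam + int m) * b)"

text \<open>Reversing the product matches the factors up to the scalars
  \<open>- (q powi (int lam - int m))\<close>. Their number is even and their exponents add up to
  \<open>lam\<close>.\<close>

lemma pair_factor_q_shift:
  assumes "q > 0"
  shows "pair_factor q lam (q * b) a = q ^ lam * pair_factor q lam a b"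
proof -
  have "pair_factor q lam (q * b) a = (\<Prod>m<2 * lam. q * b - q powi (1 - int lam + int (2 * lam - Suc m)) * a)"
    unfolding pair_factor_def by (rule prod.nat_diff_reindex[symmetric])
  also have "\<dots> = (\<Prod>m<2 * lam. (- (q powi (int lam - int m))) * (a - q powi (1 - int lam + int m) * b))"
  proof (rule prod.cong[OF refl])
    fix m assume m: "m \<in> {..<2 * lam}"
    have e: "1 - int lam + int (2 * lam - Suc m) = int lam - int m" using m by auto
    have "q powi (int lam - int m) * q powi (1 - int lam + int m) = q powi 1"
      using assms by (simp add: power_int_add[symmetric])
    then show "q * b - q powi (1 - int lam + int (2 * lam - Suc m)) * a =
        (- (q powi (int lam - int m))) * (a - q powi (1 - int lam + int m) * b)"
      unfolding e by (simp add: algebra_simps)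
  qed
  also have "\<dots> = (\<Prod>m<2 * lam. - (q powi (int lam - int m))) * pair_factor q lam a b"
    by (simp only: prod.distrib pair_factor_def)
  also have "(\<Prod>m<2 * lam. - (q powi (int lam - int m))) = q ^ lam"
  proof -
    have pa: "q powi (a + b) = q powi a * q powi b" for a b
      using assms by (simp add: power_int_add)
    \<comment> \<open>Generalised to \<open>2 * k\<close> factors, for an induction that takes two
      factors at a time so that the signs cancel.\<close>
    have "(\<Prod>m<2 * k. - (q powi (int lam - int m))) = q powi (2 * int k * int lam - int k * (2 * int k - 1))" for k
    proof (induction k)
      case (Suc k)
      have "{..<2 * Suc k} = insert (2 * k + 1) (insert (2 * k) {..<2 * k})" by auto
      then have "(\<Prod>m<2 * Suc k. - (q powi (int lam - int m))) =
        q powi (int lam - int (2 * k + 1)) * q powi (int lam - int (2 * k)) * (\<Prod>m<2 * k. - (q powi (int lam - int m)))"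
        by simp
      also have "\<dots> = q powi ((int lam - int (2 * k + 1)) + (int lam - int (2 * k)) + (2 * int k * int lam - int k * (2 * int k - 1)))"
        by (simp only: Suc pa)
      also have "(int lam - int (2 * k + 1)) + (int lam - int (2 * k)) + (2 * int k * int lam - int k * (2 * int k - 1))
         = 2 * int (Suc k) * int lam - int (Suc k) * (2 * int (Suc k) - 1)"
        by (simp add: algebra_simps)
      finally show ?case .
    qed simp
    from this[of lam] show ?thesis by (simp add: algebra_simps)
  qed
  finally show ?thesis .
qed

text \<open>By the \<open>q\<close>-shift the exchanged product is, up to \<open>q ^ lam\<close>,
  that of \<open>f 0\<close> to \<open>f (2 * lam - 1)\<close>, while the original one is that of
  \<open>f 1\<close> to \<open>f (2 * lam)\<close>. Only the two end factors differ, and they give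
  the linear forms that occur in \<open>T\<close>.\<close>

lemma pair_factor_swap:
  assumes "q > 0"
  shows "pair_factor q lam b a * (a - q ^ lam * b) = (q ^ lam * a - b) * pair_factor q lam a b"
proof (cases lam)
  case 0
  then show ?thesis by (simp add: pair_factor_def)
next
  case (Suc l)
  define f where "f = (\<lambda>m. a - q powi (int m - int lam) * b)"
  have "pair_factor q lam b a = q ^ lam * pair_factor q lam a (b / q)"
    using pair_factor_q_shift[OF assms, of lam "b / q" a] assms by simp
  also have "pair_factor q lam a (b / q) = (\<Prod>m<2 * lam. f m)"
    unfolding pair_factor_def f_def
  proof (rule prod.cong[OF refl])
    fix m
    have "q powi (1 - int lam + int m) = q powi (int m - int lam) * q"
    proof -
      have "1 - int lam + int m = (int m - int lam) + 1" by simp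
      then show ?thesis using assms by (simp only:) (subst power_int_add, auto)
    qed
    then show "a - q powi (1 - int lam + int m) * (b / q) = a - q powi (int m - int lam) * b"
      using assms by simp
  qed
  finally have 1: "pair_factor q lam b a = q ^ lam * (\<Prod>m<2 * lam. f m)" .
  have 2: "pair_factor q lam a b = (\<Prod>m<2 * lam. f (Suc m))"
    unfolding pair_factor_def f_def by (intro prod.cong) (auto simp: algebra_simps)
  have "f 0 * (\<Prod>m<2 * lam. f (Suc m)) = (\<Prod>m<2 * lam. f m) * f (2 * lam)"
    by (metis prod.lessThan_Suc prod.lessThan_Suc_shift)
  moreover have "f (2 * lam) = a - q ^ lam * b" by (simp add: f_def power_int_def)
  moreover have "q ^ lam * f 0 = q ^ lam * a - b"
    using assms by (simp add: f_def power_int_minus algebra_simps)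
  ultimately show ?thesis unfolding 1 2 by (metis mult.assoc)
qed

text \<open>The factor with \<open>m = a - b + lam - 1\<close> vanishes whenever this number lies
  between 0 and \<open>2 * lam - 1\<close>. The window is not symmetric in \<open>a\<close> and
  \<open>b\<close>, which later singles out increasing exponents as the minimal ones.\<close>

lemma pair_factor_eq_0:
  assumes q: "q > 0" and "int b - int a \<le> int lam - 1" "int a - int b \<le> int lam"
  shows "pair_factor q lam (q ^ a) (q ^ b) = 0"
proof -
  define m where "m = nat (int a - int b + int lam - 1)"
  have m: "m < 2 * lam" "int m = int a - int b + int lam - 1"
    using assms(2,3) by (auto simp: m_def)
  have "q powi (1 - int lam + int m) * q ^ b = q powi (1 - int lam + int m) * q powi (int b)" by simp
  also have "\<dots> = q powi (int a)"
    using q m(2) by (simp add: power_int_add[symmetric] del: power_int_of_nat)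
  finally have "q ^ a - q powi (1 - int lam + int m) * q ^ b = 0" by simp
  then show ?thesis unfolding pair_factor_def using m(1) by (intro prod_zero) auto
qed

definition pairs :: "nat \<Rightarrow> (nat \<times> nat) set" where
  "pairs n = {(i, j). 1 \<le> i \<and> i < j \<and> j \<le> n}"

lemma finite_pairs [simp]: "finite (pairs n)"
  by (rule finite_subset[of _ "{1..n} \<times> {1..n}"]) (auto simp: pairs_def)

definition vand :: "real \<Rightarrow> nat \<Rightarrow> nat \<Rightarrow> (nat \<Rightarrow> real) \<Rightarrow> real" where
  "vand q lam n s = (\<Prod>(i, j)\<in>pairs n. pair_factor q lam (s i) (s j))"

lemma prod_pairs:
  "(\<Prod>(i, j)\<in>pairs n. f i j) = (\<Prod>i=1..n. \<Prod>j=i+1..n. f i j)"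
proof -
  have "pairs n = Sigma {1..n} (\<lambda>i. {i+1..n})" by (auto simp: pairs_def)
  then show ?thesis using prod.Sigma[of "{1..n}" "\<lambda>i. {i+1..n}" f] by simp
qed

text \<open>All pairs other than \<open>(i, Suc i)\<close> are merely permuted, so the quotient is
  that of \<open>pair_factor_swap\<close>.\<close>

lemma vand_swap:
  assumes i: "1 \<le> i" "Suc i \<le> n" and q: "q > 0"
  shows "vand q lam n (s \<circ> adj i) * (s i - q ^ lam * s (Suc i)) = (q ^ lam * s i - s (Suc i)) * vand q lam n s"
proof -
  define P where "P = pairs n - {(i, Suc i)}"
  have rm: "vand q lam n r = pair_factor q lam (r i) (r (Suc i)) * (\<Prod>(a, b)\<in>P. pair_factor q lam (r a) (r b))" for r
    unfolding vand_def P_def using i by (subst prod.remove[OF finite_pairs, of "(i, Suc i)"]) (auto simp: pairs_def)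
  have maps: "map_prod (adj i) (adj i) p \<in> P" if "p \<in> P" for p
  proof -
    obtain a b where p: "p = (a, b)" by (cases p)
    then have ab: "1 \<le> a" "a < b" "b \<le> n" "\<not> (a = i \<and> b = Suc i)" using that by (auto simp: P_def pairs_def)
    have "adj i a < adj i b" "1 \<le> adj i a" "adj i b \<le> n"
      using ab i by (cases "a = i"; cases "a = Suc i"; cases "b = i"; cases "b = Suc i"; auto)+
    moreover have "\<not> (adj i a = i \<and> adj i b = Suc i)"
      using ab(2) by (auto simp: transpose_eq_iff)
    ultimately show ?thesis by (auto simp: p P_def pairs_def)
  qed
  have "bij_betw (map_prod (adj i) (adj i)) P P"
    by (rule bij_betw_byWitness[of _ "map_prod (adj i) (adj i)"]) (use maps in \<open>auto simp: prod.map_comp\<close>)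
  from prod.reindex_bij_betw[OF this, of "\<lambda>(a, b). pair_factor q lam (s a) (s b)"]
  have "(\<Prod>(a, b)\<in>P. pair_factor q lam ((s \<circ> adj i) a) ((s \<circ> adj i) b)) = (\<Prod>(a, b)\<in>P. pair_factor q lam (s a) (s b))"
    by (simp add: case_prod_beta)
  then show ?thesis
    unfolding rm using pair_factor_swap[OF q, of lam "s (Suc i)" "s i"] by (simp add: mult_ac)
qed

definition rot_point :: "nat \<Rightarrow> real \<Rightarrow> (nat \<Rightarrow> real) \<Rightarrow> nat \<Rightarrow> real" where
  "rot_point n q s j = (if j = 1 then q * s n else if 1 < j \<and> j \<le> n then s (j - 1) else s j)"

text \<open>The \<open>n - 1\<close> pairs with the wrapped coordinate become the pairs ending in
  \<open>n\<close> and contribute \<open>q ^ lam\<close> each by \<open>pair_factor_q_shift\<close>;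
  the other pairs are only shifted.\<close>

lemma vand_rot:
  assumes n: "1 \<le> n" and q: "q > 0"
  shows "vand q lam n (rot_point n q s) = (q ^ lam) ^ (n - 1) * vand q lam n s"
proof -
  define c where "c = (\<lambda>(a, b). if a = 1 then (b - 1, n) else (a - 1, b - 1))"
  define c' where "c' = (\<lambda>(a, b). if b = n then (1, Suc a) else (Suc a, Suc b))"
  have "bij_betw c (pairs n) (pairs n)"
    by (rule bij_betw_byWitness[of _ c'])
       (auto simp: c_def c'_def pairs_def split: if_splits)
  from prod.reindex_bij_betw[OF this, of "\<lambda>(a, b). pair_factor q lam (s a) (s b)"]
  have re: "(\<Prod>p\<in>pairs n. case c p of (a, b) \<Rightarrow> pair_factor q lam (s a) (s b)) = vand q lam n s"
    by (simp add: vand_def)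
  have "vand q lam n (rot_point n q s) =
      (\<Prod>p\<in>pairs n. (if fst p = 1 then q ^ lam else 1) * (case c p of (a, b) \<Rightarrow> pair_factor q lam (s a) (s b)))"
    unfolding vand_def
    by (rule prod.cong) (auto simp: pairs_def rot_point_def c_def pair_factor_q_shift[OF q])
  also have "\<dots> = (\<Prod>p\<in>pairs n. if fst p = 1 then q ^ lam else 1) * vand q lam n s"
    by (simp only: prod.distrib re)
  also have "(\<Prod>p\<in>pairs n. if fst p = 1 then q ^ lam else 1) = (q ^ lam) ^ card {p \<in> pairs n. fst p = 1}"
    by (simp add: prod.If_cases Int_def)
  also have "{p \<in> pairs n. fst p = 1} = Pair 1 ` {2..n}"
    by (auto simp: pairs_def)
  also have "card (Pair 1 ` {2..n}) = n - 1"
    by (subst card_image) (auto simp: inj_on_def)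
  finally show ?thesis .
qed

section \<open>Exponents with prescribed gaps and minimal sum\<close>

lemma distinct_nat_sum:
  fixes A :: "nat set"
  assumes "finite A"
  shows "(\<Sum>i<card A. i) \<le> \<Sum>A" and "\<Sum>A = (\<Sum>i<card A. i) \<Longrightarrow> A \<subseteq> {..<card A}"
proof -
  have "(\<Sum>i<card A. i) \<le> \<Sum>A \<and> (\<Sum>A = (\<Sum>i<card A. i) \<longrightarrow> A \<subseteq> {..<card A})"
    using assms
  proof (induction A rule: finite_linorder_max_induct)
    case (insert b A)
    have bA: "b \<notin> A" using insert.hyps by auto
    have "card A \<le> b"
      using card_mono[of "{..<b}" A] insert.hyps by auto
    then show ?case using insert bA by (auto simp: subset_iff)
  qed simp
  then show "(\<Sum>i<card A. i) \<le> \<Sum>A" and "\<Sum>A = (\<Sum>i<card A. i) \<Longrightarrow> A \<subseteq> {..<card A}" by auto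
qed

text \<open>With \<open>v i = n * k i + i - 1\<close> the two cases of the hypothesis both say that the \<open>v i\<close> are at
  least \<open>n * \<lambda> + 1\<close> apart, so that the quotients \<open>v i div (n * \<lambda> + 1)\<close> are distinct.\<close>

lemma gap_exponents:
  fixes k :: "nat \<Rightarrow> nat"
  assumes gaps: "\<And>i j. 1 \<le> i \<Longrightarrow> i < j \<Longrightarrow> j \<le> n \<Longrightarrow> k i + lam \<le> k j \<or> k j + lam + 1 \<le> k i"
  shows "lam * (n choose 2) \<le> (\<Sum>i=1..n. k i)"
    and "(\<Sum>i=1..n. k i) = lam * (n choose 2) \<Longrightarrow> i \<in> {1..n} \<Longrightarrow> k i = lam * (i - 1)"
proof -
  define g where "g = n * lam + 1"
  define v where "v = (\<lambda>i. n * k i + i - 1)"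
  define b where "b = (\<lambda>i. v i div g)"
  have sep: "v i + g \<le> v j \<or> v j + g \<le> v i" if "1 \<le> i" "i < j" "j \<le> n" for i j
  proof (cases "k i + lam \<le> k j")
    case True
    then have "n * (k i + lam) \<le> n * k j" by (rule mult_le_mono2)
    then show ?thesis using that by (auto simp: v_def g_def algebra_simps)
  next
    case False
    then have "k j + lam + 1 \<le> k i" using gaps[OF that] by auto
    then have "n * (k j + lam + 1) \<le> n * k i" by (rule mult_le_mono2)
    then show ?thesis using that by (auto simp: v_def g_def algebra_simps)
  qed
  have g: "0 < g" by (simp add: g_def)
  have neq: "b i \<noteq> b j" if "v i + g \<le> v j" for i j
  proof -
    have "(v i + g) div g \<le> v j div g" by (rule div_le_mono[OF that])
    then show ?thesis using g by (simp add: b_def)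
  qed
  have inj: "inj_on b {1..n}"
  proof (rule inj_onI)
    fix i j assume ij: "i \<in> {1..n}" "j \<in> {1..n}" "b i = b j"
    show "i = j"
    proof (rule ccontr)
      assume "i \<noteq> j"
      then have "i < j \<or> j < i" by auto
      then show False using sep[of i j] sep[of j i] neq[of i j] neq[of j i] ij by auto
    qed
  qed
  have card: "card (b ` {1..n}) = n" using card_image[OF inj] by simp
  have sb: "\<Sum>(b ` {1..n}) = (\<Sum>i=1..n. b i)" using sum.reindex[OF inj, of "\<lambda>x. x"] by simp
  have tri: "(\<Sum>i<n. i) = n choose 2"
    by (simp add: lessThan_atLeast0 choose_two Sum_Ico_nat)
  have lower: "n choose 2 \<le> (\<Sum>i=1..n. b i)"
    using distinct_nat_sum(1)[of "b ` {1..n}"] unfolding card sb tri by simp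
  have bv: "g * b i \<le> v i" for i by (simp add: b_def)
  have "(\<Sum>i=1..n. i - 1) = n choose 2"
    unfolding One_nat_def sum.atLeast1_atMost_eq by (simp add: tri)
  moreover have "(\<Sum>i=1..n. v i) = n * (\<Sum>i=1..n. k i) + (\<Sum>i=1..n. i - 1)"
    unfolding sum_distrib_left sum.distrib[symmetric] by (rule sum.cong) (auto simp: v_def)
  ultimately have sv: "(\<Sum>i=1..n. v i) = n * (\<Sum>i=1..n. k i) + (n choose 2)" by simp
  have gb: "g * (\<Sum>i=1..n. b i) \<le> (\<Sum>i=1..n. v i)"
    unfolding sum_distrib_left by (rule sum_mono) (rule bv)
  have "g * (n choose 2) \<le> g * (\<Sum>i=1..n. b i)" using lower by simp
  \<comment> \<open>The summand \<open>n choose 2\<close> occurs on both sides, once from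
    \<open>g\<close> and once from the offsets \<open>i - 1\<close> in \<open>v\<close>, and
    cancels.\<close>
  then have main: "n * (lam * (n choose 2)) \<le> n * (\<Sum>i=1..n. k i)"
  proof -
    have "g * (n choose 2) = n * (lam * (n choose 2)) + (n choose 2)"
      by (simp add: g_def algebra_simps)
    then show ?thesis using gb sv \<open>g * (n choose 2) \<le> _\<close> by linarith
  qed
  show "lam * (n choose 2) \<le> (\<Sum>i=1..n. k i)"
    using main by (cases "n = 0") auto
  assume eq: "(\<Sum>i=1..n. k i) = lam * (n choose 2)" and i: "i \<in> {1..n}"
  have tot: "(\<Sum>i=1..n. v i) = g * (n choose 2)" unfolding sv eq by (simp add: g_def algebra_simps)
  have b_eq: "(\<Sum>i=1..n. b i) = n choose 2"
    using gb lower tot g by (intro antisym) auto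
  have "b ` {1..n} \<subseteq> {..<n}"
    using distinct_nat_sum(2)[of "b ` {1..n}"] b_eq unfolding card sb tri by simp
  then have "b i \<in> {..<n}" using i by blast
  then have bn: "b i < n" by simp
  have "v i = g * b i"
  proof (rule ccontr)
    assume "v i \<noteq> g * b i"
    then have "g * b i < v i" using bv[of i] by simp
    then have "(\<Sum>i=1..n. g * b i) < (\<Sum>i=1..n. v i)"
      using i bv by (intro sum_strict_mono_ex1) auto
    then show False unfolding sum_distrib_left[symmetric] b_eq tot by simp
  qed
  then have vi: "n * k i + (i - 1) = n * (lam * b i) + b i"
    using i by (auto simp: v_def g_def algebra_simps)
  \<comment> \<open>In the extremal case the offset \<open>i - 1\<close> is recovered as a residue
    modulo \<open>n\<close>, which identifies \<open>b i\<close>.\<close>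
  have "(n * k i + (i - 1)) mod n = i - 1"
    unfolding mod_mult_self4 by (rule mod_less) (use i in auto)
  moreover have "(n * (lam * b i) + b i) mod n = b i" using bn by simp
  ultimately have "b i = i - 1" unfolding vi by linarith
  then show "k i = lam * (i - 1)" using vi i by simp
qed

section \<open>The q-integral functional\<close>

lemma swap_div_diff: "swap_op i (div_diff i f) = div_diff i f"
proof -
  have "swap_op i (swap_factor i * div_diff i f) = f - swap_op i f"
    unfolding div_diff_eq by (simp add: alg_hom_simps[OF alg_hom_swap])
  then have "(Var (Suc i) - Var i) * swap_op i (div_diff i f) = f - swap_op i f"
    by (simp add: alg_hom_simps[OF alg_hom_swap] swap_Var)
  then have "swap_factor i * swap_op i (div_diff i f) = swap_factor i * div_diff i f"
    unfolding div_diff_eq by (metis minus_diff_eq mult_minus_left)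
  then show ?thesis using swap_factor_neq_0[of i] mult_left_cancel by blast
qed

lemma peval_swap_op: "peval (swap_op i f) s = peval f (s \<circ> adj i)"
  by (simp add: peval_alg_hom[OF alg_hom_swap, of i f s] swap_Var comp_def)

lemma peval_omega:
  assumes "1 \<le> n"
  shows "peval (omega_op n q f) s = peval f (rot_point n q s)"
proof -
  have "(\<lambda>i. peval (omega_op n q (Var i)) s) = rot_point n q s"
    using assms by (auto simp: omega_Var rot_point_def fun_eq_iff)
  then show ?thesis by (simp add: peval_alg_hom[OF alg_hom_omega, of n q f s])
qed

lemma peval_bounded:
  assumes "\<And>i. \<bar>s i\<bar> \<le> 1"
  shows "\<bar>peval f s\<bar> \<le> (\<Sum>m\<in>keys f. \<bar>lookup f m\<bar>)"
proof -
  have "\<bar>peval f s\<bar> = \<bar>\<Sum>m\<in>keys f. lookup f m * (\<Prod>i\<in>keys m. s i ^ lookup m i)\<bar>"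
    by (simp add: peval_def insertion_def)
  also have "\<dots> \<le> (\<Sum>m\<in>keys f. \<bar>lookup f m * (\<Prod>i\<in>keys m. s i ^ lookup m i)\<bar>)"
    by (rule sum_abs)
  also have "\<dots> \<le> (\<Sum>m\<in>keys f. \<bar>lookup f m\<bar> * 1)"
  proof (rule sum_mono)
    fix m
    have "(\<Prod>i\<in>keys m. \<bar>s i\<bar> ^ lookup m i) \<le> 1"
      using assms by (intro prod_le_1) (auto intro: power_le_one)
    then show "\<bar>lookup f m * (\<Prod>i\<in>keys m. s i ^ lookup m i)\<bar> \<le> \<bar>lookup f m\<bar> * 1"
      unfolding abs_mult abs_prod power_abs by (rule mult_left_mono) simp
  qed
  finally show ?thesis by simp
qed

text \<open>\<open>B\<close> will be \<open>q powr y\<close>. The power \<open>q powr x\<close> is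
  not fixed, because the recursion relates the functional at \<open>X\<close> and at
  \<open>X * q\<close>.\<close>

locale qint =
  fixes n lam :: nat and q t B :: real
  assumes n1: "1 \<le> n" and q: "0 < q" "q < 1" and t: "t = q ^ lam" and B: "0 < B" "B < 1"
begin

sublocale hecke n q t
  using n1 q t by unfold_locales auto

definition grid :: "(nat \<Rightarrow> nat) set" where
  "grid = PiE {1..n} (\<lambda>_. UNIV)"

definition pt :: "(nat \<Rightarrow> nat) \<Rightarrow> nat \<Rightarrow> real" where
  "pt k = (\<lambda>i. if i \<in> {1..n} then q ^ k i else 0)"

definition qw :: "nat \<Rightarrow> real" where
  "qw k = qpoch_inf (q * q ^ k) q / qpoch_inf (B * q ^ k) q"

text \<open>\<open>X ^ k i\<close> is the value of \<open>s powr x\<close> at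
  \<open>s = q ^ k i\<close>: the factor \<open>q ^ k i\<close> of the \<open>q\<close>-integral is
  absorbed into \<open>s powr (x - 1)\<close>.\<close>

definition wgt :: "real \<Rightarrow> (nat \<Rightarrow> nat) \<Rightarrow> real" where
  "wgt X k = (\<Prod>i=1..n. X ^ k i * qw (k i)) * vand q lam n (pt k)"

definition L :: "real \<Rightarrow> mpoly \<Rightarrow> real" where
  "L X f = (\<Sum>\<^sub>\<infinity>k\<in>grid. wgt X k * peval f (pt k))"

lemma t_pos: "0 < t" and t_le_1: "t \<le> 1"
  using q by (auto simp: t power_le_one)

lemma Bq: "0 \<le> B * q ^ k" "B * q ^ k < 1" "0 \<le> q * q ^ k" "q * q ^ k < 1"
proof -
  have "B * q ^ k \<le> B * 1" using B q by (intro mult_left_mono power_le_one) auto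
  then show "B * q ^ k < 1" using B by linarith
  have "q * q ^ k \<le> q * 1" using q by (intro mult_left_mono power_le_one) auto
  then show "q * q ^ k < 1" using q by linarith
qed (use B q in auto)

lemma qw_pos: "0 < qw k"
  unfolding qw_def using Bq[of k] by (intro divide_pos_pos qpoch_inf_pos[OF q])

lemma qw_le: "qw k \<le> 1 / qpoch_inf B q"
proof -
  have "0 < qpoch_inf B q" using B by (intro qpoch_inf_pos[OF q]) auto
  moreover have "qpoch_inf B q \<le> qpoch_inf (B * q ^ k) q" using B by (intro qpoch_inf_mono[OF q]) auto
  moreover have "qpoch_inf (q * q ^ k) q \<le> 1" using Bq[of k] by (intro qpoch_inf_le_1[OF q])
  ultimately show ?thesis unfolding qw_def by (intro frac_le) auto
qed

text \<open>The first-order \<open>q\<close>-difference equation of the one-variable weight, the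
  source of the integration by parts.\<close>

lemma qw_Suc: "qw (Suc k) * (1 - q ^ Suc k) = qw k * (1 - B * q ^ k)"
proof -
  have s: "qpoch_inf z q = (1 - z) * qpoch_inf (z * q) q" if "0 \<le> z" "z < 1" for z
    using qpoch_inf_split[OF q that(2,1), of 1] by (simp add: qpoch_def)
  have "qpoch_inf (q * q ^ k) q = (1 - q ^ Suc k) * qpoch_inf (q * q ^ Suc k) q"
    using s[OF Bq(3,4)[of k]] by (simp add: mult_ac)
  moreover have "qpoch_inf (B * q ^ k) q = (1 - B * q ^ k) * qpoch_inf (B * q ^ Suc k) q"
    using s[OF Bq(1,2)[of k]] by (simp add: mult_ac)
  moreover have "0 < 1 - B * q ^ k" using Bq(2)[of k] by simp
  ultimately show ?thesis unfolding qw_def by simp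
qed

lemma pt_bounds: "\<bar>pt k i\<bar> \<le> 1"
  using q by (auto simp: pt_def power_le_one abs_mult)

lemma pair_factor_bounded:
  "\<exists>C. \<forall>a b. \<bar>a\<bar> \<le> 1 \<longrightarrow> \<bar>b\<bar> \<le> 1 \<longrightarrow> \<bar>pair_factor q lam a b\<bar> \<le> C"
proof (intro exI allI impI)
  fix a b :: real assume ab: "\<bar>a\<bar> \<le> 1" "\<bar>b\<bar> \<le> 1"
  show "\<bar>pair_factor q lam a b\<bar> \<le> (\<Prod>m<2 * lam. 1 + \<bar>q powi (1 - int lam + int m)\<bar>)"
    unfolding pair_factor_def abs_prod
  proof (intro prod_mono conjI)
    fix m
    have "\<bar>q powi (1 - int lam + int m) * b\<bar> \<le> \<bar>q powi (1 - int lam + int m)\<bar> * 1"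
      unfolding abs_mult using ab by (intro mult_left_mono) auto
    then show "\<bar>a - q powi (1 - int lam + int m) * b\<bar> \<le> 1 + \<bar>q powi (1 - int lam + int m)\<bar>"
      using ab by linarith
  qed simp
qed

lemma vand_bounded: "\<exists>C. \<forall>k. \<bar>vand q lam n (pt k)\<bar> \<le> C"
proof -
  obtain C where C: "\<And>a b. \<bar>a\<bar> \<le> 1 \<Longrightarrow> \<bar>b\<bar> \<le> 1 \<Longrightarrow> \<bar>pair_factor q lam a b\<bar> \<le> C"
    using pair_factor_bounded by blast
  have "\<bar>vand q lam n (pt k)\<bar> \<le> (\<Prod>p\<in>pairs n. C)" for k
    unfolding vand_def abs_prod
    by (rule prod_mono) (use C pt_bounds in auto)
  then show ?thesis by blast
qed

lemma wgt_bounded: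
  "\<exists>C. \<forall>X k. 0 \<le> X \<longrightarrow> \<bar>wgt X k * peval f (pt k)\<bar> \<le> C * (\<Prod>i=1..n. X ^ k i)"
proof -
  obtain C where C: "\<And>k. \<bar>vand q lam n (pt k)\<bar> \<le> C" using vand_bounded by blast
  define D where "D = (1 / qpoch_inf B q) ^ n * C * (\<Sum>m\<in>keys f. \<bar>lookup f m\<bar>)"
  have "\<bar>wgt X k * peval f (pt k)\<bar> \<le> D * (\<Prod>i=1..n. X ^ k i)" if X: "0 \<le> X" for X k
  proof -
    have B0: "0 < qpoch_inf B q" using B by (intro qpoch_inf_pos[OF q]) auto
    have "(\<Prod>i=1..n. qw (k i)) \<le> (\<Prod>i=1..n. 1 / qpoch_inf B q)"
      by (rule prod_mono) (use qw_le qw_pos less_imp_le in auto)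
    then have 1: "(\<Prod>i=1..n. qw (k i)) \<le> (1 / qpoch_inf B q) ^ n" by simp
    have 2: "0 \<le> (\<Prod>i=1..n. qw (k i))" by (rule prod_nonneg) (use qw_pos less_imp_le in auto)
    have 3: "0 \<le> (\<Prod>i=1..n. X ^ k i)" using X by (intro prod_nonneg) auto
    have "\<bar>wgt X k * peval f (pt k)\<bar> =
        (\<Prod>i=1..n. X ^ k i) * ((\<Prod>i=1..n. qw (k i)) * \<bar>vand q lam n (pt k)\<bar> * \<bar>peval f (pt k)\<bar>)"
      using 2 3 by (simp add: wgt_def prod.distrib abs_mult)
    also have "\<dots> \<le> (\<Prod>i=1..n. X ^ k i) * D"
      unfolding D_def
      by (intro mult_left_mono[OF _ 3] mult_mono 1 C peval_bounded pt_bounds)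
         (use 2 B0 order_trans[OF abs_ge_zero C] in \<open>auto intro!: mult_nonneg_nonneg\<close>)
    finally show ?thesis by (simp add: mult.commute)
  qed
  then show ?thesis by blast
qed

lemma summable_wgt:
  assumes "0 \<le> X" "X < 1"
  shows "(\<lambda>k. wgt X k * peval f (pt k)) summable_on grid"
proof -
  obtain C where C: "\<And>k. \<bar>wgt X k * peval f (pt k)\<bar> \<le> C * (\<Prod>i=1..n. X ^ k i)"
    using wgt_bounded[of f] assms(1) by blast
  have "(\<lambda>k. C * (\<Prod>i=1..n. X ^ k i)) summable_on grid"
    unfolding grid_def using assms by (intro summable_on_cmult_right summable_on_geometric_PiE) auto
  then have "(\<lambda>k. norm (wgt X k * peval f (pt k))) summable_on grid"
    by (rule summable_on_comparison_test) (use C in auto)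
  then show ?thesis by (rule abs_summable_summable)
qed

context
  fixes X :: real
  assumes X: "0 < X" "X < 1"
begin

lemma L_add: "L X (f + g) = L X f + L X g"
  unfolding L_def using X
  by (simp add: distrib_left infsum_add[OF summable_wgt summable_wgt])

lemma L_Const: "L X (Const c * f) = c * L X f"
  unfolding L_def by (simp add: mult.left_commute infsum_cmult_right')

lemma L_diff: "L X (f - g) = L X f - L X g"
  using L_add[of "f - g" g] by simp

lemma grid_adj:
  assumes "1 \<le> i" "Suc i \<le> n"
  shows "bij_betw (\<lambda>k. k \<circ> adj i) grid grid"
proof (rule bij_betw_byWitness[of _ "\<lambda>k. k \<circ> adj i"])
  have a: "j \<in> {1..n} \<longleftrightarrow> adj i j \<in> {1..n}" for j
    using assms by (cases "j = i"; cases "j = Suc i"; simp)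
  have "k \<circ> adj i \<in> grid" if "k \<in> grid" for k
    using that unfolding grid_def PiE_iff extensional_def comp_def using a by auto
  then show "(\<lambda>k. k \<circ> adj i) ` grid \<subseteq> grid" "(\<lambda>k. k \<circ> adj i) ` grid \<subseteq> grid" by auto
qed (auto simp: fun_eq_iff)

lemma pt_adj:
  assumes "1 \<le> i" "Suc i \<le> n"
  shows "pt (k \<circ> adj i) = pt k \<circ> adj i"
proof
  fix j show "pt (k \<circ> adj i) j = (pt k \<circ> adj i) j"
    using assms by (cases "j = i"; cases "j = Suc i"; simp add: pt_def)
qed

lemma wgt_adj:
  assumes i: "1 \<le> i" "Suc i \<le> n"
  shows "wgt X (k \<circ> adj i) * (pt k i - t * pt k (Suc i)) = wgt X k * (t * pt k i - pt k (Suc i))"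
proof -
  have "(\<Prod>j=1..n. X ^ (k \<circ> adj i) j * qw ((k \<circ> adj i) j)) = (\<Prod>j=1..n. X ^ k j * qw (k j))"
    using prod.reindex_bij_betw[OF bij_betw_adj[OF i], of "\<lambda>j. X ^ k j * qw (k j)"] by simp
  then show ?thesis
    unfolding wgt_def pt_adj[OF i] using vand_swap[OF i q(1), of lam "pt k"]
    by (simp add: t mult_ac)
qed

text \<open>In \<open>T i f = Const t * f + h\<close> the divided difference is symmetric, so by
  \<open>wgt_adj\<close> the weighted values of \<open>h\<close> are antisymmetric under the
  exchange of the two coordinates and sum to zero.\<close>

lemma L_T:
  assumes i: "1 \<le> i" "Suc i \<le> n"
  shows "L X (T i f) = t * L X f"
proof -
  define g where "g = div_diff i f"
  define h where "h = (Const t * Var i - Var (Suc i)) * g"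
  define F where "F = (\<lambda>k. wgt X k * peval h (pt k))"
  have "F (k \<circ> adj i) = - F k" for k
  proof -
    have "peval g (pt k \<circ> adj i) = peval g (pt k)"
      by (metis g_def peval_swap_op swap_div_diff)
    then have "F (k \<circ> adj i) = - (wgt X (k \<circ> adj i) * (pt k i - t * pt k (Suc i)) * peval g (pt k))"
      unfolding F_def h_def pt_adj[OF i] by (simp add: algebra_simps)
    then show ?thesis unfolding wgt_adj[OF i] by (simp add: F_def h_def mult_ac)
  qed
  then have "infsum F grid = infsum (\<lambda>k. - F k) grid"
    using infsum_reindex_bij_betw[OF grid_adj[OF i], of F] by simp
  then have "L X h = 0" by (simp add: infsum_uminus L_def F_def)
  moreover have "T i f = Const t * f + h" by (simp add: T_op_def h_def g_def)
  ultimately show ?thesis by (simp add: L_add L_Const)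
qed

lemma L_Var_T:
  assumes i: "1 \<le> i" "Suc i \<le> n"
  shows "L X (Var i * T i f) = L X (Var (Suc i) * f)"
proof -
  have "Var i * T i f = T i (Var (Suc i) * f) - Const (t - 1) * (Var (Suc i) * f)"
    unfolding T_op_Var_Suc by (simp add: Const_diff algebra_simps)
  then show ?thesis
    by (simp only: L_diff L_Const L_T[OF i]) (simp add: algebra_simps)
qed

lemma L_foldr_T:
  "set js \<subseteq> {1..<n} \<Longrightarrow> L X (foldr T js f) = t ^ length js * L X f"
  by (induction js) (simp_all add: L_T)

text \<open>Under \<open>L\<close>, each \<open>T\<close> that meets the variable raises its index
  by one and disappears.\<close>

lemma L_Var_foldr_T:
  "1 \<le> m \<Longrightarrow> m \<le> n \<Longrightarrow> L X (Var 1 * foldr T [1..<m] f) = L X (Var m * f)"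
proof (induction m arbitrary: f rule: dec_induct)
  case (step m)
  have u: "[1..<Suc m] = [1..<m] @ [m]" using step by simp
  show ?case
    unfolding u using step L_Var_T[of m f] by simp
qed simp

section \<open>Rotation of the grid and q-integration by parts\<close>

definition rotk :: "(nat \<Rightarrow> nat) \<Rightarrow> nat \<Rightarrow> nat" where
  "rotk k = (\<lambda>j. if j = 1 then Suc (k n) else if 1 < j \<and> j \<le> n then k (j - 1) else undefined)"

lemma bij_rotk: "bij_betw rotk grid {k\<in>grid. k 1 \<noteq> 0}"
proof -
  define r where "r = (\<lambda>k j. if j = n then k 1 - 1 else if 1 \<le> j \<and> j < n then k (Suc j) else (undefined::nat))"
  show ?thesis
  proof (rule bij_betw_byWitness[of _ r])
    show "\<forall>k\<in>grid. r (rotk k) = k"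
    proof (intro ballI ext)
      fix k j assume "k \<in> grid"
      then have "j \<notin> {1..n} \<Longrightarrow> k j = undefined" by (auto simp: grid_def PiE_def extensional_def)
      then show "r (rotk k) j = k j"
        using n1 by (cases "1 \<le> j"; cases "j < n"; cases "j = n"; simp add: r_def rotk_def)
    qed
    show "\<forall>k\<in>{k\<in>grid. k 1 \<noteq> 0}. rotk (r k) = k"
    proof (intro ballI ext)
      fix k j assume k: "k \<in> {k\<in>grid. k 1 \<noteq> 0}"
      then have undef: "j \<notin> {1..n} \<Longrightarrow> k j = undefined" by (auto simp: grid_def PiE_def extensional_def)
      consider "j = 1" | "1 < j" "j \<le> n" | "j \<notin> {1..n}" by fastforce
      then show "rotk (r k) j = k j"
      proof cases
        case 1
        then show ?thesis using k by (simp add: r_def rotk_def)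
      next
        case 2
        then have "j - 1 \<noteq> n" "1 \<le> j - 1" "j - 1 < n" "Suc (j - 1) = j" by auto
        then have "r k (j - 1) = k j" unfolding r_def by simp
        then show ?thesis using 2 by (simp add: rotk_def)
      next
        case 3
        then have "j \<noteq> 1" "\<not> (1 < j \<and> j \<le> n)" using n1 by auto
        then show ?thesis using undef[OF 3] by (auto simp: rotk_def)
      qed
    qed
    show "rotk ` grid \<subseteq> {k\<in>grid. k 1 \<noteq> 0}"
      using n1 by (auto simp: grid_def PiE_iff extensional_def rotk_def)
    show "r ` {k\<in>grid. k 1 \<noteq> 0} \<subseteq> grid"
      using n1 by (auto simp: grid_def PiE_iff extensional_def r_def)
  qed
qed

lemma pt_rotk: "pt (rotk k) = rot_point n q (pt k)"
  using n1 by (auto simp: pt_def rotk_def rot_point_def fun_eq_iff)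

lemma prod_rotk:
  "(\<Prod>i=1..n. (f (rotk k i) :: real)) = f (Suc (k n)) * (\<Prod>i=1..<n. f (k i))"
proof -
  obtain m where m: "n = Suc m" using n1 by (cases n) auto
  have "(\<Prod>i=1..n. f (rotk k i)) = (\<Prod>i<Suc m. f (rotk k (Suc i)))"
    unfolding m One_nat_def prod.atLeast1_atMost_eq ..
  also have "\<dots> = f (Suc (k n)) * (\<Prod>i<m. f (k (Suc i)))"
    unfolding prod.lessThan_Suc_shift rotk_def using m by simp
  also have "(\<Prod>i<m. f (k (Suc i))) = (\<Prod>i=1..m. f (k i))"
    unfolding One_nat_def prod.atLeast1_atMost_eq ..
  also have "{1..m} = {1..<n}" using m by auto
  finally show ?thesis .
qed

lemma wgt_rotk:
  "wgt X (rotk k) * (1 - q ^ Suc (k n)) = X * t ^ (n - 1) * (wgt X k * (1 - B * q ^ k n))"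
proof -
  have n: "{1..n} = insert n {1..<n}" using n1 by auto
  define R where "R = (\<Prod>i=1..<n. X ^ k i * qw (k i))"
  have "(\<Prod>i=1..n. X ^ rotk k i * qw (rotk k i)) = X ^ Suc (k n) * qw (Suc (k n)) * R"
    using prod_rotk[of "\<lambda>j. X ^ j * qw j"] by (simp add: R_def)
  moreover have "(\<Prod>i=1..n. X ^ k i * qw (k i)) = X ^ k n * qw (k n) * R"
    unfolding n by (simp add: R_def)
  moreover have "vand q lam n (pt (rotk k)) = t ^ (n - 1) * vand q lam n (pt k)"
    unfolding pt_rotk vand_rot[OF n1 q(1)] t ..
  ultimately have "wgt X (rotk k) * (1 - q ^ Suc (k n)) =
      X * X ^ k n * R * t ^ (n - 1) * vand q lam n (pt k) * (qw (Suc (k n)) * (1 - q ^ Suc (k n)))"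
    by (simp add: wgt_def mult_ac)
  also have "\<dots> = X * t ^ (n - 1) * (wgt X k * (1 - B * q ^ k n))"
    unfolding qw_Suc wgt_def \<open>(\<Prod>i=1..n. X ^ k i * qw (k i)) = _\<close> by (simp only: mult_ac)
  finally show ?thesis .
qed

text \<open>The \<open>q\<close>-integration by parts in the first variable: on the grid, the substitution
  \<open>(s\<^sub>1, \<dots>, s\<^sub>n) \<mapsto> (q s\<^sub>n, s\<^sub>1, \<dots>, s\<^sub>n\<^sub>-\<^sub>1)\<close> misses exactly the points with \<open>s\<^sub>1 = 1\<close>, where the
  integrand vanishes.\<close>

lemma L_by_parts:
  "L X ((1 - Var 1) * F) = X * t ^ (n - 1) * L X ((1 - Const B * Var n) * \<omega> F)"
proof -
  define G where "G = (\<lambda>k. wgt X k * peval ((1 - Var 1) * F) (pt k))"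
  have "L X ((1 - Var 1) * F) = infsum G {k\<in>grid. k 1 \<noteq> 0}"
    unfolding L_def G_def
    by (rule infsum_cong_neutral) (use n1 in \<open>auto simp: pt_def\<close>)
  also have "\<dots> = infsum (\<lambda>k. G (rotk k)) grid"
    by (rule infsum_reindex_bij_betw[OF bij_rotk, symmetric])
  also have "\<dots> = infsum (\<lambda>k. X * t ^ (n - 1) * (wgt X k * peval ((1 - Const B * Var n) * \<omega> F) (pt k))) grid"
  proof (rule infsum_cong)
    fix k
    have "pt (rotk k) 1 = q ^ Suc (k n)" using n1 by (simp add: pt_def rotk_def)
    then have "G (rotk k) = wgt X (rotk k) * (1 - q ^ Suc (k n)) * peval F (pt (rotk k))"
      by (simp add: G_def)
    also have "\<dots> = X * t ^ (n - 1) * (wgt X k * (1 - B * q ^ k n)) * peval (\<omega> F) (pt k)"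
      unfolding wgt_rotk pt_rotk peval_omega[OF n1] ..
    finally show "G (rotk k) = X * t ^ (n - 1) * (wgt X k * peval ((1 - Const B * Var n) * \<omega> F) (pt k))"
      using n1 by (simp add: pt_def mult_ac)
  qed
  also have "\<dots> = X * t ^ (n - 1) * L X ((1 - Const B * Var n) * \<omega> F)"
    by (simp add: infsum_cmult_right' L_def)
  finally show ?thesis .
qed

text \<open>The eigenvalue equation turns \<open>foldr T [1..<n] (\<omega> f)\<close> into a
  multiple of \<open>f\<close>. With \<open>L_foldr_T\<close> and \<open>L_Var_foldr_T\<close>, the
  values of \<open>L\<close> at \<open>\<omega> f\<close> and \<open>Var n * \<omega> f\<close>
  become multiples of those at \<open>f\<close> and \<open>Var 1 * f\<close>, and integration by
  parts is a linear equation that eliminates the last one.\<close>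

lemma L_raise:
  assumes Y: "Y 1 f = Const z * f"
  shows "L X (Var n * \<omega> f) * (1 - X * B * t ^ (2 * (n - 1)) * z) = t ^ (n - 1) * z * (1 - X * t ^ (n - 1) * z) * L X f"
proof -
  define N where "N = t ^ (n - 1)"
  have N0: "N \<noteq> 0" using t_pos by (simp add: N_def)
  have p: "t powi (1 - int n) * N = 1"
  proof -
    have "N = t powi (int n - 1)" using n1 by (simp add: N_def power_int_def nat_diff_distrib)
    then show ?thesis using t_pos by (simp add: power_int_add[symmetric])
  qed
  have "Const (t powi (1 - int n)) * foldr T [1..<n] (\<omega> f) = Const z * f"
    using Y by (simp add: Y_eq)
  then have "Const N * (Const (t powi (1 - int n)) * foldr T [1..<n] (\<omega> f)) = Const N * (Const z * f)" by simp
  then have fT: "foldr T [1..<n] (\<omega> f) = Const (N * z) * f"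
    using p by (simp add: mult.assoc[symmetric] mult.commute[of N] flip: Const_mult)
  have "N * L X (\<omega> f) = N * z * L X f"
    using L_foldr_T[of "[1..<n]" "\<omega> f"] unfolding fT L_Const length_upt N_def[symmetric] by auto
  then have "N * L X (\<omega> f) = N * (z * L X f)" by (simp only: mult.assoc)
  then have 1: "L X (\<omega> f) = z * L X f" using N0 mult_left_cancel by blast
  have "L X (Var n * \<omega> f) = L X (Var 1 * foldr T [1..<n] (\<omega> f))"
    using L_Var_foldr_T[of n "\<omega> f"] n1 by simp
  also have "\<dots> = L X (Const (N * z) * (Var 1 * f))" unfolding fT by (simp only: mult_ac)
  finally have 2: "L X (Var n * \<omega> f) = N * z * L X (Var 1 * f)" by (simp only: L_Const)
  have "L X ((1 - Var 1) * f) = L X f - L X (Var 1 * f)"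
    by (simp add: left_diff_distrib L_diff)
  moreover have "(1 - Const B * Var n) * \<omega> f = \<omega> f - Const B * (Var n * \<omega> f)"
    by (simp add: left_diff_distrib mult.assoc)
  then have "L X ((1 - Const B * Var n) * \<omega> f) = L X (\<omega> f) - B * L X (Var n * \<omega> f)"
    by (simp only: L_diff L_Const)
  ultimately have 3: "L X f - L X (Var 1 * f) = X * N * (z * L X f - B * (N * z * L X (Var 1 * f)))"
    using L_by_parts[of f] by (simp only: N_def 1 2)
  have NN: "t ^ (2 * (n - 1)) = N * N" by (simp add: N_def power_mult power2_eq_square mult_2 power_add)
  have "L X (Var 1 * f) * (1 - X * B * (N * N) * z) = (1 - X * N * z) * L X f"
    using 3 by algebra
  then show ?thesis
    unfolding 2 NN N_def[symmetric] by algebra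
qed

end

end

section \<open>Evaluation of the functional\<close>

lemma peval_cong_comps:
  assumes "keys E \<subseteq> comps n" "\<And>i. i \<in> {1..n} \<Longrightarrow> s i = s' i"
  shows "peval E s = peval E s'"
  unfolding peval_def insertion_def
proof (intro sum.cong refl arg_cong2[of _ _ _ _ "(*)"] prod.cong)
  fix m i assume "m \<in> keys E" "i \<in> keys m"
  then have "i \<in> {1..n}" using assms(1) unfolding comps_def by blast
  then show "s i ^ lookup m i = s' i ^ lookup m i" by (simp add: assms(2))
qed

lemma low_set_wt:
  assumes "\<nu> \<in> low_set n \<eta>"
  shows "wt n \<nu> = wt n \<eta>"
proof -
  have "lookup \<nu> = lookup \<eta> \<or> comp_less n (lookup \<nu>) (lookup \<eta>)"
    using assms by (intro low_comp_less) (simp add: low_set_def)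
  then show ?thesis by (auto simp: comp_less_def)
qed

lemma peval_homogeneous:
  assumes "keys E \<subseteq> low_set n \<eta>"
  shows "peval E (\<lambda>i. c * s i) = c ^ wt n \<eta> * peval E s"
proof -
  have "(\<Prod>i\<in>keys m. (c * s i) ^ lookup m i) = c ^ wt n \<eta> * (\<Prod>i\<in>keys m. s i ^ lookup m i)"
    if "m \<in> keys E" for m
  proof -
    have m: "m \<in> low_set n \<eta>" using assms that by blast
    then have "keys m \<subseteq> {1..n}" by (simp add: low_set_def comps_def)
    then have "(\<Sum>i\<in>keys m. lookup m i) = wt n m"
      by (intro sum.mono_neutral_left) (auto simp: in_keys_iff)
    then have "(\<Prod>i\<in>keys m. c ^ lookup m i) = c ^ wt n \<eta>"
      using low_set_wt[OF m] by (simp add: power_sum[symmetric])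
    then show ?thesis by (simp add: power_mult_distrib prod.distrib)
  qed
  then have "peval E (\<lambda>i. c * s i) = (\<Sum>m\<in>keys E. lookup E m * (c ^ wt n \<eta> * (\<Prod>i\<in>keys m. s i ^ lookup m i)))"
    by (simp add: peval_def insertion_def)
  then show ?thesis by (simp add: peval_def insertion_def sum_distrib_left mult_ac)
qed

lemma rot_point_funpow:
  assumes "j \<le> n" "1 \<le> i" "i \<le> n"
  shows "(rot_point n q ^^ j) s i = (if i \<le> j then q * s (n - j + i) else s (i - j))"
  using assms
proof (induction j arbitrary: i)
  case (Suc j)
  define r where "r = (rot_point n q ^^ j) s"
  have r: "(rot_point n q ^^ Suc j) s i = (if i = 1 then q * r n else if 1 < i \<and> i \<le> n then r (i - 1) else r i)"
    unfolding funpow.simps comp_apply r_def[symmetric] rot_point_def ..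
  show ?case
  proof (cases "i = 1")
    case True
    have "(rot_point n q ^^ j) s n = s (n - j)" using Suc.IH[of n] Suc.prems by simp
    moreover have "n - Suc j + 1 = n - j" using Suc.prems by simp
    ultimately show ?thesis using True unfolding r by (simp add: r_def)
  next
    case False
    then have "(rot_point n q ^^ j) s (i - 1) = (if i - 1 \<le> j then q * s (n - j + (i - 1)) else s (i - 1 - j))"
      using Suc.prems by (intro Suc.IH) auto
    moreover have "n - j + (i - 1) = n - Suc j + i" "i - 1 - j = i - Suc j" "i - 1 \<le> j \<longleftrightarrow> i \<le> Suc j"
      using Suc.prems False by auto
    ultimately show ?thesis using False Suc.prems unfolding r by (simp add: r_def)
  qed
qed simp

lemma rot_point_funpow_outside:
  assumes "i \<notin> {1..n}" "1 \<le> n"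
  shows "(rot_point n q ^^ j) s i = s i"
  using assms by (induction j) (auto simp: rot_point_def)

context qint
begin

definition part :: "expvec \<Rightarrow> nat \<Rightarrow> nat" where
  "part \<eta> i = partition_of n (lookup \<eta>) i"

text \<open>With \<open>X = q powr x\<close> and \<open>B = q powr y\<close>, the products
  \<open>X * \<alpha> \<eta> i\<close> and \<open>X * \<beta> \<eta> i\<close> are \<open>q\<close>
  raised to the arguments of the gamma functions in which the parts of \<eta> occur.\<close>

definition \<alpha> :: "expvec \<Rightarrow> nat \<Rightarrow> real" where
  "\<alpha> \<eta> i = q ^ (part \<eta> i + lam * (n - i))"

definition \<beta> :: "expvec \<Rightarrow> nat \<Rightarrow> real" where
  "\<beta> \<eta> i = B * q ^ (part \<eta> i + lam * (2 * n - 1 - i))"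

text \<open>Exponents of the point \<open>(1, t, ..., t ^ (n - 1))\<close>; the value
  \<open>undefined\<close> outside \<open>{1..n}\<close> makes it a member of
  \<open>grid\<close>.\<close>

definition \<delta> :: "nat \<Rightarrow> nat" where
  "\<delta> = (\<lambda>i. if i \<in> {1..n} then lam * (i - 1) else undefined)"

text \<open>The weighted value with the power of \<open>X\<close> removed, see
  \<open>wgt_G\<close>.\<close>

definition G :: "mpoly \<Rightarrow> (nat \<Rightarrow> nat) \<Rightarrow> real" where
  "G E k = (\<Prod>i=1..n. qw (k i)) * vand q lam n (pt k) * peval E (pt k)"

context
  fixes \<eta> :: expvec and E :: mpoly
  assumes \<eta>: "\<eta> \<in> comps n" and E: "isE \<eta> E"
begin

abbreviation "z i \<equiv> spec_val n q t (lookup \<eta>) i"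

definition chain :: "nat \<Rightarrow> mpoly" where
  "chain k = ((\<lambda>f. Var n * \<omega> f) ^^ k) E"

lemma chain_Suc: "chain (Suc k) = Var n * \<omega> (chain k)"
  by (simp add: chain_def)

text \<open>Each application of \<open>Var n * \<omega>\<close> moves the next eigenvalue to
  \<open>Y 1\<close>, so the step from \<open>chain k\<close> to \<open>chain (Suc k)\<close>
  involves \<open>z (Suc k)\<close>.\<close>

lemma Y_chain: "1 \<le> i \<Longrightarrow> i + k \<le> n \<Longrightarrow> Y i (chain k) = Const (z (i + k)) * chain k"
proof (induction k arbitrary: i)
  case 0
  then show ?case using E by (simp add: chain_def isE_def)
next
  case (Suc k)
  have "Y i (chain (Suc k)) = Var n * \<omega> (Y (Suc i) (chain k))"
    unfolding chain_Suc using Suc.prems by (intro Y_raise) auto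
  also have "Y (Suc i) (chain k) = Const (z (i + Suc k)) * chain k"
    using Suc.IH[of "Suc i"] Suc.prems by simp
  finally show ?case by (simp add: chain_Suc omega_simps mult.left_commute)
qed

lemma L_chain:
  assumes X: "0 < X" "X < 1"
  shows "k \<le> n \<Longrightarrow> L X (chain k) * (\<Prod>i=1..k. 1 - X * B * t ^ (2 * (n - 1)) * z i) =
    (\<Prod>i=1..k. t ^ (n - 1) * z i * (1 - X * t ^ (n - 1) * z i)) * L X E"
proof (induction k)
  case 0
  then show ?case by (simp add: chain_def)
next
  case (Suc k)
  have "Y 1 (chain k) = Const (z (Suc k)) * chain k"
    using Y_chain[of 1 k] Suc.prems by simp
  from L_raise[OF X this] have step: "L X (chain (Suc k)) * (1 - X * B * t ^ (2 * (n - 1)) * z (Suc k)) =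
      t ^ (n - 1) * z (Suc k) * (1 - X * t ^ (n - 1) * z (Suc k)) * L X (chain k)"
    by (simp only: chain_Suc)
  define P where "P = (\<Prod>i=1..k. 1 - X * B * t ^ (2 * (n - 1)) * z i)"
  define Q where "Q = (\<Prod>i=1..k. t ^ (n - 1) * z i * (1 - X * t ^ (n - 1) * z i))"
  have IH: "L X (chain k) * P = Q * L X E" using Suc by (simp add: P_def Q_def)
  have "L X (chain (Suc k)) * (P * (1 - X * B * t ^ (2 * (n - 1)) * z (Suc k))) =
      (L X (chain (Suc k)) * (1 - X * B * t ^ (2 * (n - 1)) * z (Suc k))) * P"
    by (simp only: mult_ac)
  also have "\<dots> = t ^ (n - 1) * z (Suc k) * (1 - X * t ^ (n - 1) * z (Suc k)) * (L X (chain k) * P)"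
    unfolding step by (simp only: mult_ac)
  also have "\<dots> = (Q * (t ^ (n - 1) * z (Suc k) * (1 - X * t ^ (n - 1) * z (Suc k)))) * L X E"
    unfolding IH by (simp only: mult_ac)
  finally show ?case by (simp add: P_def Q_def)
qed

lemma keys_E: "keys E \<subseteq> low_set n \<eta>" and keys_E_comps: "keys E \<subseteq> comps n"
  using E by (auto simp: isE_def low_set_def)

lemma peval_chain: "peval (chain k) s = (\<Prod>j<k. (rot_point n q ^^ j) s n) * peval E ((rot_point n q ^^ k) s)"
proof (induction k arbitrary: s)
  case 0
  then show ?case by (simp add: chain_def)
next
  case (Suc k)
  have "peval (chain (Suc k)) s = s n * peval (chain k) (rot_point n q s)"
    by (simp add: chain_Suc peval_omega[OF n1])
  also have "\<dots> = (s n * (\<Prod>j<k. (rot_point n q ^^ Suc j) s n)) * peval E ((rot_point n q ^^ Suc k) s)"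
    unfolding Suc by (simp add: funpow_swap1 mult_ac)
  finally show ?case by (simp only: prod.lessThan_Suc_shift) simp
qed

lemma peval_chain_n: "peval (chain n) (pt k) = q ^ wt n \<eta> * ((\<Prod>i=1..n. q ^ k i) * peval E (pt k))"
proof -
  have 1: "(\<Prod>j<n. (rot_point n q ^^ j) (pt k) n) = (\<Prod>i=1..n. q ^ k i)"
  proof -
    have "(\<Prod>j<n. (rot_point n q ^^ j) (pt k) n) = (\<Prod>j<n. pt k (n - j))"
      by (rule prod.cong) (use n1 in \<open>auto simp: rot_point_funpow\<close>)
    also have "\<dots> = (\<Prod>j<n. pt k (Suc (n - Suc j)))"
      by (rule prod.cong) (auto simp: Suc_diff_Suc)
    also have "\<dots> = (\<Prod>j<n. pt k (Suc j))"
      by (rule prod.nat_diff_reindex)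
    also have "\<dots> = (\<Prod>i=1..n. pt k i)"
      unfolding One_nat_def prod.atLeast1_atMost_eq ..
    also have "\<dots> = (\<Prod>i=1..n. q ^ k i)" by (rule prod.cong) (auto simp: pt_def)
    finally show ?thesis .
  qed
  have "(rot_point n q ^^ n) (pt k) i = q * pt k i" for i
  proof (cases "i \<in> {1..n}")
    case True
    then show ?thesis using rot_point_funpow[of n n i q "pt k"] by simp
  next
    case False
    then show ?thesis using rot_point_funpow_outside[OF False n1] by (auto simp: pt_def)
  qed
  then have "(rot_point n q ^^ n) (pt k) = (\<lambda>i. q * pt k i)" by (rule ext)
  then have 2: "peval E ((rot_point n q ^^ n) (pt k)) = q ^ wt n \<eta> * peval E (pt k)"
    using peval_homogeneous[OF keys_E] by simp
  show ?thesis unfolding peval_chain 1 2 by (simp only: mult_ac)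
qed

text \<open>After \<open>n\<close> rotations every coordinate occurs once as a factor and is once
  multiplied by \<open>q\<close> in the argument: the factors turn \<open>X\<close> into
  \<open>X * q\<close>, and homogeneity of \<open>E\<close> gives the power of
  \<open>q\<close>.\<close>

lemma L_chain_n: "L X (chain n) = q ^ wt n \<eta> * L (X * q) E"
proof -
  have "wgt X k * peval (chain n) (pt k) = q ^ wt n \<eta> * (wgt (X * q) k * peval E (pt k))" for k
    unfolding peval_chain_n by (simp add: wgt_def power_mult_distrib prod.distrib mult_ac)
  then show ?thesis by (simp add: L_def infsum_cmult_right')
qed

lemma z_leg: "z i * t ^ leg' n (lookup \<eta>) i = q ^ lookup \<eta> i"
  using t_pos by (simp add: spec_val_def power_int_minus)

lemma z_power:
  assumes "leg' n (lookup \<eta>) i \<le> N"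
  shows "t ^ N * z i = q ^ (lookup \<eta> i + lam * (N - leg' n (lookup \<eta>) i))"
proof -
  have "t ^ N = t ^ leg' n (lookup \<eta>) i * t ^ (N - leg' n (lookup \<eta>) i)"
    using assms by (simp add: power_add[symmetric])
  then have "t ^ N * z i = (z i * t ^ leg' n (lookup \<eta>) i) * t ^ (N - leg' n (lookup \<eta>) i)"
    by (simp only: mult_ac)
  then show ?thesis unfolding z_leg by (simp add: t power_add power_mult)
qed

text \<open>Leg lengths are at most \<open>n - 1\<close>, so the bound on \<open>N\<close> keeps the
  subtraction in the exponent free of truncation.\<close>

lemma prod_part:
  assumes N: "n - 1 \<le> N"
  shows "(\<Prod>i=1..n. 1 - C * (t ^ N * z i)) = (\<Prod>i=1..n. 1 - C * q ^ (part \<eta> i + lam * (N - (i - 1))))"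
proof -
  have "(\<Prod>i=1..n. 1 - C * (t ^ N * z i)) =
      (\<Prod>i=1..n. (\<lambda>e l. 1 - C * q ^ (e + lam * (N - l))) (lookup \<eta> i) (leg' n (lookup \<eta>) i))"
  proof (rule prod.cong[OF refl])
    fix i assume "i \<in> {1..n}"
    then have "leg' n (lookup \<eta>) i \<le> N" using leg'_less[of i n "lookup \<eta>"] N by linarith
    then show "1 - C * (t ^ N * z i) = (\<lambda>e l. 1 - C * q ^ (e + lam * (N - l))) (lookup \<eta> i) (leg' n (lookup \<eta>) i)"
      by (simp add: z_power)
  qed
  also have "\<dots> = (\<Prod>i=1..n. 1 - C * q ^ (part \<eta> i + lam * (N - (i - 1))))"
    unfolding part_def by (rule prod_leg'_eq)
  finally show ?thesis .
qed

text \<open>The legs are a permutation of the numbers below \<open>n\<close>; they take half of the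
  exponent \<open>n * (n - 1)\<close> of \<open>t\<close>.\<close>

lemma prod_t_z: "(\<Prod>i=1..n. t ^ (n - 1) * z i) = t ^ (n choose 2) * q ^ wt n \<eta>"
proof -
  have n2: "n * (n - 1) = (n choose 2) + (n choose 2)"
  proof -
    have "even (n * (n - 1))" by (cases n) auto
    then show ?thesis unfolding choose_two by presburger
  qed
  have "(\<Prod>i=1..n. z i) * t ^ (n choose 2) = (\<Prod>i=1..n. z i * t ^ leg' n (lookup \<eta>) i)"
    by (simp add: prod.distrib power_sum[symmetric] sum_leg'[unfolded One_nat_def])
  also have "\<dots> = q ^ wt n \<eta>"
    unfolding z_leg by (simp add: power_sum)
  finally have *: "(\<Prod>i=1..n. z i) * t ^ (n choose 2) = q ^ wt n \<eta>" .
  have "(\<Prod>i=1..n. t ^ (n - 1) * z i) = t ^ (n * (n - 1)) * (\<Prod>i=1..n. z i)"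
    by (simp add: prod.distrib power_mult[symmetric] mult.commute)
  also have "\<dots> = t ^ (n choose 2) * ((\<Prod>i=1..n. z i) * t ^ (n choose 2))"
    unfolding n2 power_add by (simp only: mult_ac)
  finally show ?thesis unfolding * .
qed

abbreviation "c0 \<equiv> lam * (n choose 2)"

text \<open>Two evaluations of \<open>L X (chain n)\<close> are equated: through the factors of
  \<open>L_raise\<close>, and as a multiple of \<open>L (X * q) E\<close>. The power of
  \<open>q\<close> with exponent \<open>wt n \<eta>\<close> cancels.\<close>

lemma L_shift:
  assumes X: "0 < X" "X < 1"
  shows "L (X * q) E * (\<Prod>i=1..n. 1 - X * \<beta> \<eta> i) = q ^ c0 * (\<Prod>i=1..n. 1 - X * \<alpha> \<eta> i) * L X E"
proof -
  have b: "(\<Prod>i=1..n. 1 - X * B * t ^ (2 * (n - 1)) * z i) = (\<Prod>i=1..n. 1 - X * \<beta> \<eta> i)"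
  proof -
    have "(\<Prod>i=1..n. 1 - X * B * (t ^ (2 * (n - 1)) * z i)) =
        (\<Prod>i=1..n. 1 - X * B * q ^ (part \<eta> i + lam * (2 * (n - 1) - (i - 1))))"
      by (rule prod_part) simp
    also have "\<dots> = (\<Prod>i=1..n. 1 - X * \<beta> \<eta> i)"
    proof (rule prod.cong[OF refl])
      fix i assume "i \<in> {1..n}"
      then have "2 * (n - 1) - (i - 1) = 2 * n - 1 - i" by auto
      then show "1 - X * B * q ^ (part \<eta> i + lam * (2 * (n - 1) - (i - 1))) = 1 - X * \<beta> \<eta> i"
        by (simp only: \<beta>_def mult_ac)
    qed
    finally show ?thesis by (simp only: mult_ac)
  qed
  have a: "(\<Prod>i=1..n. 1 - X * t ^ (n - 1) * z i) = (\<Prod>i=1..n. 1 - X * \<alpha> \<eta> i)"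
  proof -
    have "(\<Prod>i=1..n. 1 - X * (t ^ (n - 1) * z i)) =
        (\<Prod>i=1..n. 1 - X * q ^ (part \<eta> i + lam * ((n - 1) - (i - 1))))"
      by (rule prod_part) simp
    also have "\<dots> = (\<Prod>i=1..n. 1 - X * \<alpha> \<eta> i)"
    proof (rule prod.cong[OF refl])
      fix i assume "i \<in> {1..n}"
      then have "(n - 1) - (i - 1) = n - i" by auto
      then show "1 - X * q ^ (part \<eta> i + lam * ((n - 1) - (i - 1))) = 1 - X * \<alpha> \<eta> i"
        by (simp only: \<alpha>_def)
    qed
    finally show ?thesis by (simp only: mult_ac)
  qed
  have tc: "t ^ (n choose 2) = q ^ c0" by (simp add: t power_mult)
  have "q ^ wt n \<eta> * (L (X * q) E * (\<Prod>i=1..n. 1 - X * \<beta> \<eta> i)) =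
      L X (chain n) * (\<Prod>i=1..n. 1 - X * B * t ^ (2 * (n - 1)) * z i)"
    unfolding L_chain_n b by (simp only: mult_ac)
  also have "\<dots> = (\<Prod>i=1..n. t ^ (n - 1) * z i * (1 - X * t ^ (n - 1) * z i)) * L X E"
    by (rule L_chain[OF X order_refl])
  also have "\<dots> = q ^ wt n \<eta> * (q ^ c0 * (\<Prod>i=1..n. 1 - X * \<alpha> \<eta> i) * L X E)"
  proof -
    have "(\<Prod>i=1..n. t ^ (n - 1) * z i * (1 - X * t ^ (n - 1) * z i)) =
        (\<Prod>i=1..n. t ^ (n - 1) * z i) * (\<Prod>i=1..n. 1 - X * t ^ (n - 1) * z i)"
      by (rule prod.distrib)
    then show ?thesis unfolding prod_t_z a tc by (simp only: mult_ac)
  qed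
  finally show ?thesis using q by simp
qed

lemma L_shift_iter:
  assumes X: "0 < X" "X < 1"
  shows "L (X * q ^ M) E * (\<Prod>i=1..n. qpoch (X * \<beta> \<eta> i) q M) = (q ^ c0) ^ M * (\<Prod>i=1..n. qpoch (X * \<alpha> \<eta> i) q M) * L X E"
proof (induction M)
  case 0
  then show ?case by (simp add: qpoch_def)
next
  case (Suc M)
  have "X * q ^ M \<le> X * 1" using X q by (intro mult_left_mono power_le_one) auto
  then have XM: "0 < X * q ^ M" "X * q ^ M < 1" using X q by (simp, linarith)
  have s: "(\<Prod>i=1..n. qpoch (X * f i) q (Suc M)) = (\<Prod>i=1..n. qpoch (X * f i) q M) * (\<Prod>i=1..n. 1 - X * q ^ M * f i)" for f
    by (simp add: qpoch_def prod.distrib[symmetric] mult_ac)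
  have "L (X * q ^ Suc M) E * (\<Prod>i=1..n. qpoch (X * \<beta> \<eta> i) q (Suc M)) =
      (L (X * q ^ M * q) E * (\<Prod>i=1..n. 1 - X * q ^ M * \<beta> \<eta> i)) * (\<Prod>i=1..n. qpoch (X * \<beta> \<eta> i) q M)"
    unfolding s by (simp add: mult_ac)
  also have "\<dots> = q ^ c0 * (\<Prod>i=1..n. 1 - X * q ^ M * \<alpha> \<eta> i) * (L (X * q ^ M) E * (\<Prod>i=1..n. qpoch (X * \<beta> \<eta> i) q M))"
    unfolding L_shift[OF XM] by (simp only: mult_ac)
  also have "\<dots> = (q ^ c0) ^ Suc M * (\<Prod>i=1..n. qpoch (X * \<alpha> \<eta> i) q (Suc M)) * L X E"
    unfolding Suc s by (simp add: mult_ac)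
  finally show ?case .
qed

lemma wgt_G: "wgt X k * peval E (pt k) = X ^ (\<Sum>i=1..n. k i) * G E k"
  by (simp add: wgt_def G_def prod.distrib power_sum mult_ac)

lemma \<delta>_grid: "\<delta> \<in> grid"
  by (auto simp: grid_def \<delta>_def PiE_iff extensional_def)

lemma sum_\<delta>: "(\<Sum>i=1..n. \<delta> i) = c0"
proof -
  have "(\<Sum>i=1..n. \<delta> i) = (\<Sum>i=1..n. lam * (i - 1))"
    by (rule sum.cong) (auto simp: \<delta>_def)
  also have "\<dots> = lam * (\<Sum>i<n. i)"
    unfolding One_nat_def sum.atLeast1_atMost_eq by (simp add: sum_distrib_left)
  also have "(\<Sum>i<n. i) = n choose 2" by (simp add: lessThan_atLeast0 choose_two Sum_Ico_nat)
  finally show ?thesis .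
qed

text \<open>A nonzero weight keeps every pair out of the window of \<open>pair_factor_eq_0\<close>,
  so the exponents satisfy the hypothesis of \<open>gap_exponents\<close>, whose equality case is
  \<delta> alone.\<close>

lemma G_support:
  assumes k: "k \<in> grid" and "G E k \<noteq> 0" and "k \<noteq> \<delta>"
  shows "c0 < (\<Sum>i=1..n. k i)"
proof -
  have gaps: "k i + lam \<le> k j \<or> k j + lam + 1 \<le> k i" if "1 \<le> i" "i < j" "j \<le> n" for i j
  proof (rule ccontr)
    assume "\<not> ?thesis"
    then have "pair_factor q lam (q ^ k i) (q ^ k j) = 0"
      by (intro pair_factor_eq_0 q) auto
    then have "pair_factor q lam (pt k i) (pt k j) = 0" using that by (simp add: pt_def)
    then have "vand q lam n (pt k) = 0"
      unfolding vand_def using that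
      by (intro prod_zero[OF finite_pairs] bexI[of _ "(i, j)"]) (auto simp: pairs_def)
    then show False using assms(2) by (simp add: G_def)
  qed
  have "c0 \<le> (\<Sum>i=1..n. k i)" by (rule gap_exponents(1)[OF gaps])
  moreover have "(\<Sum>i=1..n. k i) \<noteq> c0"
  proof
    assume eq: "(\<Sum>i=1..n. k i) = c0"
    have "k i = \<delta> i" for i
    proof (cases "i \<in> {1..n}")
      case True
      then show ?thesis using gap_exponents(2)[OF gaps eq True] by (simp add: \<delta>_def)
    next
      case False
      then show ?thesis using k by (auto simp: grid_def PiE_def extensional_def \<delta>_def)
    qed
    then show False using assms(3) by (simp add: fun_eq_iff)
  qed
  ultimately show ?thesis by simp
qed

text \<open>After the division the term at \<delta> is constant in \<open>M\<close>, and every other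
  nonzero term keeps at least one factor \<open>q ^ M\<close>. So the remainder is at most
  \<open>q ^ M\<close> times its absolute sum at \<open>M = 0\<close>.\<close>

lemma L_asymptotic:
  assumes X: "0 < X" "X < 1"
  shows "(\<lambda>M. L (X * q ^ M) E / (X * q ^ M) ^ c0) \<longlonglongrightarrow> G E \<delta>"
proof -
  define S where "S = (\<lambda>k::nat \<Rightarrow> nat. \<Sum>i=1..n. k i)"
  define u where "u = (\<lambda>M k. (X * q ^ M) ^ S k * G E k / (X * q ^ M) ^ c0)"
  define d where "d = (\<lambda>M k. if k = \<delta> then 0 else u M k)"
  have XM: "0 < X * q ^ M" "X * q ^ M < 1" for M
  proof -
    have "X * q ^ M \<le> X * 1" using X q by (intro mult_left_mono power_le_one) auto
    then show "X * q ^ M < 1" using X by linarith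
    show "0 < X * q ^ M" using X q by simp
  qed
  have summ: "u M summable_on grid" for M
  proof -
    have "(\<lambda>k. (X * q ^ M) ^ S k * G E k) summable_on grid"
      using summable_wgt[of "X * q ^ M" E] XM[of M] unfolding wgt_G S_def by simp
    from summable_on_cmult_left[OF this, of "inverse ((X * q ^ M) ^ c0)"]
    show ?thesis unfolding u_def by (simp add: divide_inverse)
  qed
  have Lu: "L (X * q ^ M) E / (X * q ^ M) ^ c0 = infsum (u M) grid" for M
  proof -
    have "infsum (\<lambda>k. (X * q ^ M) ^ S k * G E k * inverse ((X * q ^ M) ^ c0)) grid =
        infsum (\<lambda>k. (X * q ^ M) ^ S k * G E k) grid * inverse ((X * q ^ M) ^ c0)"
      by (rule infsum_cmult_left')
    then show ?thesis unfolding L_def wgt_G u_def S_def by (simp add: divide_inverse)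
  qed
  have u\<delta>: "u M \<delta> = G E \<delta>" for M
    unfolding u_def S_def sum_\<delta> using X q by simp
  have fin: "(\<lambda>k. if k = \<delta> then G E \<delta> else 0) summable_on grid"
    "infsum (\<lambda>k. if k = \<delta> then G E \<delta> else 0) grid = G E \<delta>"
  proof -
    have "((\<lambda>k. if k = \<delta> then G E \<delta> else 0) has_sum G E \<delta>) grid \<longleftrightarrow> ((\<lambda>k. if k = \<delta> then G E \<delta> else 0) has_sum G E \<delta>) {\<delta>}"
      using \<delta>_grid by (intro has_sum_cong_neutral) auto
    moreover have "((\<lambda>k. if k = \<delta> then G E \<delta> else 0) has_sum G E \<delta>) {\<delta>}"
      using has_sum_finite[of "{\<delta>}" "\<lambda>k. if k = \<delta> then G E \<delta> else 0"] by simp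
    ultimately have h: "((\<lambda>k. if k = \<delta> then G E \<delta> else 0) has_sum G E \<delta>) grid" by simp
    show "(\<lambda>k. if k = \<delta> then G E \<delta> else 0) summable_on grid" using h by (rule has_sum_imp_summable)
    show "infsum (\<lambda>k. if k = \<delta> then G E \<delta> else 0) grid = G E \<delta>" using h by (rule infsumI)
  qed
  have ud: "u M = (\<lambda>k. (if k = \<delta> then G E \<delta> else 0) + d M k)" for M
    by (rule ext) (simp add: d_def u\<delta>)
  have dsum: "d M summable_on grid" for M
  proof -
    have "(\<lambda>k. u M k + (- (if k = \<delta> then G E \<delta> else 0))) summable_on grid"
      by (intro summable_on_add summ summable_on_uminus[THEN iffD2] fin(1))
    also have "(\<lambda>k. u M k + (- (if k = \<delta> then G E \<delta> else 0))) = d M"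
      by (rule ext) (simp add: d_def u\<delta>)
    finally show ?thesis .
  qed
  have diff: "L (X * q ^ M) E / (X * q ^ M) ^ c0 - G E \<delta> = infsum (d M) grid" for M
    unfolding Lu ud using infsum_add[OF fin(1) dsum[of M]] fin(2) by simp
  have bound: "\<bar>d M k\<bar> \<le> q ^ M * \<bar>d 0 k\<bar>" if "k \<in> grid" for M k
  proof (cases "k = \<delta> \<or> G E k = 0")
    case True
    then show ?thesis by (auto simp: d_def u_def)
  next
    case False
    then have "c0 < S k" using G_support[OF that] by (simp add: S_def)
    then obtain e where e: "S k = c0 + Suc e" by (metis less_imp_Suc_add add_Suc_right)
    have "(q ^ M) ^ Suc e = q ^ M * (q ^ M) ^ e" by simp
    also have "\<dots> \<le> q ^ M * 1"
      using q by (intro mult_left_mono power_le_one) (auto intro: power_le_one)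
    finally have qe: "(q ^ M) ^ Suc e \<le> q ^ M" by simp
    have "d M k = (X * q ^ M) ^ Suc e * G E k" "d 0 k = X ^ Suc e * G E k"
      using False XM[of M] X by (auto simp: d_def u_def e power_add)
    then have "\<bar>d M k\<bar> = (q ^ M) ^ Suc e * \<bar>d 0 k\<bar>"
      using q by (simp add: power_mult_distrib abs_mult mult_ac)
    also have "\<dots> \<le> q ^ M * \<bar>d 0 k\<bar>" by (rule mult_right_mono[OF qe]) simp
    finally show ?thesis .
  qed
  define K where "K = infsum (\<lambda>k. \<bar>d 0 k\<bar>) grid"
  have abs0: "(\<lambda>k. \<bar>d 0 k\<bar>) summable_on grid"
    using dsum[of 0] summable_on_iff_abs_summable_on_real[of "d 0" grid] by simp
  have "\<bar>infsum (d M) grid\<bar> \<le> q ^ M * K" for M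
  proof -
    have a: "(\<lambda>k. \<bar>d M k\<bar>) summable_on grid"
      using dsum[of M] summable_on_iff_abs_summable_on_real[of "d M" grid] by simp
    have "\<bar>infsum (d M) grid\<bar> \<le> infsum (\<lambda>k. \<bar>d M k\<bar>) grid"
      using norm_infsum_bound[of "d M" grid] a by simp
    also have "\<dots> \<le> infsum (\<lambda>k. q ^ M * \<bar>d 0 k\<bar>) grid"
      by (rule infsum_mono[OF a summable_on_cmult_right[OF abs0] bound])
    also have "\<dots> = q ^ M * K" by (simp add: K_def infsum_cmult_right')
    finally show ?thesis .
  qed
  moreover have "(\<lambda>M. q ^ M * K) \<longlonglongrightarrow> 0 * K"
    using q by (intro tendsto_mult LIMSEQ_power_zero tendsto_const) auto
  ultimately have "(\<lambda>M. infsum (d M) grid) \<longlonglongrightarrow> 0"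
    by (intro Lim_null_comparison[of "\<lambda>M. infsum (d M) grid" "\<lambda>M. q ^ M * K"]) auto
  then have "(\<lambda>M. L (X * q ^ M) E / (X * q ^ M) ^ c0 - G E \<delta>) \<longlonglongrightarrow> 0"
    unfolding diff .
  then show ?thesis by (simp add: LIM_zero_iff)
qed

text \<open>Iterating the recursion leads from \<open>X\<close> to \<open>X * q ^ M\<close>. The
  factor \<open>q ^ c0\<close> of each step is the change of the normalising power, the finite
  products converge to infinite ones, and \<open>L_asymptotic\<close> supplies the remaining
  limit.\<close>

theorem L_evaluation:
  assumes X: "0 < X" "X < 1"
  shows "L X E * (\<Prod>i=1..n. qpoch_inf (X * \<alpha> \<eta> i) q) = X ^ c0 * G E \<delta> * (\<Prod>i=1..n. qpoch_inf (X * \<beta> \<eta> i) q)"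
proof -
  have "(\<lambda>M. X ^ c0 * (L (X * q ^ M) E / (X * q ^ M) ^ c0) * (\<Prod>i=1..n. qpoch (X * \<beta> \<eta> i) q M))
      \<longlonglongrightarrow> X ^ c0 * G E \<delta> * (\<Prod>i=1..n. qpoch_inf (X * \<beta> \<eta> i) q)"
    by (intro tendsto_mult tendsto_const L_asymptotic[OF X] tendsto_prod qpoch_tendsto q)
  moreover have "X ^ c0 * (L (X * q ^ M) E / (X * q ^ M) ^ c0) * (\<Prod>i=1..n. qpoch (X * \<beta> \<eta> i) q M) =
      L X E * (\<Prod>i=1..n. qpoch (X * \<alpha> \<eta> i) q M)" for M
  proof -
    have "(X * q ^ M) ^ c0 = X ^ c0 * (q ^ c0) ^ M"
      by (simp add: power_mult_distrib power_mult[symmetric] mult.commute)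
    then have "X ^ c0 * (L (X * q ^ M) E / (X * q ^ M) ^ c0) = L (X * q ^ M) E / (q ^ c0) ^ M"
      using X q by simp
    then have "X ^ c0 * (L (X * q ^ M) E / (X * q ^ M) ^ c0) * (\<Prod>i=1..n. qpoch (X * \<beta> \<eta> i) q M) =
        (L (X * q ^ M) E * (\<Prod>i=1..n. qpoch (X * \<beta> \<eta> i) q M)) / (q ^ c0) ^ M" by simp
    also have "\<dots> = L X E * (\<Prod>i=1..n. qpoch (X * \<alpha> \<eta> i) q M)"
      unfolding L_shift_iter[OF X] using q by simp
    finally show ?thesis .
  qed
  ultimately have "(\<lambda>M. L X E * (\<Prod>i=1..n. qpoch (X * \<alpha> \<eta> i) q M))
      \<longlonglongrightarrow> X ^ c0 * G E \<delta> * (\<Prod>i=1..n. qpoch_inf (X * \<beta> \<eta> i) q)" by simp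
  moreover have "(\<lambda>M. L X E * (\<Prod>i=1..n. qpoch (X * \<alpha> \<eta> i) q M)) \<longlonglongrightarrow> L X E * (\<Prod>i=1..n. qpoch_inf (X * \<alpha> \<eta> i) q)"
    by (intro tendsto_mult tendsto_const tendsto_prod qpoch_tendsto q)
  ultimately show ?thesis by (rule LIMSEQ_unique[rotated])
qed

end

end

section \<open>Gamma factors\<close>

lemma pairs_Suc: "pairs (Suc n) = pairs n \<union> (\<lambda>i. (i, Suc n)) ` {1..n}"
  by (auto simp: pairs_def)

lemma prod_pairs_Suc:
  fixes f :: "nat \<Rightarrow> nat \<Rightarrow> 'a::comm_monoid_mult"
  shows "(\<Prod>(i, j)\<in>pairs (Suc n). f i j) = (\<Prod>(i, j)\<in>pairs n. f i j) * (\<Prod>i=1..n. f i (Suc n))"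
proof -
  have "(\<Prod>(i, j)\<in>pairs (Suc n). f i j) = (\<Prod>(i, j)\<in>pairs n. f i j) * (\<Prod>(i, j)\<in>(\<lambda>i. (i, Suc n)) ` {1..n}. f i j)"
    unfolding pairs_Suc by (rule prod.union_disjoint[OF finite_pairs]) (auto simp: pairs_def)
  also have "(\<Prod>(i, j)\<in>(\<lambda>i. (i, Suc n)) ` {1..n}. f i j) = (\<Prod>i=1..n. f i (Suc n))"
    by (subst prod.reindex) (auto simp: inj_on_def)
  finally show ?thesis .
qed

text \<open>\<open>i - 1\<close> counts the indices below \<open>i\<close>, so the exponents summed
  over all pairs count triples.\<close>

lemma prod_pairs_power:
  fixes c :: real
  shows "(\<Prod>(i, j)\<in>pairs n. c ^ (i - 1)) = c ^ (n choose 3)"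
proof (induction n)
  case 0
  have "pairs 0 = {}" by (auto simp: pairs_def)
  then show ?case by (simp add: numeral_3_eq_3)
next
  case (Suc n)
  have "(\<Sum>i=1..n. i - 1) = n choose 2"
    unfolding One_nat_def sum.atLeast1_atMost_eq by (simp add: lessThan_atLeast0 choose_two Sum_Ico_nat)
  then have "(\<Prod>i=1..n. c ^ (i - 1)) = c ^ (n choose 2)"
    by (simp add: power_sum[symmetric])
  moreover have "Suc n choose 3 = (n choose 2) + (n choose 3)"
    by (simp add: numeral_3_eq_3 numeral_2_eq_2)
  ultimately show ?case unfolding prod_pairs_Suc Suc by (simp add: power_add)
qed

text \<open>For a fixed second index \<open>j\<close> the quotients telescope to
  \<open>g 0 * g 1 / (g (j - 1) * g j)\<close>, and \<open>g (j - 1)\<close> cancels against the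
  separate factor.\<close>

lemma prod_pairs_telescope:
  fixes g :: "nat \<Rightarrow> real"
  assumes nz: "\<And>d. g d \<noteq> 0"
  shows "(\<Prod>i=1..n. g (i - 1)) * (\<Prod>(i, j)\<in>pairs n. g (j - i - 1) / g (j - i + 1)) = (\<Prod>i=1..n. g 0 * g 1 / g i)"
proof (induction n)
  case 0
  have "pairs 0 = {}" by (auto simp: pairs_def)
  then show ?case by simp
next
  case (Suc n)
  have tel: "(\<Prod>d<m. g d / g (Suc (Suc d))) = g 0 * g 1 / (g m * g (Suc m))" for m
    by (induction m) (use nz in \<open>simp_all add: field_simps\<close>)
  have "(\<Prod>i=1..n. g (Suc n - i - 1) / g (Suc n - i + 1)) = (\<Prod>i<n. g (n - Suc i) / g (Suc (Suc (n - Suc i))))"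
    unfolding One_nat_def prod.atLeast1_atMost_eq by (rule prod.cong) (auto simp: Suc_diff_Suc Suc_diff_le)
  also have "\<dots> = (\<Prod>d<n. g d / g (Suc (Suc d)))"
    by (rule prod.nat_diff_reindex)
  finally have e: "(\<Prod>i=1..n. g (Suc n - i - 1) / g (Suc n - i + 1)) = g 0 * g 1 / (g n * g (Suc n))"
    unfolding tel .
  have "(\<Prod>i=1..Suc n. g (i - 1)) * (\<Prod>(i, j)\<in>pairs (Suc n). g (j - i - 1) / g (j - i + 1)) =
      ((\<Prod>i=1..n. g (i - 1)) * (\<Prod>(i, j)\<in>pairs n. g (j - i - 1) / g (j - i + 1))) * (g n * (g 0 * g 1 / (g n * g (Suc n))))"
    unfolding prod_pairs_Suc e by simp
  also have "\<dots> = (\<Prod>i=1..Suc n. g 0 * g 1 / g i)"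
    unfolding Suc using nz by simp
  finally show ?case .
qed

lemma powi_add_nat: "c > 0 \<Longrightarrow> c powi (a + int m) = c powi a * (c :: real) ^ m"
  by (simp add: power_int_add)

lemma pair_factor_eq_qpoch:
  assumes "a \<noteq> 0" "q > 0"
  shows "a ^ (2 * lam) * qpoch (q powi (1 - int lam) * (b / a)) q (2 * lam) = pair_factor q lam a b"
proof -
  have "pair_factor q lam a b = (\<Prod>m<2 * lam. a * (1 - q powi (1 - int lam) * (b / a) * q ^ m))"
    unfolding pair_factor_def
  proof (rule prod.cong[OF refl])
    fix m
    show "a - q powi (1 - int lam + int m) * b = a * (1 - q powi (1 - int lam) * (b / a) * q ^ m)"
      unfolding powi_add_nat[OF assms(2)] using assms(1) by (simp add: field_simps)
  qed
  then show ?thesis by (simp add: qpoch_def prod.distrib)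
qed

text \<open>The balance of the arguments leaves a single factor \<open>1 - q\<close>, because
  \<open>3 - (u1 + u2 + u3)\<close> equals \<open>1 + (1 - u4) + (1 - u5)\<close>.\<close>

lemma qGamma_ratio:
  assumes q: "0 < q" "q < 1"
    and pos: "0 < u1" "0 < u2" "0 < u3" "0 < u4" "0 < u5"
    and sum: "u1 + u2 + u3 = u4 + u5"
  shows "qGamma q u1 * qGamma q u2 * qGamma q u3 / (qGamma q u4 * qGamma q u5) =
    (1 - q) * (qpoch_inf q q * qpoch_inf (q powr u4) q / qpoch_inf (q powr u1) q) *
      (qpoch_inf (q powr u5) q / (qpoch_inf (q powr u2) q * qpoch_inf (q powr u3) q))"
proof -
  have lt: "q powr u < 1" if "0 < u" for u
    using powr01_less_one[of q u] q that by simp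
  have P: "0 < qpoch_inf (q powr u) q" if "0 < u" for u
    using lt[OF that] by (intro qpoch_inf_pos[OF q]) auto
  have Q: "0 < qpoch_inf q q" using q by (intro qpoch_inf_pos[OF q]) auto
  have "(1 - q) powr (1 - u1) * (1 - q) powr (1 - u2) * (1 - q) powr (1 - u3) =
      (1 - q) * ((1 - q) powr (1 - u4) * (1 - q) powr (1 - u5))"
  proof -
    have "(1 - q) powr (1 - u1) * (1 - q) powr (1 - u2) * (1 - q) powr (1 - u3) = (1 - q) powr (3 - (u1 + u2 + u3))"
      by (simp add: powr_add[symmetric] algebra_simps)
    also have "\<dots> = (1 - q) powr 1 * ((1 - q) powr (1 - u4) * (1 - q) powr (1 - u5))"
      unfolding sum powr_add[symmetric] by (simp add: algebra_simps)
    finally show ?thesis using q by simp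
  qed
  then have r: "(1 - q) powr (1 - u1) * (1 - q) powr (1 - u2) * (1 - q) powr (1 - u3) /
      ((1 - q) powr (1 - u4) * (1 - q) powr (1 - u5)) = 1 - q"
    using q by simp
  have "qGamma q u1 * qGamma q u2 * qGamma q u3 / (qGamma q u4 * qGamma q u5) =
    ((1 - q) powr (1 - u1) * (1 - q) powr (1 - u2) * (1 - q) powr (1 - u3) /
      ((1 - q) powr (1 - u4) * (1 - q) powr (1 - u5))) *
    ((qpoch_inf q q / qpoch_inf (q powr u1) q) * (qpoch_inf q q / qpoch_inf (q powr u2) q) *
     (qpoch_inf q q / qpoch_inf (q powr u3) q) /
     ((qpoch_inf q q / qpoch_inf (q powr u4) q) * (qpoch_inf q q / qpoch_inf (q powr u5) q)))"
    by (simp add: qGamma_def mult_ac)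
  also have "\<dots> = (1 - q) * ((qpoch_inf q q * qpoch_inf (q powr u4) q / qpoch_inf (q powr u1) q) *
      (qpoch_inf (q powr u5) q / (qpoch_inf (q powr u2) q * qpoch_inf (q powr u3) q)))"
    unfolding r using P[OF pos(1)] P[OF pos(2)] P[OF pos(3)] P[OF pos(4)] P[OF pos(5)] Q
    by (simp add: field_simps)
  finally show ?thesis by (simp only: mult.assoc)
qed

section \<open>The weight at the dominant grid point\<close>

context qint
begin

lemma multi_qintegral_eq_L:
  assumes X: "0 < X" "X < 1"
    and F: "\<And>k. k \<in> grid \<Longrightarrow> F (pt k) * q ^ (\<Sum>i=1..n. k i) = wgt X k * peval E (pt k)"
  shows "multi_qintegral n q F = (1 - q) ^ n * L X E"
proof -
  have set: "set [1..<Suc n] = {1..n}" by auto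
  have pt: "(\<lambda>l. if l \<in> {1..n} then q ^ k l else 0) = pt k" for k
    by (simp add: pt_def)
  have "(\<lambda>k. F (pt k) * q ^ (\<Sum>i=1..n. k i)) summable_on grid"
    using summable_wgt[of X E] X by (subst summable_on_cong[OF F]) auto
  then have "multi_qintegral n q F = (1 - q) ^ length [1..<Suc n] *
      (\<Sum>\<^sub>\<infinity>k\<in>grid. F (pt k) * q ^ (\<Sum>i=1..n. k i))"
    unfolding multi_qintegral_def
    using qintegral_iter_eq_infsum[of "[1..<Suc n]" q F "\<lambda>_. 0"] q
    unfolding set pt grid_def by simp
  also have "(\<Sum>\<^sub>\<infinity>k\<in>grid. F (pt k) * q ^ (\<Sum>i=1..n. k i)) = L X E"
    unfolding L_def by (rule infsum_cong) (rule F)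
  finally show ?thesis using n1 by simp
qed

text \<open>Up to a power of \<open>1 - q\<close> and the constant \<open>qpoch_inf q q\<close>, the
  reciprocal of \<open>qGamma q (real (lam * d) + 1)\<close>.\<close>

definition gq :: "nat \<Rightarrow> real" where "gq d = qpoch_inf (q ^ (1 + lam * d)) q"

lemma gq_pos: "0 < gq d"
  using q unfolding gq_def by (intro qpoch_inf_pos[OF q]) (auto simp: power_less_one_iff simp del: power_Suc)

text \<open>Here the \<open>q\<close>-Pochhammer symbol starts at \<open>q ^ (1 + lam * d)\<close>
  with \<open>d = j - i - 1\<close> and has \<open>2 * lam\<close> factors, so it is a quotient of
  two infinite ones whose indices differ by two.\<close>

lemma pair_factor_\<delta>:
  assumes "i < j" "1 \<le> i"
  shows "pair_factor q lam (q ^ (lam * (i - 1))) (q ^ (lam * (j - 1))) =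
    (q ^ (2 * lam\<^sup>2)) ^ (i - 1) * (gq (j - i - 1) / gq (j - i + 1))"
proof -
  define d where "d = j - i - 1"
  have d: "j - 1 = (i - 1) + Suc d" "j - i + 1 = Suc (Suc d)" using assms by (auto simp: d_def)
  have "q powi (1 - int lam) * (q ^ (lam * (j - 1)) / q ^ (lam * (i - 1))) = q ^ (1 + lam * d)"
  proof -
    have "q ^ (lam * (j - 1)) / q ^ (lam * (i - 1)) = q ^ (lam * Suc d)"
      using q unfolding d by (simp add: algebra_simps power_add)
    then have "q powi (1 - int lam) * (q ^ (lam * (j - 1)) / q ^ (lam * (i - 1))) = q powi (1 - int lam + int (lam * Suc d))"
      using q by (simp only: powi_add_nat)
    also have "1 - int lam + int (lam * Suc d) = int (1 + lam * d)" by (simp add: algebra_simps)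
    finally show ?thesis by (simp only: power_int_of_nat)
  qed
  then have "pair_factor q lam (q ^ (lam * (i - 1))) (q ^ (lam * (j - 1))) =
      (q ^ (lam * (i - 1))) ^ (2 * lam) * qpoch (q ^ (1 + lam * d)) q (2 * lam)"
    using pair_factor_eq_qpoch[of "q ^ (lam * (i - 1))" q lam "q ^ (lam * (j - 1))"] q by simp
  also have "qpoch (q ^ (1 + lam * d)) q (2 * lam) = gq d / gq (Suc (Suc d))"
  proof -
    have z: "q ^ (1 + lam * d) < 1" "0 \<le> q ^ (1 + lam * d)"
      using q by (auto simp: power_less_one_iff simp del: power_Suc)
    have "(1 + lam * d) + 2 * lam = 1 + lam * Suc (Suc d)" by simp
    then have "q ^ (1 + lam * d) * q ^ (2 * lam) = q ^ (1 + lam * Suc (Suc d))"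
      by (simp only: power_add[symmetric])
    then have "gq d = qpoch (q ^ (1 + lam * d)) q (2 * lam) * gq (Suc (Suc d))"
      unfolding gq_def using qpoch_inf_split[OF q z, of "2 * lam"] by (simp only:)
    then show ?thesis using gq_pos[of "Suc (Suc d)"] by simp
  qed
  also have "(q ^ (lam * (i - 1))) ^ (2 * lam) = (q ^ (2 * lam\<^sup>2)) ^ (i - 1)"
    by (simp add: power_mult[symmetric] power2_eq_square mult_ac)
  finally show ?thesis unfolding d(2) d_def .
qed

lemma vand_\<delta>:
  "vand q lam n (pt \<delta>) = q ^ (2 * lam\<^sup>2 * (n choose 3)) * (\<Prod>(i, j)\<in>pairs n. gq (j - i - 1) / gq (j - i + 1))"
proof -
  have "vand q lam n (pt \<delta>) =
      (\<Prod>(i, j)\<in>pairs n. (q ^ (2 * lam\<^sup>2)) ^ (i - 1) * (gq (j - i - 1) / gq (j - i + 1)))"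
    unfolding vand_def
  proof (rule prod.cong[OF refl], clarify)
    fix i j assume "(i, j) \<in> pairs n"
    then have ij: "1 \<le> i" "i < j" "j \<le> n" by (auto simp: pairs_def)
    then have "pt \<delta> i = q ^ (lam * (i - 1))" "pt \<delta> j = q ^ (lam * (j - 1))"
      by (auto simp: pt_def \<delta>_def)
    then show "pair_factor q lam (pt \<delta> i) (pt \<delta> j) = (q ^ (2 * lam\<^sup>2)) ^ (i - 1) * (gq (j - i - 1) / gq (j - i + 1))"
      using pair_factor_\<delta>[OF ij(2,1)] by simp
  qed
  also have "\<dots> = (\<Prod>(i, j)\<in>pairs n. (q ^ (2 * lam\<^sup>2)) ^ (i - 1)) * (\<Prod>(i, j)\<in>pairs n. gq (j - i - 1) / gq (j - i + 1))"
    unfolding case_prod_beta prod.distrib ..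
  finally show ?thesis unfolding prod_pairs_power by (simp add: power_mult)
qed

text \<open>The numerators of \<open>qw\<close> supply the separate factors for
  \<open>prod_pairs_telescope\<close>; in the denominators the order of the indices is reversed to
  match the gamma functions.\<close>

lemma prod_qw_vand_\<delta>:
  "(\<Prod>i=1..n. qw (\<delta> i)) * vand q lam n (pt \<delta>) =
     q ^ (2 * lam\<^sup>2 * (n choose 3)) * (\<Prod>i=1..n. gq 0 * gq 1 / gq i / qpoch_inf (B * q ^ (lam * (n - i))) q)"
proof -
  have "(\<Prod>i=1..n. qw (\<delta> i)) = (\<Prod>i=1..n. gq (i - 1) / qpoch_inf (B * q ^ (lam * (i - 1))) q)"
    by (rule prod.cong) (auto simp: qw_def \<delta>_def gq_def)
  also have "\<dots> = (\<Prod>i=1..n. gq (i - 1)) / (\<Prod>i=1..n. qpoch_inf (B * q ^ (lam * (i - 1))) q)"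
    by (rule prod_dividef)
  also have "(\<Prod>i=1..n. qpoch_inf (B * q ^ (lam * (i - 1))) q) = (\<Prod>i=1..n. qpoch_inf (B * q ^ (lam * (n - i))) q)"
    unfolding One_nat_def prod.atLeast1_atMost_eq
    using prod.nat_diff_reindex[of "\<lambda>i. qpoch_inf (B * q ^ (lam * i)) q" n] by simp
  finally have "(\<Prod>i=1..n. qw (\<delta> i)) * vand q lam n (pt \<delta>) =
      q ^ (2 * lam\<^sup>2 * (n choose 3)) * (((\<Prod>i=1..n. gq (i - 1)) * (\<Prod>(i, j)\<in>pairs n. gq (j - i - 1) / gq (j - i + 1))) /
        (\<Prod>i=1..n. qpoch_inf (B * q ^ (lam * (n - i))) q))"
    unfolding vand_\<delta> by simp
  also have "(\<Prod>i=1..n. gq (i - 1)) * (\<Prod>(i, j)\<in>pairs n. gq (j - i - 1) / gq (j - i + 1)) = (\<Prod>i=1..n. gq 0 * gq 1 / gq i)"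
    by (rule prod_pairs_telescope) (use gq_pos in \<open>metis less_irrefl\<close>)
  finally show ?thesis by (simp only: prod_dividef)
qed

end

theorem proposition4p11:
  fixes n lam :: nat and q t x y :: real and \<eta> :: "nat \<Rightarrow>\<^sub>0 nat"
  assumes "n \<ge> 1" and "0 < q" and "q < 1" and "t = q ^ lam" and "x > 0" and "y > 0"
    and "Poly_Mapping.keys \<eta> \<subseteq> {1..n}"
  shows "multi_qintegral n q (\<lambda>s.
           (\<Prod>i=1..n. s i powr (x - 1) * (qpoch_inf (q * s i) q / qpoch_inf (q powr y * s i) q)) *
           macdonald_E n \<eta> s q t *
           (\<Prod>i=1..n. \<Prod>j=i+1..n.
              s i ^ (2 * lam) * qpoch (q powi (1 - int lam) * (s j / s i)) q (2 * lam)))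
       = q powr (real lam * x * real (n choose 2) + 2 * real lam ^ 2 * real (n choose 3)) *
         macdonald_E n \<eta> (\<lambda>i. t ^ (i - 1)) q t *
         (\<Prod>i=1..n.
            (qGamma q (real (lam * i) + 1) *
             qGamma q (x + real (lam * (n - i)) + real (partition_of n (Poly_Mapping.lookup \<eta>) i)) *
             qGamma q (y + real (lam * (n - i)))) /
            (qGamma q (real lam + 1) *
             qGamma q (x + y + real lam * (2 * real n - real i - 1)
                       + real (partition_of n (Poly_Mapping.lookup \<eta>) i))))"
proof -
  define X B where "X = q powr x" and "B = q powr y"
  have XB: "0 < X" "X < 1" "0 < B" "B < 1"
    using assms powr01_less_one[of q] by (auto simp: X_def B_def)
  interpret qint n lam q t B
    using assms XB by unfold_locales auto
  have \<eta>: "\<eta> \<in> comps n" using assms(7) by (simp add: comps_def)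
  obtain E where E: "isE \<eta> E" and mE: "\<And>s. macdonald_E n \<eta> s q t = peval E s"
    using macdonald_E_eigenvector[OF assms(1-3) \<eta>, of lam] unfolding assms(4) by blast
  define F where "F = (\<lambda>s. (\<Prod>i=1..n. s i powr (x - 1) * (qpoch_inf (q * s i) q / qpoch_inf (q powr y * s i) q)) *
           macdonald_E n \<eta> s q t *
           (\<Prod>i=1..n. \<Prod>j=i+1..n.
              s i ^ (2 * lam) * qpoch (q powi (1 - int lam) * (s j / s i)) q (2 * lam)))"
  have integrand: "F (pt k) * q ^ (\<Sum>i=1..n. k i) = wgt X k * peval E (pt k)" for k
  proof -
    have "(\<Prod>i=1..n. \<Prod>j=i+1..n. pt k i ^ (2 * lam) * qpoch (q powi (1 - int lam) * (pt k j / pt k i)) q (2 * lam))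
        = (\<Prod>i=1..n. \<Prod>j=i+1..n. pair_factor q lam (pt k i) (pt k j))"
      using q by (intro prod.cong refl pair_factor_eq_qpoch) (auto simp: pt_def)
    also have "\<dots> = vand q lam n (pt k)"
      unfolding vand_def by (rule prod_pairs[symmetric])
    finally have v: "(\<Prod>i=1..n. \<Prod>j=i+1..n. pt k i ^ (2 * lam) * qpoch (q powi (1 - int lam) * (pt k j / pt k i)) q (2 * lam))
        = vand q lam n (pt k)" .
    define A where "A = (\<Prod>i=1..n. pt k i powr (x - 1) * (qpoch_inf (q * pt k i) q / qpoch_inf (q powr y * pt k i) q))"
    have "A * q ^ (\<Sum>i=1..n. k i)
        = (\<Prod>i=1..n. pt k i powr (x - 1) * (qpoch_inf (q * pt k i) q / qpoch_inf (q powr y * pt k i) q) * q ^ k i)"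
      unfolding A_def power_sum by (rule prod.distrib[symmetric])
    also have "\<dots> = (\<Prod>i=1..n. X ^ k i * qw (k i))"
    proof (rule prod.cong[OF refl])
      fix i assume i: "i \<in> {1..n}"
      have "(q ^ k i) powr (x - 1) * q ^ k i = (q ^ k i) powr x"
        using q powr_add[of "q ^ k i" "x - 1" 1] by simp
      also have "\<dots> = X ^ k i"
        using q by (simp add: X_def powr_powr powr_realpow[symmetric] mult.commute)
      finally have "(q ^ k i) powr (x - 1) * q ^ k i = X ^ k i" .
      then show "pt k i powr (x - 1) * (qpoch_inf (q * pt k i) q / qpoch_inf (q powr y * pt k i) q) * q ^ k i = X ^ k i * qw (k i)"
        using i by (simp add: pt_def qw_def B_def[symmetric] mult_ac)
    qed
    finally have W: "A * q ^ (\<Sum>i=1..n. k i) = (\<Prod>i=1..n. X ^ k i * qw (k i))" .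
    have "F (pt k) * q ^ (\<Sum>i=1..n. k i) = (A * q ^ (\<Sum>i=1..n. k i)) * vand q lam n (pt k) * peval E (pt k)"
      unfolding F_def v mE A_def[symmetric] by (simp only: mult_ac)
    then show ?thesis unfolding W wgt_def .
  qed
  define p where "p = partition_of n (lookup \<eta>)"
  have ev: "peval E (pt \<delta>) = macdonald_E n \<eta> (\<lambda>i. t ^ (i - 1)) q t"
    unfolding mE
  proof (rule peval_cong_comps)
    show "keys E \<subseteq> comps n" using E by (auto simp: isE_def low_set_def)
    show "pt \<delta> i = t ^ (i - 1)" if "i \<in> {1..n}" for i
      using that by (simp add: pt_def \<delta>_def t power_mult)
  qed
  have \<alpha>: "X * \<alpha> \<eta> i = q powr (x + real (lam * (n - i)) + real (p i))" for i
  proof -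
    have "q ^ (part \<eta> i + lam * (n - i)) = q powr (real (lam * (n - i)) + real (p i))"
      using q by (simp add: powr_realpow[symmetric] part_def p_def add.commute)
    then show ?thesis by (simp add: \<alpha>_def X_def powr_add add.assoc)
  qed
  have \<beta>: "X * \<beta> \<eta> i = q powr (x + y + real lam * (2 * real n - real i - 1) + real (p i))" if "i \<in> {1..n}" for i
  proof -
    have "real (2 * n - 1 - i) = 2 * real n - real i - 1"
      using that by (simp add: of_nat_diff)
    then have "real (lam * (2 * n - 1 - i)) = real lam * (2 * real n - real i - 1)"
      by (simp only: of_nat_mult)
    then have "q ^ (part \<eta> i + lam * (2 * n - 1 - i)) = q powr (real lam * (2 * real n - real i - 1) + real (p i))"
      using q by (simp only: powr_realpow[symmetric] part_def p_def of_nat_add add.commute)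
    then show ?thesis unfolding \<beta>_def by (simp add: X_def B_def powr_add add.assoc mult.assoc)
  qed
  have \<gamma>: "B * q ^ (lam * (n - i)) = q powr (y + real (lam * (n - i)))" for i
    using q by (simp add: B_def powr_add powr_realpow[symmetric])
  have g: "gq d = qpoch_inf (q powr (real (lam * d) + 1)) q" for d
  proof -
    have "q ^ (1 + lam * d) = q powr real (1 + lam * d)"
      using q by (simp only: powr_realpow)
    then show ?thesis by (simp add: gq_def add.commute)
  qed
  have g0: "gq 0 = qpoch_inf q q" and g1: "gq 1 = qpoch_inf (q powr (real lam + 1)) q"
    using g[of 0] g[of 1] q by simp_all
  have a_pos: "0 < qpoch_inf (X * \<alpha> \<eta> i) q" for i
  proof -
    define u where "u = x + real (lam * (n - i)) + real (p i)"
    have "0 < u" unfolding u_def using assms(5) by (intro add_pos_nonneg) auto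
    then have "q powr u < 1" using powr01_less_one[of q u] q by simp
    then show ?thesis
      unfolding \<alpha> u_def[symmetric] by (intro qpoch_inf_pos[OF q]) auto
  qed
  define C where "C = q powr (real lam * x * real (n choose 2) + 2 * real lam ^ 2 * real (n choose 3))"
  have C: "C = X ^ (lam * (n choose 2)) * q ^ (2 * lam\<^sup>2 * (n choose 3))"
  proof -
    have "X ^ (lam * (n choose 2)) = q powr (real lam * x * real (n choose 2))"
      using q by (simp add: X_def powr_powr powr_realpow[symmetric] mult_ac)
    moreover have "q ^ (2 * lam\<^sup>2 * (n choose 3)) = q powr (2 * real lam ^ 2 * real (n choose 3))"
      using q by (simp add: powr_realpow[symmetric])
    ultimately show ?thesis by (simp add: C_def powr_add)
  qed
  have "L X E = X ^ (lam * (n choose 2)) * G E \<delta> * (\<Prod>i=1..n. qpoch_inf (X * \<beta> \<eta> i) q)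
      / (\<Prod>i=1..n. qpoch_inf (X * \<alpha> \<eta> i) q)"
  proof -
    have "(\<Prod>i=1..n. qpoch_inf (X * \<alpha> \<eta> i) q) > 0"
      by (rule prod_pos) (rule a_pos)
    then have "(\<Prod>i=1..n. qpoch_inf (X * \<alpha> \<eta> i) q) \<noteq> 0" by (rule less_imp_neq[symmetric])
    then show ?thesis
      by (rule nonzero_eq_divide_eq[THEN iffD2]) (rule L_evaluation[OF \<eta> E XB(1,2)])
  qed
  also have "G E \<delta> = q ^ (2 * lam\<^sup>2 * (n choose 3)) *
      (\<Prod>i=1..n. gq 0 * gq 1 / gq i / qpoch_inf (B * q ^ (lam * (n - i))) q) * peval E (pt \<delta>)"
    unfolding G_def prod_qw_vand_\<delta> ..
  finally have LE: "L X E = C * peval E (pt \<delta>) *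
      ((\<Prod>i=1..n. gq 0 * gq 1 / gq i / qpoch_inf (B * q ^ (lam * (n - i))) q) *
       ((\<Prod>i=1..n. qpoch_inf (X * \<beta> \<eta> i) q) / (\<Prod>i=1..n. qpoch_inf (X * \<alpha> \<eta> i) q)))"
    unfolding C by (simp add: mult_ac)
  \<comment> \<open>One factor of the result up to \<open>1 - q\<close>: the power
    \<open>(1 - q) ^ n\<close> of the iterated \<open>q\<close>-integral is distributed over the
    \<open>n\<close> gamma quotients.\<close>
  define R where "R = (\<lambda>i. gq 0 * gq 1 / gq i / qpoch_inf (B * q ^ (lam * (n - i))) q *
      (qpoch_inf (X * \<beta> \<eta> i) q / qpoch_inf (X * \<alpha> \<eta> i) q))"
  have LR: "L X E = C * peval E (pt \<delta>) * (\<Prod>i=1..n. R i)"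
    unfolding LE R_def prod.distrib prod_dividef ..
  have "(1 - q) * R i = (qGamma q (real (lam * i) + 1) *
             qGamma q (x + real (lam * (n - i)) + real (p i)) * qGamma q (y + real (lam * (n - i)))) /
            (qGamma q (real lam + 1) *
             qGamma q (x + y + real lam * (2 * real n - real i - 1) + real (p i)))" if i: "i \<in> {1..n}" for i
  proof -
    have ni: "real (n - i) = real n - real i" using i by (simp add: of_nat_diff)
    have "qGamma q (real (lam * i) + 1) *
             qGamma q (x + real (lam * (n - i)) + real (p i)) * qGamma q (y + real (lam * (n - i))) /
            (qGamma q (real lam + 1) *
             qGamma q (x + y + real lam * (2 * real n - real i - 1) + real (p i))) =
      (1 - q) * (gq 0 * gq 1 / gq i) * (qpoch_inf (X * \<beta> \<eta> i) q /
        (qpoch_inf (X * \<alpha> \<eta> i) q * qpoch_inf (B * q ^ (lam * (n - i))) q))"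
      unfolding \<alpha> \<beta>[OF i] \<gamma> g0 g1 g[of i]
    proof (rule qGamma_ratio[OF q])
      have "0 \<le> real lam * (2 * real n - real i - 1)" using i by (intro mult_nonneg_nonneg) auto
      then show "0 < x + y + real lam * (2 * real n - real i - 1) + real (p i)"
        using assms(5,6) by linarith
      show "real (lam * i) + 1 + (x + real (lam * (n - i)) + real (p i)) + (y + real (lam * (n - i))) =
          real lam + 1 + (x + y + real lam * (2 * real n - real i - 1) + real (p i))"
        unfolding of_nat_mult ni by (simp add: algebra_simps)
    qed (use assms(5,6) in \<open>auto intro: add_pos_nonneg add_nonneg_pos add_pos_nonneg[OF add_pos_nonneg]\<close>)
    then show ?thesis by (simp add: R_def mult_ac)
  qed
  then have "(\<Prod>i=1..n. (1 - q) * R i) = (\<Prod>i=1..n.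
            (qGamma q (real (lam * i) + 1) *
             qGamma q (x + real (lam * (n - i)) + real (p i)) * qGamma q (y + real (lam * (n - i)))) /
            (qGamma q (real lam + 1) *
             qGamma q (x + y + real lam * (2 * real n - real i - 1) + real (p i))))"
    by (rule prod.cong[OF refl])
  moreover have "(\<Prod>i=1..n. (1 - q) * R i) = (1 - q) ^ n * (\<Prod>i=1..n. R i)"
    by (simp add: prod.distrib)
  moreover have "multi_qintegral n q F = (1 - q) ^ n * L X E"
    by (rule multi_qintegral_eq_L[OF XB(1,2) integrand])
  ultimately have "multi_qintegral n q F = C * macdonald_E n \<eta> (\<lambda>i. t ^ (i - 1)) q t * (\<Prod>i=1..n.
            (qGamma q (real (lam * i) + 1) *
             qGamma q (x + real (lam * (n - i)) + real (p i)) * qGamma q (y + real (lam * (n - i)))) /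
            (qGamma q (real lam + 1) *
             qGamma q (x + y + real lam * (2 * real n - real i - 1) + real (p i))))"
    unfolding LR ev by (simp add: mult_ac)
  then show ?thesis unfolding F_def C_def p_def .
qed

end
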